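(* Consider $SO(N)$ lattice gauge theory on $\mathbb{Z}^2$ in the strong coupling regime $|\beta|<\beta_0$. For every loop $\ell$ there exists $k_0=k_0(\ell)$ such that $a_k(\ell)=0$ for all $k>k_0$; that is, $$w(\ell,\beta)=\sum_{k=0}^{k_0}a_k(\ell)\beta^k .$$
   Context: Model. $E$ is the set of directed nearest-neighbour edges of $\mathbb{Z}^2$; $e^{-1}$ is the reversal of $e$; $E^+$ is the set of positively oriented edges (ending point larger than starting point in the lexicographic order). A plaquette $p=e_1e_2e_3e_4$ is a closed walk of length four around a unit square (four distinct edges), identified up to cyclic permutation; it is positively oriented if its smallest and second smallest vertices (lexicographically) occur in that order. For finite $\Lambda\subset\mathbb{Z}^2$, $E_\Lambda^+$ is the set of edges of $E^+$ with both endpoints in $\Lambda$, and $\mathcal{P}_\Lambda^+$ is the set of positively oriented plaquettes with all edges in $\Lambda$. For $N\ge 1$, $\beta\in\mathbb{R}$, the Gibbs measure $\mu_{\Lambda,N,\beta}$ is the probability measure on configurations $Q=(Q_e)_{e\in E_\Lambda^+}\in SO(N)^{E_\Lambda^+}$ whose density with respect to product Haar probability measure is $Z_{\Lambda,N,\beta}^{-1}\exp\big(N\beta\sum_{p\in\mathcal{P}_\Lambda^+}\mathrm{Tr}(Q_p)\big)$, where $Q_{e^{-1}}=Q_e^{-1}$ and $Q_p=Q_{e_1}Q_{e_2}Q_{e_3}Q_{e_4}$. Expectation is denoted $\langle\cdot\rangle_{\Lambda,N,\beta}$. Loops. A loop $\ell=e_1\cdots e_n$ is a non-backtracking closed walk;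 $W_\ell=\mathrm{Tr}(Q_{e_1}\cdots Q_{e_n})$. Strong coupling regime. Fix finite sets $\Lambda_1\subset\Lambda_2\subset\cdots$ with union $\mathbb{Z}^2$. By a theorem of Chatterjee there is $\beta_0>0$ such that for $|\beta|<\beta_0$ and every loop $\ell$ the limit $w(\ell,\beta)=\lim_N\langle W_\ell\rangle_{\Lambda_N,N,\beta}/N$ exists (independently of the choice of $(\Lambda_N)$), normalized expectations of products of Wilson loop variables factorize as $N\to\infty$, and $w(\ell,\beta)=\sum_{k\ge0}a_k(\ell)\beta^k$ is an absolutely convergent power series, which defines the coefficients $a_k(\ell)$. $\beta_0$ denotes such a constant. *)

theory Defs
  imports
    "HOL-Probability.Probability"
    "HOL-Algebra.Coset"
    "Jordan_Normal_Form.Determinant"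
begin

section \<open>The group \<open>SO(N)\<close> and its Haar probability measure\<close>

text \<open>
  The matrix size \<open>N\<close> tends to infinity, so it cannot be a type; matrices are those of
  \<open>Jordan_Normal_Form\<close>, whose dimensions are values.
\<close>

definition SO :: "nat \<Rightarrow> real mat monoid" where
  "SO N = \<lparr>carrier = {A \<in> carrier_mat N N. transpose_mat A * A = 1\<^sub>m N \<and> Determinant.det A = 1},
           mult = (*), one = 1\<^sub>m N\<rparr>"

definition mat_trace :: "real mat \<Rightarrow> real" where
  "mat_trace A = (\<Sum>i<dim_row A. A $$ (i, i))"

text \<open>
  The Borel sigma-algebra of \<open>SO(N)\<close>: the restriction to \<open>SO(N)\<close> of the Borel sigma-algebra of
  \<open>N \<times> N\<close> matrices, which is the product sigma-algebra in the matrix entries.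
\<close>

definition SO_borel :: "nat \<Rightarrow> real mat measure" where
  "SO_borel N = vimage_algebra (carrier (SO N))
     (\<lambda>A. \<lambda>ij \<in> {..<N} \<times> {..<N}. A $$ ij) (Pi\<^sub>M ({..<N} \<times> {..<N}) (\<lambda>_. borel))"

definition is_haar_prob :: "nat \<Rightarrow> real mat measure \<Rightarrow> bool" where
  "is_haar_prob N \<mu> \<longleftrightarrow>
     prob_space \<mu> \<and> sets \<mu> = sets (SO_borel N) \<and>
     (\<forall>g \<in> carrier (SO N). \<forall>S \<in> sets \<mu>. emeasure \<mu> (g <#\<^bsub>SO N\<^esub> S) = emeasure \<mu> S)"


section \<open>Edges, plaquettes and loops of the square lattice\<close>

type_synonym vertex = "int \<times> int"
type_synonym edge = "vertex \<times> vertex"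

definition edges :: "edge set" where
  "edges = {(u, v). \<bar>fst u - fst v\<bar> + \<bar>snd u - snd v\<bar> = 1}"

definition reversal :: "edge \<Rightarrow> edge" where
  "reversal e = (snd e, fst e)"

definition lex_less :: "vertex \<Rightarrow> vertex \<Rightarrow> bool" where
  "lex_less u v \<longleftrightarrow> fst u < fst v \<or> fst u = fst v \<and> snd u < snd v"

definition pos_edges :: "edge set" where
  "pos_edges = {e \<in> edges. lex_less (fst e) (snd e)}"

definition pos_edges_in :: "vertex set \<Rightarrow> edge set" where
  "pos_edges_in \<Lambda> = pos_edges \<inter> \<Lambda> \<times> \<Lambda>"

definition closed_walk :: "edge list \<Rightarrow> bool" where
  "closed_walk p \<longleftrightarrow> set p \<subseteq> edges \<and>
     (\<forall>i < length p. snd (p ! i) = fst (p ! (Suc i mod length p)))"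

text \<open>
  Backtracking is understood cyclically: the last edge is followed by the first one.
  The empty walk is admitted (the null loop).
\<close>

definition is_loop :: "edge list \<Rightarrow> bool" where
  "is_loop p \<longleftrightarrow> closed_walk p \<and>
     (\<forall>i < length p. p ! (Suc i mod length p) \<noteq> reversal (p ! i))"

definition is_plaquette :: "edge list \<Rightarrow> bool" where
  "is_plaquette p \<longleftrightarrow> closed_walk p \<and> length p = 4 \<and>
     (\<exists>x y. fst ` set p = {x, x + 1} \<times> {y, y + 1})"

text \<open>
  Plaquettes are identified up to cyclic permutation. Each class is represented by its unique
  member that starts at the lexicographically smallest vertex; it is positively oriented iff
  the second smallest vertex comes next.
\<close>

definition pos_plaquettes_in :: "vertex set \<Rightarrow> edge list set" where
  "pos_plaquettes_in \<Lambda> = {p. is_plaquette p \<and> set p \<subseteq> \<Lambda> \<times> \<Lambda> \<and>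
     (let v0 = fst (p ! 0); v1 = fst (p ! 1) in
        (\<forall>v \<in> fst ` set p - {v0}. lex_less v0 v) \<and>
        (\<forall>v \<in> fst ` set p - {v0, v1}. lex_less v1 v))}"


section \<open>The Gibbs measure and Wilson loop expectations\<close>

text \<open>A configuration assigns matrices to positively oriented edges only.\<close>

definition edge_matrix :: "nat \<Rightarrow> (edge \<Rightarrow> real mat) \<Rightarrow> edge \<Rightarrow> real mat" where
  "edge_matrix N Q e = (if e \<in> pos_edges then Q e else inv\<^bsub>SO N\<^esub> (Q (reversal e)))"

definition walk_matrix :: "nat \<Rightarrow> (edge \<Rightarrow> real mat) \<Rightarrow> edge list \<Rightarrow> real mat" where
  "walk_matrix N Q p = foldr (\<lambda>e A. edge_matrix N Q e \<otimes>\<^bsub>SO N\<^esub> A) p \<one>\<^bsub>SO N\<^esub>"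

definition wilson :: "nat \<Rightarrow> edge list \<Rightarrow> (edge \<Rightarrow> real mat) \<Rightarrow> real" where
  "wilson N p Q = mat_trace (walk_matrix N Q p)"

text \<open>In the following, \<open>haar N\<close> is meant to be the Haar probability measure of \<open>SO(N)\<close>.\<close>

definition config_measure ::
    "(nat \<Rightarrow> real mat measure) \<Rightarrow> vertex set \<Rightarrow> nat \<Rightarrow> (edge \<Rightarrow> real mat) measure" where
  "config_measure haar \<Lambda> N = Pi\<^sub>M (pos_edges_in \<Lambda>) (\<lambda>_. haar N)"

definition boltzmann :: "vertex set \<Rightarrow> nat \<Rightarrow> real \<Rightarrow> (edge \<Rightarrow> real mat) \<Rightarrow> real" where
  "boltzmann \<Lambda> N \<beta> Q = exp (real N * \<beta> * (\<Sum>p \<in> pos_plaquettes_in \<Lambda>. wilson N p Q))"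

definition partition_function ::
    "(nat \<Rightarrow> real mat measure) \<Rightarrow> vertex set \<Rightarrow> nat \<Rightarrow> real \<Rightarrow> real" where
  "partition_function haar \<Lambda> N \<beta> = (\<integral>Q. boltzmann \<Lambda> N \<beta> Q \<partial>config_measure haar \<Lambda> N)"

definition gibbs ::
    "(nat \<Rightarrow> real mat measure) \<Rightarrow> vertex set \<Rightarrow> nat \<Rightarrow> real \<Rightarrow> (edge \<Rightarrow> real mat) measure" where
  "gibbs haar \<Lambda> N \<beta> = density (config_measure haar \<Lambda> N)
     (\<lambda>Q. ennreal (boltzmann \<Lambda> N \<beta> Q / partition_function haar \<Lambda> N \<beta>))"

definition gibbs_expectation ::
    "(nat \<Rightarrow> real mat measure) \<Rightarrow> vertex set \<Rightarrow> nat \<Rightarrow> real \<Rightarrow> ((edge \<Rightarrow> real mat) \<Rightarrow> real) \<Rightarrow> real"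
  where
  "gibbs_expectation haar \<Lambda> N \<beta> f = (\<integral>Q. f Q \<partial>gibbs haar \<Lambda> N \<beta>)"


section \<open>The strong coupling regime\<close>

definition exhaustion :: "(nat \<Rightarrow> vertex set) \<Rightarrow> bool" where
  "exhaustion \<Lambda> \<longleftrightarrow> (\<forall>N. finite (\<Lambda> N)) \<and> incseq \<Lambda> \<and> (\<Union>N. \<Lambda> N) = UNIV"

text \<open>
  \<open>\<beta>\<^sub>0\<close> is a constant as provided by Chatterjee's theorem, with limiting normalized Wilson loop
  expectations \<open>w\<close> and power series coefficients \<open>a\<close>. The conditions determine \<open>w\<close> on loops for
  \<open>\<bar>\<beta>\<bar> < \<beta>\<^sub>0\<close>, as a limit, and \<open>a\<close> on loops, by uniqueness of power series coefficients.
\<close>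

definition strong_coupling ::
    "(nat \<Rightarrow> real mat measure) \<Rightarrow> real \<Rightarrow> (edge list \<Rightarrow> real \<Rightarrow> real) \<Rightarrow> (edge list \<Rightarrow> nat \<Rightarrow> real) \<Rightarrow> bool"
  where
  "strong_coupling haar \<beta>\<^sub>0 w a \<longleftrightarrow> \<beta>\<^sub>0 > 0 \<and>
     (\<forall>\<beta>. \<bar>\<beta>\<bar> < \<beta>\<^sub>0 \<longrightarrow>
        (\<forall>\<Lambda> l. exhaustion \<Lambda> \<and> is_loop l \<longrightarrow>
           (\<lambda>N. gibbs_expectation haar (\<Lambda> N) N \<beta> (wilson N l) / real N) \<longlonglongrightarrow> w l \<beta>) \<and>
        (\<forall>\<Lambda> ls. exhaustion \<Lambda> \<and> (\<forall>l \<in> set ls. is_loop l) \<longrightarrow>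
           (\<lambda>N. gibbs_expectation haar (\<Lambda> N) N \<beta> (\<lambda>Q. \<Prod>l\<leftarrow>ls. wilson N l Q) / real N ^ length ls)
             \<longlonglongrightarrow> (\<Prod>l\<leftarrow>ls. w l \<beta>)) \<and>
        (\<forall>l. is_loop l \<longrightarrow>
           summable (\<lambda>k. \<bar>a l k * \<beta> ^ k\<bar>) \<and> w l \<beta> = (\<Sum>k. a l k * \<beta> ^ k)))"

end

theory Submission
  imports Defs
begin

text \<open>
  In the plane the loop group is freely generated by the lassos around the plaquettes. The
  Schwinger--Dyson equations of the horizontal edges in the column above a plaquette telescope, as
  nothing lies above the top row of a box, to an equation for words in lassos in which only one
  lasso \<open>Y\<close> occurs as a deformation. In the limit, for words \<open>u\<close> without higher lassos and with \<open>Y'\<close>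
  inverse to \<open>Y\<close>,
  \<open>\<Sum>\<^bsub>u = P Y C\<^esub> w(P) w(Y C) - \<Sum>\<^bsub>u = B Y' S\<^esub> w(B Y') w(S) = \<beta> (w(Y' u) - w(Y u))\<close>.

  For powers of \<open>Y\<close> this determines the power series: \<open>w(Y) = \<beta>\<close> and \<open>w(Y\<^sup>m) = 0\<close> for \<open>m \<ge> 2\<close>. Then
  \<open>x\<^sub>m = w(Y\<^sup>m A)\<close> satisfies \<open>x\<^sub>m + \<beta> x\<^sub>m\<^sub>+\<^sub>1 = - S\<^sub>m\<close> for \<open>m \<ge> 2\<close>, where \<open>S\<^sub>m\<close> only involves
  words shorter than \<open>A\<close>. By induction on the length of \<open>A\<close>, \<open>S\<^sub>m\<close> vanishes for large \<open>m\<close>; hence so does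
  \<open>x\<^sub>m\<close>, which is divisible by every power of \<open>\<beta>\<close>, and descending in \<open>m\<close> all \<open>x\<^sub>m\<close> are polynomials.
\<close>

text \<open>The obstacle is that a loop equation at a single edge relates a loop to its deformations
  by both adjacent plaquettes, which can be longer loops; it yields coefficients order by order, but
  no reason for the series to stop. With lassos as letters a deformation is multiplication by a
  letter. For \<open>Y^m A\<close> with m >= 2, the deformation by the inverse letter is cancelled
  exactly by the splitting that cuts off a single \<open>Y\<close>, because w(Y) = \<beta>. What
  remains points upwards in m only. This recursion does not reach m = 0. There a word containing the
  letter is rotated, or inverted and rotated, until the letter comes first, which is m = 1 for a
  shorter word. Words without the letter are left to an induction over the set of letters, in which
  a letter of the highest row is adjoined last. On the orthogonal group the equation in a finite box
  also contains single traces of one piece times the reversal of the other. They carry one factor N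
  less than the products of traces and disappear in the limit.\<close>

section \<open>Words and the limiting master loop equation\<close>

text \<open>
  When the letter \<open>e\<close> is varied to \<open>(1 + t X) e\<close>, and hence its inverse \<open>r e\<close> to \<open>r e (1 - t X)\<close>,
  the derivative of a word is the signed sum of \<open>P X S\<close> over its cuts \<open>(s, P, S)\<close>.
\<close>

fun cuts :: "('a \<Rightarrow> 'a) \<Rightarrow> 'a \<Rightarrow> 'a list \<Rightarrow> (real \<times> 'a list \<times> 'a list) list" where
  "cuts r e [] = []"
| "cuts r e (c # w) = (if c = e then [(1, [], c # w)] else []) @
     (if c = r e then [(-1, [c], w)] else []) @ map (\<lambda>(s, P, S). (s, c # P, S)) (cuts r e w)"

lemma cuts_append:
  "cuts r e (u @ v) = map (\<lambda>(s, P, S). (s, P, S @ v)) (cuts r e u) @ map (\<lambda>(s, P, S). (s, u @ P,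
      S)) (cuts r e v)"
  by (induction u) (auto simp: case_prod_unfold o_def)

lemma cuts_concat: "(s, P, S) \<in> set (cuts r e w) \<Longrightarrow> P @ S = w"
  by (induction w arbitrary: s P S) (auto split: if_splits)

lemma cuts_eq_Nil: "e \<notin> set w \<Longrightarrow> r e \<notin> set w \<Longrightarrow> cuts r e w = []"
  by (induction w) auto

lemma cuts_cases:
  assumes "(s, P, S) \<in> set (cuts r e w)"
  obtains B C where "w = B @ e # C" "P = B" "S = e # C" "s = 1"
  | B C where "w = B @ r e # C" "P = B @ [r e]" "S = C" "s = -1"
  using assms
proof (induction w arbitrary: s P S thesis)
  case (Cons c w)
  from Cons.prems(3) consider "c = e" "s = 1" "P = []" "S = c # w"
    | "c = r e" "s = -1" "P = [c]" "S = w"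
    | P' where "(s, P', S) \<in> set (cuts r e w)" "P = c # P'"
    by (auto split: if_splits)
  then show ?case
  proof cases
    case 1 then show ?thesis using Cons.prems(1)[of "[]" w] by simp
  next
    case 2 then show ?thesis using Cons.prems(2)[of "[]" w] by simp
  next
    case 3
    show ?thesis
    proof (rule Cons.IH[OF _ _ 3(1)])
      fix B C assume "w = B @ e # C" "P' = B" "S = e # C" "s = 1"
      then show thesis using Cons.prems(1)[of "c # B" C] 3(2) by simp
    next
      fix B C assume "w = B @ r e # C" "P' = B @ [r e]" "S = C" "s = -1"
      then show thesis using Cons.prems(2)[of "c # B" C] 3(2) by simp
    qed
  qed
qed simp

definition winv :: "('a \<Rightarrow> 'a) \<Rightarrow> 'a list \<Rightarrow> 'a list" where
  "winv r w = rev (map r w)"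

text \<open>A letter is a generator with a sign. Words are not freely reduced; cancellation is
  imposed on the functions of words instead.\<close>

definition flip :: "'l \<times> bool \<Rightarrow> 'l \<times> bool" where
  "flip c = (fst c, \<not> snd c)"

section \<open>Polynomials among formal power series\<close>

definition fps_poly :: "real fps \<Rightarrow> bool" where
  "fps_poly f \<longleftrightarrow> f \<in> range fps_of_poly"

lemma fps_poly_of_poly: "fps_poly (fps_of_poly p)"
  by (simp add: fps_poly_def)

lemma fps_poly_intros [intro]:
  "fps_poly 0" "fps_poly 1" "fps_poly fps_X" "fps_poly (fps_const c)"
  "fps_poly f \<Longrightarrow> fps_poly (- f)"
  "fps_poly f \<Longrightarrow> fps_poly g \<Longrightarrow> fps_poly (f + g)"
  "fps_poly f \<Longrightarrow> fps_poly g \<Longrightarrow> fps_poly (f - g)"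
  "fps_poly f \<Longrightarrow> fps_poly g \<Longrightarrow> fps_poly (f * g)"
  using fps_poly_of_poly[of 0] fps_poly_of_poly[of 1] fps_poly_of_poly[of "[:0, 1:]"]
    fps_poly_of_poly[of "[:c:]"]
  by (simp_all add: fps_of_poly_fps_X fps_of_poly_const)
    (auto simp: fps_poly_def simp flip: fps_of_poly_add fps_of_poly_diff fps_of_poly_mult
      fps_of_poly_uminus)

lemma fps_poly_sum_list: "(\<And>x. x \<in> set xs \<Longrightarrow> fps_poly (f x)) \<Longrightarrow> fps_poly (\<Sum>x\<leftarrow>xs. f x)"
  by (induction xs) auto

lemma fps_poly_bound: "fps_poly f \<Longrightarrow> \<exists>d. \<forall>k>d. fps_nth f k = 0"
  unfolding fps_poly_def by (metis coeff_eq_0 fps_of_poly_nth rangeE)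

text \<open>The index m runs away upwards, so the induction is on the coefficient: coefficient n at
  m is minus coefficient n - 1 at m + 1.\<close>

lemma fps_shift_eq_zero:
  fixes x :: "nat \<Rightarrow> real fps"
  assumes "\<And>m. m \<ge> M \<Longrightarrow> x m = - fps_X * x (Suc m)" and "m \<ge> M"
  shows "x m = 0"
proof (rule fps_ext)
  fix n show "fps_nth (x m) n = fps_nth 0 n"
    using assms(2)
  proof (induction n arbitrary: m)
    case 0 then show ?case by (simp add: assms(1)[of m])
  next
    case (Suc n) then show ?case by (simp add: assms(1)[of m])
  qed
qed

lemma fps_mult_nth_cong:
  fixes f g f' g' :: "'a :: comm_ring_1 fps"
  assumes "\<And>i. i \<le> n \<Longrightarrow> fps_nth f i = fps_nth f' i" "\<And>i. i \<le> n \<Longrightarrow> fps_nth g i = fps_nth g' i"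
  shows "fps_nth (f * g) n = fps_nth (f' * g') n"
  unfolding fps_mult_nth using assms by (intro sum.cong) auto

lemma fps_X_mult_nth_cong:
  fixes f g :: "'a :: comm_ring_1 fps"
  assumes "\<And>i. i < n \<Longrightarrow> fps_nth f i = fps_nth g i"
  shows "fps_nth (fps_X * f) n = fps_nth (fps_X * g) n"
  using assms by (cases n) auto

section \<open>The recursion for the powers of one lasso\<close>

text \<open>The term k = 0 is the unknown of index m itself, and the other products have both
  indices strictly between 0 and m. The larger index m + 1 on the right comes with a factor X, hence
  only with lower coefficients. So a lexicographic induction on (n, m) determines
  everything.\<close>

lemma gww_recursion_unique:
  fixes w t :: "nat \<Rightarrow> real fps"
  assumes w: "\<And>m. m \<ge> 1 \<Longrightarrow> (\<Sum>k<m. w k * w (m - k)) = fps_X * (w (m - 1) - w (m + 1))"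
    and t: "\<And>m. m \<ge> 1 \<Longrightarrow> (\<Sum>k<m. t k * t (m - k)) = fps_X * (t (m - 1) - t (m + 1))"
    and "w 0 = 1" "t 0 = 1"
  shows "w m = t m"
proof (rule fps_ext)
  have split: "(\<Sum>k<m. v k * v (m - k)) = v m + (\<Sum>k\<in>{1..<m}. v k * v (m - k))"
    if "v 0 = 1" "m \<ge> 1" for v :: "nat \<Rightarrow> real fps" and m
    using that by (simp add: lessThan_atLeast0 sum.atLeast_Suc_lessThan)
  fix n show "fps_nth (w m) n = fps_nth (t m) n"
  proof (induction n arbitrary: m rule: less_induct)
    case (less n)
    show ?case
    proof (induction m rule: less_induct)
      case IH: (less m)
      have lt: "fps_nth (w m') i = fps_nth (t m') i" if "m' < m" "i \<le> n" for m' i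
        using IH[OF that(1)] less[of i m'] that(2) by (cases "i = n") auto
      show ?case
      proof (cases "m = 0")
        case False
        then have m: "m \<ge> 1" by simp
        have ew: "w m = fps_X * (w (m - 1) - w (m + 1)) - (\<Sum>k\<in>{1..<m}. w k * w (m - k))"
          using w[OF m] split[of w, OF assms(3) m] by (simp add: algebra_simps)
        have et: "t m = fps_X * (t (m - 1) - t (m + 1)) - (\<Sum>k\<in>{1..<m}. t k * t (m - k))"
          using t[OF m] split[of t, OF assms(4) m] by (simp add: algebra_simps)
        have e3: "fps_nth (fps_X * (w (m - 1) - w (m + 1))) n = fps_nth (fps_X * (t (m - 1) - t (m
            + 1))) n"
          by (rule fps_X_mult_nth_cong) (simp add: less)
        have e4: "fps_nth (\<Sum>k\<in>{1..<m}. w k * w (m - k)) n = fps_nth (\<Sum>k\<in>{1..<m}. t k * t (m - k)) n"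
          unfolding fps_sum_nth by (intro sum.cong fps_mult_nth_cong lt) auto
        show ?thesis by (subst ew, subst et) (simp only: fps_sub_nth e3 e4)
      qed (simp add: assms)
    qed
  qed
qed

text \<open>The moments of the Gross--Witten--Wadia law in its strong coupling phase.\<close>

definition gww_moment :: "nat \<Rightarrow> real fps" where
  "gww_moment m = (if m = 0 then 1 else if m = 1 then fps_X else 0)"

text \<open>Only k = 0 and k = 1 survive, and for m = 1 the latter is out of range. Used with the
  moments themselves for \<open>x\<close>, and with the powers of \<open>Y\<close> followed by a
  fixed word.\<close>

lemma gww_moment_recursion:
  assumes "m \<ge> 1"
  shows "(\<Sum>k<m. gww_moment k * x (m - k)) = x m + (if m = 1 then 0 else fps_X * x (m - 1))"
proof -
  have "(\<Sum>k<m. gww_moment k * x (m - k)) = (\<Sum>k\<in>{..<m} \<inter> {0, 1}. gww_moment k * x (m - k))"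
    by (intro sum.mono_neutral_right) (auto simp: gww_moment_def)
  also have "{..<m} \<inter> {0, 1} = (if m = 1 then {0} else {0, 1})"
    using assms by auto
  finally show ?thesis by (simp add: gww_moment_def)
qed

section \<open>Polynomiality from the master loop equation\<close>

text \<open>\<open>y\<close> stands for a highest letter among \<open>F\<close>, and the equation is
  available for it on words over \<open>F\<close>. \<open>W_rot\<close> turns the cancellation at
  the front of a word into cancellation anywhere, so \<open>W\<close> is a class function on the
  free group.\<close>

locale master_loop =
  fixes W :: "('l \<times> bool) list \<Rightarrow> real fps" and F :: "'l set" and y :: 'l
  assumes W_Nil: "W [] = 1"
    and W_rot: "W (u @ v) = W (v @ u)"
    and W_inv: "W (winv flip u) = W u"
    and W_cancel: "W (flip c # c # u) = W u"
    and W_master: "fst ` set u \<subseteq> F \<Longrightarrow> y \<in> F \<Longrightarrow>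
      (\<Sum>(s, P, S)\<leftarrow>cuts flip (y, True) u. fps_const s * (W P * W S)) =
        fps_X * (W ((y, False) # u) - W ((y, True) # u))"
    and y: "y \<in> F"
begin

abbreviation "Y \<equiv> (y, True)"
abbreviation "Y' \<equiv> (y, False)"

lemma cuts_replicate:
  "cuts flip Y (replicate m Y) = map (\<lambda>k. (1, replicate k Y, replicate (m - k) Y)) [0..<m]"
proof (induction m)
  case (Suc m)
  have "[0..<Suc m] = 0 # map Suc [0..<m]"
    by (simp add: map_Suc_upt upt_conv_Cons)
  with Suc show ?case by (simp add: flip_def o_def)
qed simp

text \<open>The cuts of \<open>Y^m A\<close> that fall inside \<open>A\<close>: the first piece
  keeps the whole power, the second is a suffix of \<open>A\<close>.\<close>

definition tails :: "('l \<times> bool) list \<Rightarrow> nat \<Rightarrow> real fps" where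
  "tails A m = (\<Sum>(s, P, S)\<leftarrow>cuts flip Y A. fps_const s * (W (replicate m Y @ P) * W S))"

text \<open>The condition m >= 1 provides a letter of the power against which the deforming
  \<open>Y'\<close> cancels.\<close>

lemma W_power_master:
  assumes "fst ` set A \<subseteq> F" "m \<ge> 1"
  shows "(\<Sum>k<m. W (replicate k Y) * W (replicate (m - k) Y @ A)) + tails A m =
    fps_X * (W (replicate (m - 1) Y @ A) - W (replicate (m + 1) Y @ A))"
proof -
  obtain m' where m: "m = Suc m'" using assms(2) by (cases m) auto
  have "fst ` set (replicate m Y @ A) \<subseteq> F" using assms y by auto
  from W_master[OF this y]
  have "(\<Sum>(s, P, S)\<leftarrow>cuts flip Y (replicate m Y @ A). fps_const s * (W P * W S)) =
      fps_X * (W (replicate (m - 1) Y @ A) - W (replicate (m + 1) Y @ A))"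
    using W_cancel[of Y] by (simp add: m flip_def)
  then show ?thesis
    by (simp add: cuts_append cuts_replicate tails_def case_prod_unfold o_def
        interv_sum_list_conv_sum_set_nat lessThan_atLeast0)
qed

lemma W_power: "W (replicate m Y) = gww_moment m"
proof (rule gww_recursion_unique)
  fix m :: nat assume m: "m \<ge> 1"
  show "(\<Sum>k<m. W (replicate k Y) * W (replicate (m - k) Y)) =
      fps_X * (W (replicate (m - 1) Y) - W (replicate (m + 1) Y))"
    using W_power_master[of "[]" m] m by (simp add: tails_def)
  show "(\<Sum>k<m. gww_moment k * gww_moment (m - k)) =
      fps_X * (gww_moment (m - 1) - gww_moment (m + 1))"
    using m by (subst gww_moment_recursion) (auto simp: gww_moment_def)
qed (simp_all add: W_Nil gww_moment_def)

text \<open>For m >= 2 the term X x(m - 1) from the deformation by \<open>Y'\<close> also arises on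
  the left as the splitting k = 1, since W(Y) = X, and the two cancel. For m = 1 there is no such
  splitting and X x(0) stays.\<close>

lemma W_power_step:
  assumes "fst ` set A \<subseteq> F" "m \<ge> 1"
  shows "W (replicate m Y @ A) = (if m = 1 then fps_X * W A else 0)
    - fps_X * W (replicate (Suc m) Y @ A) - tails A m"
proof -
  define x where "x m = W (replicate m Y @ A)" for m
  have eq: "(\<Sum>k<m. gww_moment k * x (m - k)) + tails A m = fps_X * (x (m - 1) - x (m + 1))"
    using W_power_master[OF assms] by (simp add: W_power x_def)
  have "x m = (if m = 1 then fps_X * x 0 else 0) - fps_X * x (Suc m) - tails A m"
    using eq[unfolded gww_moment_recursion[OF assms(2)]]
    by (auto simp: algebra_simps split: if_splits)
  then show ?thesis by (simp add: x_def)
qed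

text \<open>A cut at \<open>Y'\<close> leaves this letter at the end of the first piece, where it
  cyclically meets the power of \<open>Y\<close>.\<close>

lemma W_replicate_inv: "W (replicate (Suc m) Y @ B @ [Y']) = W (replicate m Y @ B)"
proof -
  have "W (replicate (Suc m) Y @ B @ [Y']) = W ((replicate (Suc m) Y @ B) @ [Y'])" by simp
  also have "\<dots> = W ([Y'] @ replicate (Suc m) Y @ B)" by (rule W_rot)
  also have "\<dots> = W (replicate m Y @ B)" using W_cancel[of Y] by (simp add: flip_def)
  finally show ?thesis .
qed

text \<open>The induction on the length carries both claims: vanishing for large m makes the
  recursion homogeneous from some point on, polynomiality feeds the descent from there.\<close>

lemma fps_poly_W:
  assumes base: "\<And>u. fst ` set u \<subseteq> F - {y} \<Longrightarrow> fps_poly (W u)" and "fst ` set A \<subseteq> F"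
  shows "(\<forall>m. fps_poly (W (replicate m Y @ A))) \<and> (\<exists>M. \<forall>m\<ge>M. W (replicate m Y @ A) = 0)"
  using assms(2)
proof (induction A rule: length_induct)
  case (1 A)
  have IH: "fps_poly (W (replicate m Y @ B))" "\<exists>M. \<forall>m\<ge>M. W (replicate m Y @ B) = 0"
    if "length B < length A" "fst ` set B \<subseteq> F" for B m
    using 1(1) that by auto
  define x where "x m = W (replicate m Y @ A)" for m
  \<comment> \<open>At m = 0 the piece \<open>P = B Y'\<close> can be as long as \<open>A\<close>.
    For m >= 1 its last letter cancels a letter of the power and leaves the shorter
    \<open>B\<close>.\<close>
  have cut: "(\<forall>m\<ge>1. fps_poly (W (replicate m Y @ P))) \<and> fps_poly (W S) \<and>
      (\<exists>M. \<forall>m\<ge>M. W (replicate m Y @ P) = 0)"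
    if "(s, P, S) \<in> set (cuts flip Y A)" for s P S
    using that
  proof (cases rule: cuts_cases)
    case (1 B C)
    then have "length B < length A" "fst ` set B \<subseteq> F" "length C < length A" "fst ` set C \<subseteq> F"
      using \<open>fst ` set A \<subseteq> F\<close> by auto
    \<comment> \<open>The piece \<open>S = Y C\<close> can be as long as \<open>A\<close>; it is
      covered by the hypothesis for \<open>C\<close> with m = 1.\<close>
    then show ?thesis using IH[of B] IH(1)[of C 1] 1 by simp
  next
    case (2 B C)
    then have *: "length B < length A" "fst ` set B \<subseteq> F" "length C < length A" "fst ` set C \<subseteq> F"
      using \<open>fst ` set A \<subseteq> F\<close> by auto
    have P: "P = B @ [Y']" using 2 by (simp add: flip_def)
    obtain M where M: "\<And>m. m \<ge> M \<Longrightarrow> W (replicate m Y @ B) = 0" using IH(2)[OF *(1,2)] by auto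
    have "W (replicate m Y @ P) = 0" if "m \<ge> Suc M" for m
      using that M W_replicate_inv[of "m - 1" B] P by (cases m) auto
    moreover have "fps_poly (W (replicate m Y @ P))" if "m \<ge> 1" for m
      using that IH(1)[OF *(1,2)] W_replicate_inv[of "m - 1" B] P by (cases m) auto
    ultimately show ?thesis using IH(1)[OF *(3,4), of 0] 2 by auto
  qed
  have tails_poly: "fps_poly (tails A m)" if "m \<ge> 1" for m
    unfolding tails_def
  proof (intro fps_poly_sum_list)
    fix c assume c: "c \<in> set (cuts flip Y A)"
    obtain s P S where [simp]: "c = (s, P, S)" by (cases c) auto
    have "fps_poly (W (replicate m Y @ P))" "fps_poly (W S)" using cut[of s P S] c that by auto
    then show "fps_poly (case c of (s, P, S) \<Rightarrow> fps_const s * (W (replicate m Y @ P) * W S))"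
      by auto
  qed
  have "\<exists>M. \<forall>m\<ge>M. \<forall>(s, P, S)\<in>set (cuts flip Y A). W (replicate m Y @ P) = 0"
  proof -
    have "\<forall>c\<in>set (cuts flip Y A). eventually (\<lambda>m. W (replicate m Y @ fst (snd c)) = 0) sequentially"
      using cut by (fastforce simp: eventually_sequentially)
    then have "eventually (\<lambda>m. \<forall>c\<in>set (cuts flip Y A). W (replicate m Y @ fst (snd c)) = 0)
        sequentially"
      by (intro eventually_ball_finite) auto
    then show ?thesis by (auto simp: eventually_sequentially case_prod_unfold)
  qed
  then obtain M' where M': "\<And>m s P S. m \<ge> M' \<Longrightarrow> (s, P, S) \<in> set (cuts flip Y A) \<Longrightarrow>
      W (replicate m Y @ P) = 0" by blast
  \<comment> \<open>At least 2, to exclude the additional term of the recursion at m = 1.\<close>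
  define M where "M = max 2 M'"
  have "tails A m = 0" if "m \<ge> M" for m
  proof -
    have "(\<Sum>(s, P, S)\<leftarrow>cuts flip Y A. fps_const s * (W (replicate m Y @ P) * W S)) =
      (\<Sum>_\<leftarrow>cuts flip Y A. 0)"
      by (intro arg_cong[where f = sum_list] map_cong) (use that M' in \<open>auto simp: M_def\<close>)
    then show ?thesis by (simp add: tails_def)
  qed
  then have "x m = - fps_X * x (Suc m)" if "m \<ge> M" for m
    using W_power_step[OF 1(2), of m] that by (simp add: x_def M_def)
  then have zero: "x m = 0" if "m \<ge> M" for m
    using fps_shift_eq_zero[of M x m] that by blast
  have stp: "x m = (if m = 1 then fps_X * x 0 else 0) - fps_X * x (Suc m) - tails A m" if "m \<ge> 1"
      for m
    using W_power_step[OF 1(2) that] by (simp add: x_def)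
  have ge2: "fps_poly (x m)" if "m \<ge> 2" for m
  proof (cases "m \<ge> M")
    case True then show ?thesis using zero by auto
  next
    case False
    then have "m \<le> M" by simp
    then show ?thesis using that
    proof (induction rule: inc_induct)
      case base then show ?case using zero by auto
    next
      case (step n)
      then show ?case using tails_poly[of n] stp[of n] by auto
    qed
  qed
  have A0: "fps_poly (W A)"
  proof (cases "y \<in> fst ` set A")
    case False then show ?thesis using 1(2) by (intro base) auto
  next
    case True
    then obtain b B C where A: "A = B @ (y, b) # C"
      by (metis (no_types, opaque_lifting) eq_fst_iff image_iff split_list)
    show ?thesis
    proof (cases b)
      case True
      then have "W A = W (replicate 1 Y @ (C @ B))" using A W_rot[of B "Y # C"] by simp
      then show ?thesis using IH(1)[of "C @ B" 1] A 1(2) by (auto simp del: replicate.simps)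
    next
      case False
      let ?D = "winv flip B @ winv flip C"
      have "W A = W (winv flip C @ Y # winv flip B)"
        using W_inv[of A] A False by (simp add: winv_def flip_def)
      also have "\<dots> = W (replicate 1 Y @ ?D)" using W_rot[of "winv flip C" "Y # winv flip B"] by simp
      finally have "W A = W (replicate 1 Y @ ?D)" .
      moreover have "fst ` set ?D \<subseteq> F" "length ?D < length A"
        using 1(2) A by (auto simp: winv_def flip_def)
      ultimately show ?thesis using IH(1)[of ?D 1] by simp
    qed
  qed
  have "fps_poly (x m)" for m
  proof -
    consider "m = 0" | "m = 1" | "m \<ge> 2" by linarith
    then show ?thesis
    proof cases
      case 1 then show ?thesis using A0 by (simp add: x_def)
    next
      case 2
      have "x 1 = fps_X * x 0 - fps_X * x 2 - tails A 1" using stp[of 1] by (simp add: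
          numeral_2_eq_2)
      moreover have "fps_poly (x 0)" using A0 by (simp add: x_def)
      ultimately show ?thesis using 2 ge2[of 2] tails_poly[of 1] by auto
    qed (use ge2 in auto)
  qed
  then show ?case using zero unfolding x_def by blast
qed

end

text \<open>Letters are adjoined in order of increasing rank, so the new letter is never below those
  present and its master equation holds for all words over the enlarged set. Words avoiding it are
  covered by the induction hypothesis.\<close>

lemma fps_poly_words:
  fixes W :: "('l \<times> bool) list \<Rightarrow> real fps" and rank :: "'l \<Rightarrow> nat"
  assumes "W [] = 1" "\<And>u v. W (u @ v) = W (v @ u)" "\<And>u. W (winv flip u) = W u"
    and "\<And>c u. W (flip c # c # u) = W u"
    and master: "\<And>y u. (\<And>z. z \<in> fst ` set u \<Longrightarrow> rank z \<le> rank y) \<Longrightarrow>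
      (\<Sum>(s, P, S)\<leftarrow>cuts flip (y, True) u. fps_const s * (W P * W S)) =
        fps_X * (W ((y, False) # u) - W ((y, True) # u))"
    and "finite F" "fst ` set u \<subseteq> F"
  shows "fps_poly (W u)"
  using assms(6,7)
proof (induction F arbitrary: u rule: finite_ranking_induct[where f = rank])
  case empty then show ?case using assms(1) by auto
next
  case (insert y F)
  interpret master_loop W "insert y F" y
    by standard (use assms insert in \<open>auto intro!: master\<close>)
  have "fps_poly (W v)" if "fst ` set v \<subseteq> insert y F - {y}" for v
    using insert.IH that by blast
  from fps_poly_W[OF this insert.prems] show ?case
    by (metis append_Nil replicate_0)
qed

section \<open>Rotations and the Casimir identities\<close>

lemma mult_mat_entry:
  assumes "A \<in> carrier_mat N N" "B \<in> carrier_mat N N" "a < N" "b < N"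
  shows "(A * B) $$ (a, b) = (\<Sum>k<N. A $$ (a, k) * B $$ (k, b))"
  using assms by (auto simp: scalar_prod_def lessThan_atLeast0 intro!: sum.cong)

declare index_mult_mat(1) [simp del]

lemma mult_square_carrier [simp, intro]:
  "A \<in> carrier_mat N N \<Longrightarrow> B \<in> carrier_mat N N \<Longrightarrow> A * B \<in> carrier_mat N N"
  by (rule mult_carrier_mat)

lemma mat_trace_eq: "A \<in> carrier_mat N N \<Longrightarrow> mat_trace A = (\<Sum>i<N. A $$ (i, i))"
  by (auto simp: mat_trace_def)

lemma mat_trace_comm:
  assumes "A \<in> carrier_mat N N" "B \<in> carrier_mat N N"
  shows "mat_trace (A * B) = mat_trace (B * A)"
proof -
  have "mat_trace (A * B) = (\<Sum>i<N. \<Sum>k<N. A $$ (i, k) * B $$ (k, i))"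
    using assms by (subst mat_trace_eq[of _ N]) (auto simp: mult_mat_entry[OF assms] intro!:
        sum.cong)
  also have "\<dots> = (\<Sum>k<N. \<Sum>i<N. A $$ (i, k) * B $$ (k, i))" by (rule sum.swap)
  also have "\<dots> = mat_trace (B * A)"
    using assms by (subst mat_trace_eq[of _ N])
      (auto simp: mult_mat_entry[OF assms(2,1)] mult.commute intro!: sum.cong)
  finally show ?thesis .
qed

lemma mat_trace_transpose: "A \<in> carrier_mat N N \<Longrightarrow> mat_trace (transpose_mat A) = mat_trace A"
  by (auto simp: mat_trace_def)

lemma mat_trace_mult_transpose:
  assumes "A \<in> carrier_mat N N" "B \<in> carrier_mat N N"
  shows "mat_trace (A * transpose_mat B) = (\<Sum>i<N. \<Sum>k<N. A $$ (i, k) * B $$ (i, k))"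
  using assms by (subst mat_trace_eq[of _ N]) (auto simp: mult_mat_entry[of _ N] intro!: sum.cong)

lemma SO_sel [simp]:
  "x \<otimes>\<^bsub>SO N\<^esub> y = x * y" "\<one>\<^bsub>SO N\<^esub> = 1\<^sub>m N"
  by (simp_all add: SO_def)

lemma SO_carrier: "A \<in> carrier (SO N) \<longleftrightarrow> A \<in> carrier_mat N N \<and> transpose_mat A * A = 1\<^sub>m N \<and>
    Determinant.det A = 1"
  by (simp add: SO_def)

lemma SO_carrier_mat [simp, intro]: "A \<in> carrier (SO N) \<Longrightarrow> A \<in> carrier_mat N N"
  by (simp add: SO_carrier)

lemma SO_transpose_mult [simp]: "A \<in> carrier (SO N) \<Longrightarrow> transpose_mat A * A = 1\<^sub>m N"
  using SO_carrier by blast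

lemma SO_mult_transpose [simp]: "A \<in> carrier (SO N) \<Longrightarrow> A * transpose_mat A = 1\<^sub>m N"
  by (rule mat_mult_left_right_inverse[of _ N]) auto

lemma SO_det: "A \<in> carrier (SO N) \<Longrightarrow> Determinant.det A = 1"
  using SO_carrier by blast

lemma SO_transpose [simp, intro]: "A \<in> carrier (SO N) \<Longrightarrow> transpose_mat A \<in> carrier (SO N)"
  using SO_mult_transpose[of A N] SO_carrier_mat[of A N]
  unfolding SO_carrier[of "transpose_mat A"] by (simp add: det_transpose[of _ N] SO_det)

lemma SO_one [simp, intro]: "1\<^sub>m N \<in> carrier (SO N)"
  unfolding SO_carrier by simp

lemma SO_mult [simp, intro]:
  assumes A: "A \<in> carrier (SO N)" and B: "B \<in> carrier (SO N)"
  shows "A * B \<in> carrier (SO N)"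
proof -
  have "transpose_mat (A * B) * (A * B) = transpose_mat B * (transpose_mat A * A) * B"
    using A B SO_carrier_mat[OF A] SO_carrier_mat[OF B]
    by (simp add: transpose_mult[of _ N N _ N] assoc_mult_mat[of _ N N _ N _ N] del:
        SO_transpose_mult)
  also have "\<dots> = 1\<^sub>m N"
    using A B by (simp add: right_mult_one_mat[of _ N N])
  finally show ?thesis
    using A B unfolding SO_carrier[of "A * B"] by (simp add: det_mult[of _ N] SO_det)
qed

lemma group_SO: "group (SO N)"
proof (rule groupI)
  fix A assume "A \<in> carrier (SO N)"
  then show "\<exists>y\<in>carrier (SO N). y \<otimes>\<^bsub>SO N\<^esub> A = \<one>\<^bsub>SO N\<^esub>"
    by (intro bexI[of _ "transpose_mat A"]) auto
qed (auto simp: assoc_mult_mat[of _ N N _ N _ N] left_mult_one_mat[of _ N N])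

lemma inv_SO: "A \<in> carrier (SO N) \<Longrightarrow> inv\<^bsub>SO N\<^esub> A = transpose_mat A"
  by (rule group.inv_equality[OF group_SO]) auto

lemma SO_entry_bound:
  assumes A: "A \<in> carrier (SO N)" and "i < N" "j < N"
  shows "\<bar>A $$ (i, j)\<bar> \<le> 1"
proof -
  have "(A $$ (i, j))\<^sup>2 \<le> (\<Sum>k<N. (A $$ (k, j))\<^sup>2)"
    using assms by (intro member_le_sum) auto
  also have "\<dots> = (transpose_mat A * A) $$ (j, j)"
    using assms carrier_matD[OF SO_carrier_mat[OF A]]
    by (subst mult_mat_entry[of _ N]) (auto simp: power2_eq_square intro!: sum.cong)
  also have "\<dots> = 1" using assms by simp
  finally show ?thesis by (simp add: abs_square_le_1)
qed

section \<open>Generators of the Lie algebra and their one-parameter groups\<close>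

text \<open>The elementary antisymmetric matrices. A sum over all ordered pairs (i, j) meets each of
  them twice up to sign, and i = j gives zero; hence the factors 2 below.\<close>

definition so_gen :: "nat \<Rightarrow> nat \<Rightarrow> nat \<Rightarrow> real mat" where
  "so_gen N i j = mat N N (\<lambda>(k, l). (if k = i \<and> l = j then 1 else 0) - (if k = j \<and> l = i then 1
      else 0))"

text \<open>The exponential of t times \<open>so_gen N i j\<close> in closed form, which is the
  identity for i = j.\<close>

definition givens :: "nat \<Rightarrow> nat \<Rightarrow> nat \<Rightarrow> real \<Rightarrow> real mat" where
  "givens N i j t = mat N N (\<lambda>(k, l). if i = j then (if k = l then 1 else 0)
     else if k = i then (if l = i then cos t else if l = j then sin t else 0)
     else if k = j then (if l = j then cos t else if l = i then - sin t else 0)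
     else (if k = l then 1 else 0))"

lemma so_gen_carrier [simp, intro]: "so_gen N i j \<in> carrier_mat N N"
  and givens_carrier_mat [simp, intro]: "givens N i j t \<in> carrier_mat N N"
  by (auto simp: so_gen_def givens_def)

lemma so_gen_mult_entry:
  assumes "A \<in> carrier_mat N N" "k < N" "l < N" "i < N" "j < N"
  shows "(so_gen N i j * A) $$ (k, l) = (if k = i then A $$ (j, l) else 0) - (if k = j then A $$
      (i, l) else 0)"
proof -
  have "(so_gen N i j * A) $$ (k, l) = (\<Sum>m<N. (if m = j then if k = i then A $$ (j, l) else 0 else
      0)
      - (if m = i then if k = j then A $$ (i, l) else 0 else 0))"
    using assms by (subst mult_mat_entry[of _ N], simp_all only: so_gen_carrier, intro sum.cong)
      (auto simp: so_gen_def)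
  also have "\<dots> = (if k = i then A $$ (j, l) else 0) - (if k = j then A $$ (i, l) else 0)"
    using assms by (simp add: sum_subtractf)
  finally show ?thesis .
qed

lemma givens_mult_entry:
  assumes "A \<in> carrier_mat N N" "k < N" "l < N" "i < N" "j < N"
  shows "(givens N i j t * A) $$ (k, l) = (if i = j then A $$ (k, l)
     else if k = i then cos t * A $$ (i, l) + sin t * A $$ (j, l)
     else if k = j then cos t * A $$ (j, l) - sin t * A $$ (i, l) else A $$ (k, l))"
proof -
  have *: "(givens N i j t * A) $$ (k, l) = (\<Sum>m<N. givens N i j t $$ (k, m) * A $$ (m, l))"
    using assms by (subst mult_mat_entry[of _ N]) auto
  consider "i = j \<or> (k \<noteq> i \<and> k \<noteq> j)" | "i \<noteq> j" "k = i" | "i \<noteq> j" "k = j" "k \<noteq> i" by blast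
  then show ?thesis
  proof cases
    case 1
    then have "(\<Sum>m<N. givens N i j t $$ (k, m) * A $$ (m, l)) = (\<Sum>m<N. if m = k then A $$ (k, l)
        else 0)"
      using assms by (intro sum.cong) (auto simp: givens_def)
    then show ?thesis using 1 * assms by auto
  next
    case 2
    then have "(\<Sum>m<N. givens N i j t $$ (k, m) * A $$ (m, l)) =
        (\<Sum>m<N. (if m = i then cos t * A $$ (i, l) else 0) + (if m = j then sin t * A $$ (j, l)
            else 0))"
      using assms by (intro sum.cong) (auto simp: givens_def)
    then show ?thesis using 2 * assms by (simp add: sum.distrib)
  next
    case 3
    then have "(\<Sum>m<N. givens N i j t $$ (k, m) * A $$ (m, l)) =
        (\<Sum>m<N. (if m = j then cos t * A $$ (j, l) else 0) - (if m = i then sin t * A $$ (i, l)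
            else 0))"
      using assms by (intro sum.cong) (auto simp: givens_def)
    then show ?thesis using 3 * assms by (simp add: sum_subtractf)
  qed
qed

lemma givens_add:
  assumes "i < N" "j < N"
  shows "givens N i j s * givens N i j t = givens N i j (s + t)"
proof (rule eq_matI)
  fix k l assume "k < dim_row (givens N i j (s + t))" "l < dim_col (givens N i j (s + t))"
  then have "k < N" "l < N" by (auto simp: givens_def)
  then show "(givens N i j s * givens N i j t) $$ (k, l) = givens N i j (s + t) $$ (k, l)"
    using assms by (auto simp: givens_mult_entry[of _ N])
      (auto simp: givens_def cos_add sin_add algebra_simps)
qed (auto simp: givens_def)

lemma givens_0: "givens N i j 0 = 1\<^sub>m N"
  by (rule eq_matI) (auto simp: givens_def)

lemma transpose_givens: "transpose_mat (givens N i j t) = givens N i j (- t)"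
  by (rule eq_matI) (auto simp: givens_def)

lemma givens_SO [intro]:
  assumes "i < N" "j < N"
  shows "givens N i j t \<in> carrier (SO N)"
proof -
  have orth: "transpose_mat (givens N i j t) * givens N i j t = 1\<^sub>m N" for t
    using assms by (simp add: transpose_givens givens_add givens_0)
  have det_sq: "Determinant.det (givens N i j t) * Determinant.det (givens N i j t) = 1" for t
  proof -
    have "Determinant.det (transpose_mat (givens N i j t)) * Determinant.det (givens N i j t) = 1"
      by (subst det_mult[of _ N, symmetric]) (auto simp: orth)
    then show ?thesis by (subst (asm) det_transpose[of _ N]) auto
  qed
  \<comment> \<open>Orthogonality leaves the sign of the determinant open; as the square of another
    rotation the matrix has determinant 1.\<close>
  have "givens N i j t = givens N i j (t / 2) * givens N i j (t / 2)"
    using assms by (simp add: givens_add)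
  then have "Determinant.det (givens N i j t) = 1"
    using det_sq[of "t / 2"] by (simp add: det_mult[of _ N])
  then show ?thesis using orth unfolding SO_carrier by simp
qed

lemma givens_mult_deriv:
  assumes "A \<in> carrier_mat N N" "k < N" "l < N" "i < N" "j < N"
  shows "((\<lambda>t. (givens N i j t * A) $$ (k, l)) has_real_derivative
    (so_gen N i j * (givens N i j t * A)) $$ (k, l)) (at t)"
proof -
  have [simp]: "givens N i j t * A \<in> carrier_mat N N" using assms by auto
  show ?thesis
    using assms unfolding so_gen_mult_entry[OF \<open>givens N i j t * A \<in> carrier_mat N N\<close> assms(2-)]
      givens_mult_entry[OF assms]
    by (cases "i = j"; cases "k = i"; cases "k = j")
      (auto intro!: derivative_eq_intros simp: givens_mult_entry[of _ N])
qed

lemma trace_so_gen_mult: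
  assumes "M \<in> carrier_mat N N" "i < N" "j < N"
  shows "mat_trace (so_gen N i j * M) = M $$ (j, i) - M $$ (i, j)"
proof -
  have "mat_trace (so_gen N i j * M) = (\<Sum>k<N. (if k = i then M $$ (j, i) else 0) - (if k = j then
      M $$ (i, j) else 0))"
    using assms by (subst mat_trace_eq[of _ N]) (auto simp: so_gen_mult_entry[OF assms(1)] intro!:
        sum.cong)
  then show ?thesis using assms by (simp add: sum_subtractf)
qed

lemma mult_so_gen_mult_entry:
  assumes "P \<in> carrier_mat N N" "S \<in> carrier_mat N N" "i < N" "j < N" "a < N" "b < N"
  shows "(P * (so_gen N i j * S)) $$ (a, b) = P $$ (a, i) * S $$ (j, b) - P $$ (a, j) * S $$ (i, b)"
proof -
  have "(P * (so_gen N i j * S)) $$ (a, b) =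
    (\<Sum>k<N. (if k = i then P $$ (a, i) * S $$ (j, b) else 0) - (if k = j then P $$ (a, j) * S $$
        (i, b) else 0))"
    using assms by (subst mult_mat_entry[of _ N]) (auto simp: so_gen_mult_entry intro!: sum.cong)
  then show ?thesis using assms by (simp add: sum_subtractf)
qed

section \<open>Contractions over the generators\<close>

text \<open>The sum over i, j of X(a,b) X(c,d) is 2 (\<delta>(a,c) \<delta>(b,d) - \<delta>(a,d)
  \<delta>(b,c)). The second contraction splits the trace at the two insertions, the first one
  rejoins the pieces with one of them transposed.\<close>

lemma casimir_same_trace:
  assumes "P \<in> carrier_mat N N" "S \<in> carrier_mat N N"
  shows "(\<Sum>i<N. \<Sum>j<N. mat_trace (so_gen N i j * (P * (so_gen N i j * S)))) =
    2 * (mat_trace (P * transpose_mat S) - mat_trace P * mat_trace S)"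
proof -
  have "(\<Sum>i<N. \<Sum>j<N. mat_trace (so_gen N i j * (P * (so_gen N i j * S)))) =
    (\<Sum>i<N. \<Sum>j<N. (P $$ (j, i) * S $$ (j, i) + P $$ (i, j) * S $$ (i, j))
      - (P $$ (j, j) * S $$ (i, i) + P $$ (i, i) * S $$ (j, j)))"
    using assms by (intro sum.cong refl)
      (subst trace_so_gen_mult, auto simp: mult_so_gen_mult_entry algebra_simps)
  also have "\<dots> = (\<Sum>i<N. \<Sum>j<N. P $$ (j, i) * S $$ (j, i)) + (\<Sum>i<N. \<Sum>j<N. P $$ (i, j) * S $$ (i, j))
      - ((\<Sum>i<N. \<Sum>j<N. P $$ (j, j) * S $$ (i, i)) + (\<Sum>i<N. \<Sum>j<N. P $$ (i, i) * S $$ (j, j)))"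
    by (simp add: sum.distrib sum_subtractf)
  also have "(\<Sum>i<N. \<Sum>j<N. P $$ (j, i) * S $$ (j, i)) = (\<Sum>i<N. \<Sum>j<N. P $$ (i, j) * S $$ (i, j))"
    by (rule sum.swap)
  also have "(\<Sum>i<N. \<Sum>j<N. P $$ (j, j) * S $$ (i, i)) = (\<Sum>i<N. \<Sum>j<N. P $$ (i, i) * S $$ (j, j))"
    by (rule sum.swap)
  also have "\<dots> = mat_trace P * mat_trace S"
    using assms by (simp add: mat_trace_eq[of _ N] sum_product)
  finally show ?thesis using mat_trace_mult_transpose[OF assms] by simp
qed

text \<open>The same contraction, with the two insertions in different traces, merges them in both
  relative orientations.\<close>

lemma casimir_two_traces:
  assumes "M \<in> carrier_mat N N" "K \<in> carrier_mat N N"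
  shows "(\<Sum>i<N. \<Sum>j<N. mat_trace (so_gen N i j * M) * mat_trace (so_gen N i j * K)) =
    2 * (mat_trace (M * transpose_mat K) - mat_trace (M * K))"
proof -
  have "(\<Sum>i<N. \<Sum>j<N. mat_trace (so_gen N i j * M) * mat_trace (so_gen N i j * K)) =
    (\<Sum>i<N. \<Sum>j<N. (M $$ (j, i) * K $$ (j, i) + M $$ (i, j) * K $$ (i, j))
      - (M $$ (j, i) * K $$ (i, j) + M $$ (i, j) * K $$ (j, i)))"
    using assms by (intro sum.cong refl) (auto simp: trace_so_gen_mult algebra_simps)
  also have "\<dots> = (\<Sum>i<N. \<Sum>j<N. M $$ (j, i) * K $$ (j, i)) + (\<Sum>i<N. \<Sum>j<N. M $$ (i, j) * K $$ (i, j))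
      - ((\<Sum>i<N. \<Sum>j<N. M $$ (j, i) * K $$ (i, j)) + (\<Sum>i<N. \<Sum>j<N. M $$ (i, j) * K $$ (j, i)))"
    by (simp add: sum.distrib sum_subtractf)
  also have "(\<Sum>i<N. \<Sum>j<N. M $$ (j, i) * K $$ (j, i)) = (\<Sum>i<N. \<Sum>j<N. M $$ (i, j) * K $$ (i, j))"
    by (rule sum.swap)
  also have "(\<Sum>i<N. \<Sum>j<N. M $$ (j, i) * K $$ (i, j)) = (\<Sum>i<N. \<Sum>j<N. M $$ (i, j) * K $$ (j, i))"
    by (rule sum.swap)
  also have "\<dots> = mat_trace (M * K)"
    using assms by (subst mat_trace_eq[of _ N]) (auto simp: mult_mat_entry[OF assms] intro!:
        sum.cong)
  finally show ?thesis using mat_trace_mult_transpose[OF assms] by simp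
qed

section \<open>Derivatives of Wilson loop variables\<close>

text \<open>The positively oriented edge whose variable \<open>edge_matrix\<close> reads.\<close>

definition und :: "edge \<Rightarrow> edge" where
  "und c = (if c \<in> pos_edges then c else reversal c)"

text \<open>\<open>SO N\<close>-valuedness is only required along the walk, since a configuration is undefined
  outside the box.\<close>

definition SO_edge :: "nat \<Rightarrow> edge \<Rightarrow> (edge \<Rightarrow> real mat) \<Rightarrow> bool" where
  "SO_edge N c Q \<longleftrightarrow> c \<in> edges \<and> Q (und c) \<in> carrier (SO N)"

definition SO_on :: "nat \<Rightarrow> edge list \<Rightarrow> (edge \<Rightarrow> real mat) \<Rightarrow> bool" where
  "SO_on N w Q \<longleftrightarrow> (\<forall>c \<in> set w. SO_edge N c Q)"

abbreviation rv :: "edge list \<Rightarrow> edge list" where "rv \<equiv> winv reversal"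

lemma reversal_reversal [simp]: "reversal (reversal c) = c"
  and reversal_sel [simp]: "fst (reversal c) = snd c" "snd (reversal c) = fst c"
  by (simp_all add: reversal_def)

lemma reversal_edges [simp]: "reversal c \<in> edges \<longleftrightarrow> c \<in> edges"
  by (cases c) (auto simp: edges_def reversal_def abs_minus_commute)

lemma pos_edges_edges: "c \<in> pos_edges \<Longrightarrow> c \<in> edges"
  by (simp add: pos_edges_def)

lemma reversal_pos_edges: "c \<in> edges \<Longrightarrow> reversal c \<in> pos_edges \<longleftrightarrow> c \<notin> pos_edges"
  by (cases c) (auto simp: pos_edges_def edges_def reversal_def lex_less_def abs_minus_commute)

lemma und_reversal: "c \<in> edges \<Longrightarrow> und (reversal c) = und c"
  by (simp add: und_def reversal_pos_edges)

lemma und_pos: "c \<in> edges \<Longrightarrow> und c \<in> pos_edges"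
  by (simp add: und_def reversal_pos_edges)

lemma winv_Nil [simp]: "winv r [] = []"
  and winv_append [simp]: "winv r (u @ v) = winv r v @ winv r u"
  and winv_Cons [simp]: "winv r (c # v) = winv r v @ [r c]"
  by (simp_all add: winv_def)

lemma set_winv [simp]: "set (winv r u) = r ` set u"
  by (simp add: winv_def)

lemma winv_winv [simp]: "rv (rv u) = u"
  by (simp add: winv_def rev_map o_def)

lemma SO_on_simps [simp]:
  "SO_on N [] Q" "SO_on N (c # w) Q \<longleftrightarrow> SO_edge N c Q \<and> SO_on N w Q"
  "SO_on N (u @ v) Q \<longleftrightarrow> SO_on N u Q \<and> SO_on N v Q"
  by (auto simp: SO_on_def)

lemma SO_edge_reversal [simp]: "SO_edge N (reversal c) Q \<longleftrightarrow> SO_edge N c Q"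
  by (auto simp: SO_edge_def und_reversal)

lemma SO_on_rv [simp]: "SO_on N (rv w) Q \<longleftrightarrow> SO_on N w Q"
  by (simp add: SO_on_def)

lemma edge_matrix_eq:
  "SO_edge N c Q \<Longrightarrow> edge_matrix N Q c = (if c \<in> pos_edges then Q c else transpose_mat (Q (reversal
      c)))"
  by (auto simp: edge_matrix_def SO_edge_def und_def inv_SO)

lemma edge_matrix_SO: "SO_edge N c Q \<Longrightarrow> edge_matrix N Q c \<in> carrier (SO N)"
  by (auto simp: edge_matrix_eq SO_edge_def und_def split: if_splits)

lemma edge_matrix_reversal:
  "SO_edge N c Q \<Longrightarrow> edge_matrix N Q (reversal c) = transpose_mat (edge_matrix N Q c)"
  by (subst (1 2) edge_matrix_eq) (auto simp: reversal_pos_edges SO_edge_def und_reversal)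

lemma walk_matrix_simps [simp]:
  "walk_matrix N Q [] = 1\<^sub>m N" "walk_matrix N Q (c # w) = edge_matrix N Q c * walk_matrix N Q w"
  by (simp_all add: walk_matrix_def)

lemma walk_matrix_SO [simp, intro]: "SO_on N w Q \<Longrightarrow> walk_matrix N Q w \<in> carrier (SO N)"
  by (induction w) (auto dest: edge_matrix_SO)

lemma walk_matrix_carrier [simp, intro]: "SO_on N w Q \<Longrightarrow> walk_matrix N Q w \<in> carrier_mat N N"
  by blast

lemma edge_matrix_carrier [simp]: "SO_edge N c Q \<Longrightarrow> edge_matrix N Q c \<in> carrier_mat N N"
  using edge_matrix_SO by blast

lemma walk_matrix_append:
  "SO_on N u Q \<Longrightarrow> SO_on N v Q \<Longrightarrow> walk_matrix N Q (u @ v) = walk_matrix N Q u * walk_matrix N Q v"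
  by (induction u)
    (auto simp: left_mult_one_mat[of _ N N] assoc_mult_mat[of _ N N _ N _ N])

lemma walk_matrix_rv: "SO_on N w Q \<Longrightarrow> walk_matrix N Q (rv w) = transpose_mat (walk_matrix N Q w)"
proof (induction w)
  case (Cons c w)
  then have "SO_edge N c Q" "SO_on N w Q" by auto
  then show ?case using Cons.IH
    by (simp add: walk_matrix_append edge_matrix_reversal transpose_mult[of _ N N _ N]
        right_mult_one_mat[of _ N N])
qed simp

lemma wilson_rotate: "SO_on N u Q \<Longrightarrow> SO_on N v Q \<Longrightarrow> wilson N (u @ v) Q = wilson N (v @ u) Q"
  by (simp add: wilson_def walk_matrix_append mat_trace_comm[of _ N])

lemma wilson_rv: "SO_on N w Q \<Longrightarrow> wilson N (rv w) Q = wilson N w Q"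
  by (simp add: wilson_def walk_matrix_rv mat_trace_transpose[of _ N])

lemma sum_mult_sum_list:
  fixes g :: "'a \<Rightarrow> 'b \<Rightarrow> real"
  shows "(\<Sum>k\<in>K. f k * (\<Sum>x\<leftarrow>xs. g x k)) = (\<Sum>x\<leftarrow>xs. \<Sum>k\<in>K. f k * g x k)"
  by (induction xs) (simp_all add: algebra_simps sum.distrib)

lemma sum_cuts_Cons:
  "(\<Sum>x\<leftarrow>cuts r e (c # w). g x) = (if c = e then g (1, [], c # w) else 0)
    + (if c = r e then g (-1, [c], w) else 0) + (\<Sum>(s, P, S)\<leftarrow>cuts r e w. g (s, c # P, S))"
  for g :: "_ \<Rightarrow> real"
  by (simp add: case_prod_unfold o_def)

lemma sum_sum_list_swap:
  fixes g :: "'a \<Rightarrow> 'b \<Rightarrow> real"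
  shows "(\<Sum>k\<in>K. \<Sum>x\<leftarrow>xs. g x k) = (\<Sum>x\<leftarrow>xs. \<Sum>k\<in>K. g x k)"
  by (induction xs) (simp_all add: sum.distrib)

lemma sum_swap3:
  "(\<Sum>i\<in>A. \<Sum>j\<in>B. \<Sum>p\<in>C. h i j p) = (\<Sum>p\<in>C. \<Sum>i\<in>A. \<Sum>j\<in>B. h i j p)"
proof -
  have "(\<Sum>j\<in>B. \<Sum>p\<in>C. h i j p) = (\<Sum>p\<in>C. \<Sum>j\<in>B. h i j p)" for i by (rule sum.swap)
  then show ?thesis by (simp only:) (rule sum.swap)
qed

lemma cuts_SO_on:
  assumes "(s, P, S) \<in> set (cuts r e w)" "SO_on N w Q"
  shows "SO_on N P Q" "SO_on N S Q"
  using cuts_concat[OF assms(1)] assms(2) by auto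

section \<open>Rotating the variable of one edge\<close>

text \<open>The rotation acts from the left, matching the left invariance in
  \<open>is_haar_prob\<close>, so the flow preserves the product measure.\<close>

definition twist :: "nat \<Rightarrow> nat \<Rightarrow> nat \<Rightarrow> edge \<Rightarrow> (edge \<Rightarrow> real mat) \<Rightarrow> real \<Rightarrow> edge \<Rightarrow> real mat" where
  "twist N i j e Q t = Q(e := givens N i j t * Q e)"

lemma SO_edge_twist:
  assumes "i < N" "j < N" "SO_edge N c Q"
  shows "SO_edge N c (twist N i j e Q t)"
  using assms by (auto simp: SO_edge_def twist_def)

lemma SO_on_twist:
  assumes "i < N" "j < N" "SO_on N w Q"
  shows "SO_on N w (twist N i j e Q t)"
  using assms by (auto simp: SO_on_def SO_edge_twist)

text \<open>The reversed edge carries the transpose, and the generator is antisymmetric: its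
  derivative has the generator on the right and a minus sign. This is the origin of position and
  sign in \<open>cuts\<close>.\<close>

lemma edge_matrix_twist_deriv:
  assumes ij: "i < N" "j < N" and e: "e \<in> pos_edges" and Q: "SO_edge N c Q" and "a < N" "b < N"
  defines "E \<equiv> \<lambda>t. edge_matrix N (twist N i j e Q t) c"
  shows "((\<lambda>t. E t $$ (a, b)) has_real_derivative
    (if c = e then (so_gen N i j * E t) $$ (a, b) else 0)
    - (if c = reversal e then (E t * so_gen N i j) $$ (a, b) else 0)) (at t)"
proof -
  have Qt: "SO_edge N c (twist N i j e Q t)" for t by (rule SO_edge_twist[OF ij Q])
  have re: "reversal e \<notin> pos_edges" using e reversal_pos_edges[OF pos_edges_edges[OF e]] by simp
  then have ne: "e \<noteq> reversal e" using e by auto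
  consider "c = e" | "c = reversal e" | "c \<noteq> e" "reversal c \<noteq> e" by force
  then show ?thesis
  proof cases
    case 1
    have "E t = givens N i j t * Q e" for t
      using 1 e Qt[of t] by (simp add: E_def edge_matrix_eq) (simp add: twist_def)
    moreover have "Q e \<in> carrier_mat N N" using Q 1 e by (auto simp: SO_edge_def und_def)
    ultimately show ?thesis using 1 ne ij \<open>a < N\<close> \<open>b < N\<close> givens_mult_deriv[of "Q e" N a b i j t]
        by simp
  next
    case 2
    have E: "E t = transpose_mat (givens N i j t * Q e)" for t
      using 2 re Qt[of t] by (simp add: E_def edge_matrix_eq) (simp add: twist_def)
    have Qe: "Q e \<in> carrier_mat N N" using Q 2 re by (auto simp: SO_edge_def und_def)
    define Z where "Z = givens N i j t * Q e"
    have Z: "Z \<in> carrier_mat N N" using Qe by (auto simp: Z_def)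
    have "(E t * so_gen N i j) $$ (a, b) = (transpose_mat Z * (so_gen N i j * 1\<^sub>m N)) $$ (a, b)"
      unfolding E Z_def by (simp add: right_mult_one_mat[of _ N N])
    also have "\<dots> = - (so_gen N i j * Z) $$ (b, a)"
      using Z ij \<open>a < N\<close> \<open>b < N\<close>
      by (subst mult_so_gen_mult_entry[of _ N], simp_all only: so_gen_mult_entry
          transpose_carrier_mat one_carrier_mat)
        (use Z ij \<open>a < N\<close> \<open>b < N\<close> in auto)
    finally have "(E t * so_gen N i j) $$ (a, b) = - (so_gen N i j * Z) $$ (b, a)" .
    moreover have "E t $$ (a, b) = (givens N i j t * Q e) $$ (b, a)" for t
      unfolding E using \<open>a < N\<close> \<open>b < N\<close> carrier_matD[OF mult_square_carrier[OF givens_carrier_mat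
          Qe]]
      by (intro index_transpose_mat) auto
    ultimately show ?thesis
      using 2 ne ij \<open>a < N\<close> \<open>b < N\<close> givens_mult_deriv[of "Q e" N b a i j t] Qe by (simp add: Z_def)
  next
    case 3
    have "E t = E 0" for t
      unfolding E_def edge_matrix_eq[OF Qt] using 3 by (auto simp: twist_def)
    then have "(\<lambda>t. E t $$ (a, b)) = (\<lambda>t. E 0 $$ (a, b))" by metis
    then show ?thesis using 3 by auto
  qed
qed

lemma walk_matrix_twist_deriv:
  assumes ij: "i < N" "j < N" and e: "e \<in> pos_edges" and "SO_on N w Q" and "a < N" "b < N"
  defines "R \<equiv> twist N i j e Q"
  shows "((\<lambda>t. walk_matrix N (R t) w $$ (a, b)) has_real_derivative
    (\<Sum>(s, P, S)\<leftarrow>cuts reversal e w. s * (walk_matrix N (R t) P * (so_gen N i j * walk_matrix N (R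
        t) S)) $$ (a, b))) (at t)"
  using assms(4-6)
proof (induction w arbitrary: a b)
  case (Cons c w)
  then have Q: "SO_edge N c Q" "SO_on N w Q" by auto
  have R: "SO_edge N c (R t)" "SO_on N w (R t)" for t
    using Q SO_on_twist[OF ij] SO_edge_twist[OF ij] by (auto simp: R_def)
  define E where "E t = edge_matrix N (R t) c" for t
  define V where "V t = walk_matrix N (R t) w" for t
  define dE where "dE a b = (if c = e then (so_gen N i j * E t) $$ (a, b) else 0)
    - (if c = reversal e then (E t * so_gen N i j) $$ (a, b) else 0)" for a b
  define dV where "dV a b = (\<Sum>(s, P, S)\<leftarrow>cuts reversal e w. s * (walk_matrix N (R t) P * (so_gen N
      i j * walk_matrix N (R t) S)) $$ (a, b))" for a b
  have car: "E t \<in> carrier_mat N N" "V t \<in> carrier_mat N N" for t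
    using R by (auto simp: E_def V_def)
  have "walk_matrix N (R t) (c # w) $$ (a, b) = (\<Sum>k<N. E t $$ (a, k) * V t $$ (k, b))" for t
    using car Cons.prems by (simp add: E_def V_def mult_mat_entry[of _ N])
  moreover have "((\<lambda>t. \<Sum>k<N. E t $$ (a, k) * V t $$ (k, b)) has_real_derivative
      (\<Sum>k<N. dE a k * V t $$ (k, b) + E t $$ (a, k) * dV k b)) (at t)"
  proof (rule DERIV_sum)
    fix k assume "k \<in> {..<N}"
    then have "((\<lambda>t. E t $$ (a, k)) has_real_derivative dE a k) (at t)"
      "((\<lambda>t. V t $$ (k, b)) has_real_derivative dV k b) (at t)"
      using edge_matrix_twist_deriv[OF ij e Q(1), of a k t] Cons.IH[OF Q(2), of k b] Cons.prems
      by (auto simp: E_def R_def dE_def V_def dV_def)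
    from DERIV_mult[OF this]
    show "((\<lambda>t. E t $$ (a, k) * V t $$ (k, b)) has_real_derivative
        dE a k * V t $$ (k, b) + E t $$ (a, k) * dV k b) (at t)"
      by (simp add: mult.commute add.commute)
  qed
  moreover have "(\<Sum>k<N. dE a k * V t $$ (k, b)) =
      (if c = e then (so_gen N i j * (E t * V t)) $$ (a, b) else 0)
      - (if c = reversal e then (E t * (so_gen N i j * V t)) $$ (a, b) else 0)"
  proof -
    have 1: "(so_gen N i j * (E t * V t)) $$ (a, b) = (\<Sum>k<N. (so_gen N i j * E t) $$ (a, k) * V t
        $$ (k, b))"
      using car[of t] Cons.prems
      by (subst assoc_mult_mat[of _ N N _ N _ N, symmetric]) (auto intro: mult_mat_entry)
    have 2: "(E t * (so_gen N i j * V t)) $$ (a, b) = (\<Sum>k<N. (E t * so_gen N i j) $$ (a, k) * V t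
        $$ (k, b))"
      using car[of t] Cons.prems
      by (subst assoc_mult_mat[of _ N N _ N _ N, symmetric]) (auto intro: mult_mat_entry)
    show ?thesis unfolding 1 2 by (auto simp: dE_def left_diff_distrib sum_subtractf)
  qed
  moreover have "(\<Sum>k<N. E t $$ (a, k) * dV k b) =
      (\<Sum>(s, P, S)\<leftarrow>cuts reversal e w. s * ((E t * walk_matrix N (R t) P) * (so_gen N i j *
          walk_matrix N (R t) S)) $$ (a, b))"
    unfolding dV_def sum_mult_sum_list
  proof (intro arg_cong[where f = sum_list] map_cong refl, clarify)
    fix s P S assume "(s, P, S) \<in> set (cuts reversal e w)"
    from cuts_SO_on[OF this R(2)[of t]]
    have PS: "walk_matrix N (R t) P \<in> carrier_mat N N" "walk_matrix N (R t) S \<in> carrier_mat N N"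
        by auto
    then show "(\<Sum>k<N. E t $$ (a, k) * (s * (walk_matrix N (R t) P * (so_gen N i j * walk_matrix N
        (R t) S)) $$ (k, b))) =
      s * ((E t * walk_matrix N (R t) P) * (so_gen N i j * walk_matrix N (R t) S)) $$ (a, b)"
      using car[of t] Cons.prems
      by (subst assoc_mult_mat[of _ N N _ N _ N])
        (auto simp: mult_mat_entry[of "E t"] sum_distrib_left mult_ac)
  qed
  moreover have "(\<Sum>(s, P, S)\<leftarrow>cuts reversal e (c # w). s * (walk_matrix N (R t) P * (so_gen N i j *
      walk_matrix N (R t) S)) $$ (a, b)) =
      (if c = e then (so_gen N i j * (E t * V t)) $$ (a, b) else 0)
      - (if c = reversal e then (E t * (so_gen N i j * V t)) $$ (a, b) else 0)
      + (\<Sum>(s, P, S)\<leftarrow>cuts reversal e w. s * ((E t * walk_matrix N (R t) P) * (so_gen N i j *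
          walk_matrix N (R t) S)) $$ (a, b))"
  proof -
    have 1: "1\<^sub>m N * (so_gen N i j * (E t * V t)) = so_gen N i j * (E t * V t)" "E t * 1\<^sub>m N = E t"
      using car[of t] by (auto simp: left_mult_one_mat[of _ N N] right_mult_one_mat[of _ N N])
    show ?thesis
      unfolding sum_cuts_Cons prod.case walk_matrix_simps E_def[symmetric] V_def[symmetric] 1 by
          simp
  qed
  ultimately show ?case by (simp only: sum.distrib)
qed simp

text \<open>Cyclicity of the trace brings the inserted generator to the front, which turns
  \<open>P X S\<close> into \<open>X S P\<close>.\<close>

lemma wilson_twist_deriv:
  assumes ij: "i < N" "j < N" and e: "e \<in> pos_edges" and Q: "SO_on N w Q"
  defines "R \<equiv> twist N i j e Q"
  shows "((\<lambda>t. wilson N w (R t)) has_real_derivative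
    (\<Sum>(s, P, S)\<leftarrow>cuts reversal e w. s * mat_trace (so_gen N i j * walk_matrix N (R t) (S @ P))))
        (at t)"
proof -
  have R: "SO_on N w (R t)" for t using Q SO_on_twist[OF ij] by (auto simp: R_def)
  have "((\<lambda>t. \<Sum>k<N. walk_matrix N (R t) w $$ (k, k)) has_real_derivative
      (\<Sum>k<N. 1 * (\<Sum>(s, P, S)\<leftarrow>cuts reversal e w. s * (walk_matrix N (R t) P * (so_gen N i j *
          walk_matrix N (R t) S)) $$ (k, k)))) (at t)"
    unfolding mult_1_left R_def by (intro DERIV_sum walk_matrix_twist_deriv assms) auto
  moreover have "wilson N w (R t) = (\<Sum>k<N. walk_matrix N (R t) w $$ (k, k))" for t
    using R[of t] by (simp add: wilson_def mat_trace_eq[of _ N])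
  moreover have "(\<Sum>k<N. 1 * (\<Sum>(s, P, S)\<leftarrow>cuts reversal e w. s * (walk_matrix N (R t) P * (so_gen N
      i j * walk_matrix N (R t) S)) $$ (k, k))) =
      (\<Sum>(s, P, S)\<leftarrow>cuts reversal e w. s * mat_trace (so_gen N i j * walk_matrix N (R t) (S @ P)))"
    unfolding sum_mult_sum_list
  proof (intro arg_cong[where f = sum_list] map_cong refl, clarify)
    fix s P S assume "(s, P, S) \<in> set (cuts reversal e w)"
    note PS = cuts_SO_on[OF this R[of t]]
    let ?P = "walk_matrix N (R t) P" and ?S = "walk_matrix N (R t) S"
    have car: "?P \<in> carrier_mat N N" "?S \<in> carrier_mat N N" using PS by auto
    have "mat_trace (?P * (so_gen N i j * ?S)) = mat_trace (so_gen N i j * (?S * ?P))"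
      using car mat_trace_comm[of ?P N "so_gen N i j * ?S"] by (simp add: assoc_mult_mat[of _ N N
          _ N _ N])
    then show "(\<Sum>k<N. 1 * (s * (?P * (so_gen N i j * ?S)) $$ (k, k))) =
        s * mat_trace (so_gen N i j * walk_matrix N (R t) (S @ P))"
      using PS car by (simp add: walk_matrix_append mat_trace_eq[of "?P * _" N] flip:
          sum_distrib_left)
  qed
  ultimately show ?thesis by simp
qed

text \<open>The trace of X times the walk is the test function of the Schwinger--Dyson equation.
  Differentiated in the same direction X, it has two insertions, ready for
  \<open>casimir_same_trace\<close>.\<close>

lemma so_gen_trace_twist_deriv:
  assumes ij: "i < N" "j < N" and e: "e \<in> pos_edges" and Q: "SO_on N w Q"
  defines "R \<equiv> twist N i j e Q"
  shows "((\<lambda>t. mat_trace (so_gen N i j * walk_matrix N (R t) w)) has_real_derivative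
    (\<Sum>(s, P, S)\<leftarrow>cuts reversal e w. s * mat_trace (so_gen N i j *
      (walk_matrix N (R t) P * (so_gen N i j * walk_matrix N (R t) S))))) (at t)"
proof -
  have R: "SO_on N w (R t)" for t using Q SO_on_twist[OF ij] by (auto simp: R_def)
  have "mat_trace (so_gen N i j * walk_matrix N (R t) w) =
      walk_matrix N (R t) w $$ (j, i) - walk_matrix N (R t) w $$ (i, j)" for t
    using R[of t] ij by (intro trace_so_gen_mult) auto
  moreover have "((\<lambda>t. walk_matrix N (R t) w $$ (j, i) - walk_matrix N (R t) w $$ (i, j))
      has_real_derivative
      (\<Sum>(s, P, S)\<leftarrow>cuts reversal e w. s * (walk_matrix N (R t) P * (so_gen N i j * walk_matrix N (R
          t) S)) $$ (j, i))
      - (\<Sum>(s, P, S)\<leftarrow>cuts reversal e w. s * (walk_matrix N (R t) P * (so_gen N i j * walk_matrix N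
          (R t) S)) $$ (i, j))) (at t)"
    unfolding R_def by (intro DERIV_diff walk_matrix_twist_deriv assms)
  moreover have "(\<Sum>(s, P, S)\<leftarrow>cuts reversal e w. s * (walk_matrix N (R t) P * (so_gen N i j *
      walk_matrix N (R t) S)) $$ (j, i))
      - (\<Sum>(s, P, S)\<leftarrow>cuts reversal e w. s * (walk_matrix N (R t) P * (so_gen N i j * walk_matrix N
          (R t) S)) $$ (i, j)) =
      (\<Sum>(s, P, S)\<leftarrow>cuts reversal e w. s * mat_trace (so_gen N i j *
      (walk_matrix N (R t) P * (so_gen N i j * walk_matrix N (R t) S))))"
    unfolding sum_list_subtractf[symmetric]
  proof (intro arg_cong[where f = sum_list] map_cong refl, clarify)
    fix s P S assume "(s, P, S) \<in> set (cuts reversal e w)"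
    note PS = cuts_SO_on[OF this R[of t]]
    let ?Z = "walk_matrix N (R t) P * (so_gen N i j * walk_matrix N (R t) S)"
    have "?Z \<in> carrier_mat N N" using PS by auto
    then show "s * ?Z $$ (j, i) - s * ?Z $$ (i, j) = s * mat_trace (so_gen N i j * ?Z)"
      using ij by (simp add: trace_so_gen_mult algebra_simps)
  qed
  ultimately show ?thesis by simp
qed

text \<open>Integration by parts along a measure-preserving flow. The integral of \<open>f\<close>
  along the flow is constant, so all difference quotients integrate to 0. By the mean value theorem
  each quotient is a value of \<open>g\<close> further along the flow, so \<open>C\<close>
  dominates; this is why the derivative is assumed at every time.\<close>

lemma flow_integral_eq_zero:
  fixes f g :: "'a \<Rightarrow> real"
  assumes "prob_space M" and [measurable]: "f \<in> borel_measurable M" "g \<in> borel_measurable M"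
    and \<Phi> [measurable]: "\<And>t. \<Phi> t \<in> measurable M M" and inv: "\<And>t. distr M M (\<Phi> t) = M"
    and deriv: "\<And>x t. x \<in> space M \<Longrightarrow> ((\<lambda>t. f (\<Phi> t x)) has_real_derivative g (\<Phi> t x)) (at t)"
    and \<Phi>0: "\<And>x. x \<in> space M \<Longrightarrow> \<Phi> 0 x = x"
    and C: "\<And>x. x \<in> space M \<Longrightarrow> \<bar>g x\<bar> \<le> C" and D: "\<And>x. x \<in> space M \<Longrightarrow> \<bar>f x\<bar> \<le> D"
  shows "(\<integral>x. g x \<partial>M) = 0"
proof -
  interpret prob_space M by fact
  define h where "h n = 1 / real (Suc n)" for n
  have h: "h n > 0" for n by (simp add: h_def)
  have h0: "h \<longlonglongrightarrow> 0" unfolding h_def by (rule LIMSEQ_Suc[OF lim_1_over_n])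
  define q where "q n x = (f (\<Phi> (h n) x) - f x) / h n" for n x
  have int_f: "integrable M f" by (rule integrable_const_bound[of _ D]) (auto simp: D)
  have int_f': "integrable M (\<lambda>x. f (\<Phi> t x))" for t
    using measurable_space[OF \<Phi>[of t]] by (intro integrable_const_bound[of _ D]) (auto simp: D)
  have "integral\<^sup>L M (\<lambda>x. f (\<Phi> t x)) = integral\<^sup>L M f" for t
    using integral_distr[OF \<Phi>[of t] assms(2)] by (simp add: inv)
  then have q0: "integral\<^sup>L M (q n) = 0" for n
    unfolding q_def using int_f int_f' by simp
  have "(\<lambda>n. integral\<^sup>L M (q n)) \<longlonglongrightarrow> integral\<^sup>L M g"
  proof (rule integral_dominated_convergence[where w = "\<lambda>_. C"])
    show "AE x in M. (\<lambda>n. q n x) \<longlonglongrightarrow> g x"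
    proof (rule AE_I2)
      fix x assume x: "x \<in> space M"
      have "((\<lambda>s. (f (\<Phi> (0 + s) x) - f (\<Phi> 0 x)) / s) \<longlongrightarrow> g (\<Phi> 0 x)) (at 0)"
        using deriv[OF x, of 0] unfolding DERIV_def .
      then have "((\<lambda>s. (f (\<Phi> s x) - f x) / s) \<longlongrightarrow> g x) (at 0)"
        by (simp add: \<Phi>0 x)
      moreover have "filterlim h (at 0) sequentially"
        using h0 h by (simp add: filterlim_at less_imp_neq[symmetric])
      ultimately show "(\<lambda>n. q n x) \<longlonglongrightarrow> g x"
        unfolding q_def by (rule filterlim_compose)
    qed
    show "AE x in M. norm (q n x) \<le> C" for n
    proof (rule AE_I2)
      fix x assume x: "x \<in> space M"
      obtain z where z: "f (\<Phi> (h n) x) - f (\<Phi> 0 x) = (h n - 0) * g (\<Phi> z x)"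
        using MVT2[OF h[of n], of "\<lambda>t. f (\<Phi> t x)" "\<lambda>t. g (\<Phi> t x)"] deriv[OF x] by blast
      then have "q n x = g (\<Phi> z x)" using h[of n] by (simp add: q_def \<Phi>0 x)
      then show "norm (q n x) \<le> C" using C measurable_space[OF \<Phi> x, of z] by simp
    qed
    show "q n \<in> borel_measurable M" for n
      unfolding q_def using measurable_compose[OF \<Phi> assms(2)] by measurable
  qed simp_all
  then show ?thesis by (simp add: q0 LIMSEQ_const_iff)
qed

section \<open>The Schwinger--Dyson equation in a finite box\<close>

definition bdd_meas :: "'a measure \<Rightarrow> ('a \<Rightarrow> real) \<Rightarrow> bool" where
  "bdd_meas M f \<longleftrightarrow> f \<in> borel_measurable M \<and> (\<exists>C. \<forall>x\<in>space M. \<bar>f x\<bar> \<le> C)"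

lemma bdd_meas_measurable [measurable_dest]: "bdd_meas M f \<Longrightarrow> f \<in> borel_measurable M"
  by (simp add: bdd_meas_def)

lemma bdd_meas_cong:
  "(\<And>x. x \<in> space M \<Longrightarrow> f x = g x) \<Longrightarrow> bdd_meas M f \<longleftrightarrow> bdd_meas M g"
  unfolding bdd_meas_def by (auto cong: measurable_cong)

lemma bdd_meas_const [intro]: "bdd_meas M (\<lambda>_. c)"
  by (auto simp: bdd_meas_def)

lemma bdd_meas_add [intro]:
  assumes "bdd_meas M f" "bdd_meas M g"
  shows "bdd_meas M (\<lambda>x. f x + g x)"
proof -
  obtain C D where "\<forall>x\<in>space M. \<bar>f x\<bar> \<le> C" "\<forall>x\<in>space M. \<bar>g x\<bar> \<le> D"
    using assms by (auto simp: bdd_meas_def)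
  then have "\<forall>x\<in>space M. \<bar>f x + g x\<bar> \<le> C + D" by (meson abs_triangle_ineq add_mono order_trans)
  then show ?thesis using assms by (auto simp: bdd_meas_def)
qed

lemma bdd_meas_mult [intro]:
  assumes "bdd_meas M f" "bdd_meas M g"
  shows "bdd_meas M (\<lambda>x. f x * g x)"
proof -
  obtain C D where CD: "\<forall>x\<in>space M. \<bar>f x\<bar> \<le> C" "\<forall>x\<in>space M. \<bar>g x\<bar> \<le> D"
    using assms by (auto simp: bdd_meas_def)
  have "\<forall>x\<in>space M. \<bar>f x * g x\<bar> \<le> C * D"
  proof
    fix x assume "x \<in> space M"
    then have "\<bar>f x\<bar> \<le> C" "\<bar>g x\<bar> \<le> D" using CD by auto
    then show "\<bar>f x * g x\<bar> \<le> C * D"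
      using mult_mono[of "\<bar>f x\<bar>" C "\<bar>g x\<bar>" D] by (auto simp: abs_mult)
  qed
  then show ?thesis using assms by (auto simp: bdd_meas_def)
qed

lemma bdd_meas_diff [intro]:
  "bdd_meas M f \<Longrightarrow> bdd_meas M g \<Longrightarrow> bdd_meas M (\<lambda>x. f x - g x)"
  using bdd_meas_add[of M f "\<lambda>x. -1 * g x"] bdd_meas_mult[of M "\<lambda>_. -1" g] by auto

lemma bdd_meas_sum [intro]:
  "(\<And>k. k \<in> K \<Longrightarrow> bdd_meas M (f k)) \<Longrightarrow> bdd_meas M (\<lambda>x. \<Sum>k\<in>K. f k x)"
  by (induction K rule: infinite_finite_induct) auto

lemma bdd_meas_sum_list [intro]:
  "(\<And>k. k \<in> set ks \<Longrightarrow> bdd_meas M (f k)) \<Longrightarrow> bdd_meas M (\<lambda>x. \<Sum>k\<leftarrow>ks. f k x)"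
  by (induction ks) auto

lemma bdd_meas_exp [intro]:
  assumes "bdd_meas M f"
  shows "bdd_meas M (\<lambda>x. exp (f x))"
proof -
  obtain C where C: "\<forall>x\<in>space M. \<bar>f x\<bar> \<le> C" using assms by (auto simp: bdd_meas_def)
  then have "\<forall>x\<in>space M. \<bar>exp (f x)\<bar> \<le> exp C" by (auto dest!: abs_le_D1)
  then show ?thesis using assms by (auto simp: bdd_meas_def)
qed

lemma bdd_meas_integrable: "prob_space M \<Longrightarrow> bdd_meas M f \<Longrightarrow> integrable M f"
  unfolding bdd_meas_def
  by (elim conjE exE, rule finite_measure.integrable_const_bound[OF prob_space.finite_measure])
    (auto intro!: AE_I2)

definition mat_bdd_meas :: "nat \<Rightarrow> 'a measure \<Rightarrow> ('a \<Rightarrow> real mat) \<Rightarrow> bool" where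
  "mat_bdd_meas N M Z \<longleftrightarrow> (\<forall>x\<in>space M. Z x \<in> carrier_mat N N) \<and>
     (\<forall>a<N. \<forall>b<N. bdd_meas M (\<lambda>x. Z x $$ (a, b)))"

lemma mat_bdd_meas_const [intro]: "A \<in> carrier_mat N N \<Longrightarrow> mat_bdd_meas N M (\<lambda>_. A)"
  by (auto simp: mat_bdd_meas_def)

lemma mat_bdd_meas_mult [intro]:
  assumes Y: "mat_bdd_meas N M Y" and Z: "mat_bdd_meas N M Z"
  shows "mat_bdd_meas N M (\<lambda>x. Y x * Z x)"
proof -
  have "bdd_meas M (\<lambda>x. (Y x * Z x) $$ (a, b))" if "a < N" "b < N" for a b
  proof -
    have "bdd_meas M (\<lambda>x. \<Sum>k<N. Y x $$ (a, k) * Z x $$ (k, b))"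
      using Y Z that by (intro bdd_meas_sum bdd_meas_mult) (auto simp: mat_bdd_meas_def)
    then show ?thesis
      by (rule iffD1[OF bdd_meas_cong, rotated])
        (use Y Z that in \<open>auto simp: mat_bdd_meas_def mult_mat_entry[of _ N]\<close>)
  qed
  then show ?thesis using Y Z by (auto simp: mat_bdd_meas_def)
qed

lemma bdd_meas_trace [intro]:
  assumes Z: "mat_bdd_meas N M Z"
  shows "bdd_meas M (\<lambda>x. mat_trace (Z x))"
proof -
  have "bdd_meas M (\<lambda>x. \<Sum>k<N. Z x $$ (k, k))"
    using Z by (intro bdd_meas_sum) (auto simp: mat_bdd_meas_def)
  then show ?thesis
    by (rule iffD1[OF bdd_meas_cong, rotated]) (use Z in \<open>auto simp: mat_bdd_meas_def
        mat_trace_eq[of _ N]\<close>)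
qed

section \<open>Measurability and invariance of left multiplication\<close>

lemma measurable_SO_entry:
  assumes "sets \<mu> = sets (SO_borel N)" "a < N" "b < N"
  shows "(\<lambda>A. A $$ (a, b)) \<in> borel_measurable \<mu>"
proof -
  let ?f = "\<lambda>A. \<lambda>ij \<in> {..<N} \<times> {..<N}. A $$ ij :: real"
  have "?f \<in> measurable (SO_borel N) (Pi\<^sub>M ({..<N} \<times> {..<N}) (\<lambda>_. borel))"
    unfolding SO_borel_def by (rule measurable_vimage_algebra1) (auto simp: space_PiM)
  from measurable_compose[OF this measurable_component_singleton[of "(a, b)"]]
  have "(\<lambda>A. A $$ (a, b)) \<in> borel_measurable (SO_borel N)" using assms by simp
  then show ?thesis using measurable_cong_sets[OF assms(1) refl] by blast
qed

lemma space_haar: "is_haar_prob N \<mu> \<Longrightarrow> space \<mu> = carrier (SO N)"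
  using sets_eq_imp_space_eq[of \<mu> "SO_borel N"] by (simp add: is_haar_prob_def SO_borel_def)

lemma measurable_SO_mult:
  assumes \<mu>: "is_haar_prob N \<mu>" and R: "R \<in> carrier (SO N)"
  shows "(\<lambda>A. R * A) \<in> measurable \<mu> \<mu>"
proof -
  have s: "sets \<mu> = sets (SO_borel N)" using \<mu> by (simp add: is_haar_prob_def)
  have "(\<lambda>A. R * A) \<in> measurable \<mu> (SO_borel N)"
    unfolding SO_borel_def
  proof (rule measurable_vimage_algebra2)
    show "(\<lambda>A. R * A) \<in> space \<mu> \<rightarrow> carrier (SO N)" using R by (auto simp: space_haar[OF \<mu>])
    show "(\<lambda>A. \<lambda>ij \<in> {..<N} \<times> {..<N}. (R * A) $$ ij) \<in>
        measurable \<mu> (Pi\<^sub>M ({..<N} \<times> {..<N}) (\<lambda>_. borel))"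
    proof (rule measurable_restrict)
      fix ij assume "ij \<in> {..<N} \<times> {..<N}"
      then obtain a b where ab: "ij = (a, b)" "a < N" "b < N" by auto
      have "(\<lambda>A. \<Sum>k<N. R $$ (a, k) * A $$ (k, b)) \<in> borel_measurable \<mu>"
        using measurable_SO_entry[OF s _ ab(3)] by measurable
      then show "(\<lambda>A. (R * A) $$ ij) \<in> borel_measurable \<mu>"
        by (rule iffD1[OF measurable_cong, rotated])
          (use R ab in \<open>auto simp: space_haar[OF \<mu>] mult_mat_entry[of _ N]\<close>)
    qed
  qed
  then show ?thesis using measurable_cong_sets[OF refl s] by blast
qed

text \<open>The preimage is the left coset by the inverse of \<open>R\<close>, to which the
  invariance of the Haar measure applies.\<close>

lemma haar_vimage_mult:
  assumes \<mu>: "is_haar_prob N \<mu>" and R: "R \<in> carrier (SO N)" and S: "S \<in> sets \<mu>"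
  shows "emeasure \<mu> ((\<lambda>A. R * A) -` S \<inter> space \<mu>) = emeasure \<mu> S"
proof -
  have sub: "S \<subseteq> carrier (SO N)" using sets.sets_into_space[OF S] by (simp add: space_haar[OF \<mu>])
  have cancel: "R * (transpose_mat R * A) = A" "transpose_mat R * (R * A) = A"
    if "A \<in> carrier (SO N)" for A
    using R that by (simp_all add: left_mult_one_mat[of _ N N] flip: assoc_mult_mat[of _ N N _ N _
        N])
  have "(\<lambda>A. R * A) -` S \<inter> space \<mu> = transpose_mat R <#\<^bsub>SO N\<^esub> S"
    unfolding space_haar[OF \<mu>] l_coset_def
  proof (intro equalityI subsetI)
    fix A assume "A \<in> (\<lambda>A. R * A) -` S \<inter> carrier (SO N)"
    then have "A = transpose_mat R * (R * A)" "R * A \<in> S" using cancel by auto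
    then show "A \<in> (\<Union>h\<in>S. {transpose_mat R \<otimes>\<^bsub>SO N\<^esub> h})" by auto
  next
    fix A assume "A \<in> (\<Union>h\<in>S. {transpose_mat R \<otimes>\<^bsub>SO N\<^esub> h})"
    then obtain h where h: "h \<in> S" "A = transpose_mat R * h" by auto
    then have "R * A = h" using cancel(1)[of h] sub by auto
    then show "A \<in> (\<lambda>A. R * A) -` S \<inter> carrier (SO N)" using h sub R by auto
  qed
  then show ?thesis using \<mu> R S by (auto simp: is_haar_prob_def)
qed

locale gauge_box =
  fixes N :: nat and haar :: "nat \<Rightarrow> real mat measure" and \<Lambda> :: "vertex set" and \<beta> :: real
  assumes haar: "is_haar_prob N (haar N)" and fin: "finite \<Lambda>"
begin

abbreviation "M \<equiv> config_measure haar \<Lambda> N"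
abbreviation "I \<equiv> pos_edges_in \<Lambda>"

definition in_box :: "edge list \<Rightarrow> bool" where
  "in_box w \<longleftrightarrow> set w \<subseteq> edges \<inter> \<Lambda> \<times> \<Lambda>"

lemma in_box_simps [simp]:
  "in_box []" "in_box (c # w) \<longleftrightarrow> c \<in> edges \<inter> \<Lambda> \<times> \<Lambda> \<and> in_box w"
  "in_box (u @ v) \<longleftrightarrow> in_box u \<and> in_box v"
  by (auto simp: in_box_def)

lemma in_box_rv [simp]: "in_box (rv w) \<longleftrightarrow> in_box w"
  by (auto simp: in_box_def reversal_def edges_def abs_minus_commute)

lemma finite_I: "finite I"
  using fin by (auto simp: pos_edges_in_def)

lemma und_in_I: "c \<in> edges \<inter> \<Lambda> \<times> \<Lambda> \<Longrightarrow> und c \<in> I"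
  using und_pos[of c] by (auto simp: und_def pos_edges_in_def reversal_def)

lemma SO_on_space:
  assumes "Q \<in> space M" "in_box w"
  shows "SO_on N w Q"
proof -
  have "Q (und c) \<in> carrier (SO N)" if "c \<in> set w" for c
    using that assms und_in_I[of c] space_haar[OF haar]
    by (auto simp: config_measure_def space_PiM in_box_def)
  then show ?thesis using assms by (auto simp: SO_on_def SO_edge_def in_box_def)
qed

sublocale H: prob_space "haar N"
  using haar by (simp add: is_haar_prob_def)

sublocale product_prob_space "\<lambda>_. haar N" I
  by standard

lemma prob_M: "prob_space M"
  unfolding config_measure_def by (rule prob_space_PiM) (rule H.prob_space_axioms)

lemma bdd_meas_config_entry:
  assumes "c \<in> I" "a < N" "b < N"
  shows "bdd_meas M (\<lambda>Q. Q c $$ (a, b))"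
proof -
  have "(\<lambda>Q. Q c) \<in> measurable M (haar N)"
    unfolding config_measure_def using assms by (rule_tac measurable_component_singleton)
  moreover have "(\<lambda>A. A $$ (a, b)) \<in> borel_measurable (haar N)"
    using haar assms by (intro measurable_SO_entry) (auto simp: is_haar_prob_def)
  moreover have "\<bar>Q c $$ (a, b)\<bar> \<le> 1" if "Q \<in> space M" for Q
    using that assms space_haar[OF haar]
    by (intro SO_entry_bound[of _ N]) (auto simp: config_measure_def space_PiM)
  ultimately show ?thesis unfolding bdd_meas_def by (auto intro: measurable_compose)
qed

lemma mat_bdd_meas_edge:
  assumes c: "c \<in> edges \<inter> \<Lambda> \<times> \<Lambda>"
  shows "mat_bdd_meas N M (\<lambda>Q. edge_matrix N Q c)"
  unfolding mat_bdd_meas_def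
proof (intro conjI ballI allI impI)
  have Q: "SO_edge N c Q" if "Q \<in> space M" for Q
    using SO_on_space[OF that, of "[c]"] c by simp
  show "edge_matrix N Q c \<in> carrier_mat N N" if "Q \<in> space M" for Q
    using edge_matrix_SO[OF Q[OF that]] by auto
  fix a b assume ab: "a < N" "b < N"
  have "bdd_meas M (\<lambda>Q. if c \<in> pos_edges then Q c $$ (a, b) else Q (reversal c) $$ (b, a))"
    using bdd_meas_config_entry[of "und c"] und_in_I[OF c] ab
    by (cases "c \<in> pos_edges") (auto simp: und_def)
  then show "bdd_meas M (\<lambda>Q. edge_matrix N Q c $$ (a, b))"
  proof (rule iffD1[OF bdd_meas_cong, rotated])
    fix x assume x: "x \<in> space M"
    have "x (und c) \<in> carrier_mat N N" using Q[OF x] by (auto simp: SO_edge_def)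
    then show "(if c \<in> pos_edges then x c $$ (a, b) else x (reversal c) $$ (b, a)) = edge_matrix N
        x c $$ (a, b)"
      using ab edge_matrix_eq[OF Q[OF x]] by (auto simp: und_def split: if_splits)
  qed
qed

lemma mat_bdd_meas_walk [intro]: "in_box w \<Longrightarrow> mat_bdd_meas N M (\<lambda>Q. walk_matrix N Q w)"
  by (induction w) (auto intro!: mat_bdd_meas_edge)

lemma bdd_meas_wilson [intro]: "in_box w \<Longrightarrow> bdd_meas M (wilson N w)"
  unfolding wilson_def by auto

lemma in_box_plaquette: "p \<in> pos_plaquettes_in \<Lambda> \<Longrightarrow> in_box p"
  by (auto simp: in_box_def pos_plaquettes_in_def is_plaquette_def closed_walk_def)

lemma bdd_meas_boltzmann [intro]: "bdd_meas M (boltzmann \<Lambda> N \<beta>)"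
  unfolding boltzmann_def by (intro bdd_meas_exp bdd_meas_mult bdd_meas_const bdd_meas_sum
      bdd_meas_wilson in_box_plaquette)

lemma measurable_twist:
  assumes ij: "i < N" "j < N" and e: "e \<in> I"
  shows "(\<lambda>Q. twist N i j e Q t) \<in> measurable M M"
proof -
  have R: "givens N i j t \<in> carrier (SO N)" using ij by (rule givens_SO)
  have sp: "space (haar N) = carrier (SO N)" by (rule space_haar[OF haar])
  show ?thesis
    unfolding config_measure_def
  proof (rule measurable_PiM_single')
    show "(\<lambda>Q. twist N i j e Q t c) \<in> measurable (Pi\<^sub>M I (\<lambda>_. haar N)) (haar N)" if "c \<in> I" for c
    proof (cases "c = e")
      case True
      have "(\<lambda>Q. givens N i j t * Q e) \<in> measurable (Pi\<^sub>M I (\<lambda>_. haar N)) (haar N)"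
        by (rule measurable_compose[OF measurable_component_singleton[OF e] measurable_SO_mult[OF
            haar R]])
      then show ?thesis using True by (simp add: twist_def)
    next
      case False then show ?thesis using that by (simp add: twist_def)
    qed
    show "(\<lambda>Q. twist N i j e Q t) \<in> space (Pi\<^sub>M I (\<lambda>_. haar N)) \<rightarrow> (\<Pi>\<^sub>E i\<in>I. space (haar N))"
      using R e by (auto simp: space_PiM twist_def sp PiE_def extensional_def Pi_iff)
  qed
qed

text \<open>It suffices to compare product sets, as finitely many edges are involved. The preimage
  of a product set changes only its factor at \<open>e\<close>, and there the Haar measure is
  invariant.\<close>

lemma distr_twist:
  assumes ij: "i < N" "j < N" and e: "e \<in> I"
  shows "distr M M (\<lambda>Q. twist N i j e Q t) = M"
proof -
  have R: "givens N i j t \<in> carrier (SO N)" using ij by (rule givens_SO)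
  have sp: "space (haar N) = carrier (SO N)" by (rule space_haar[OF haar])
  have "distr M M (\<lambda>Q. twist N i j e Q t) = Pi\<^sub>M I (\<lambda>_. haar N)"
  proof (rule PiM_eqI[OF finite_I])
    show "sets (distr M M (\<lambda>Q. twist N i j e Q t)) = sets (Pi\<^sub>M I (\<lambda>_. haar N))"
      by (simp add: config_measure_def)
    fix A assume A: "\<And>c. c \<in> I \<Longrightarrow> A c \<in> sets (haar N)"
    define B where "B = A(e := (\<lambda>X. givens N i j t * X) -` A e \<inter> space (haar N))"
    have B: "B c \<in> sets (haar N)" if "c \<in> I" for c
      using A[OF that] measurable_sets[OF measurable_SO_mult[OF haar R]] that by (auto simp: B_def)
    have "(\<lambda>Q. twist N i j e Q t) -` (Pi\<^sub>E I A) \<inter> space M = Pi\<^sub>E I B"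
    proof (intro equalityI subsetI)
      fix Q assume "Q \<in> (\<lambda>Q. twist N i j e Q t) -` (Pi\<^sub>E I A) \<inter> space M"
      then have Q: "twist N i j e Q t \<in> Pi\<^sub>E I A" "Q \<in> Pi\<^sub>E I (\<lambda>_. space (haar N))"
        by (auto simp: config_measure_def space_PiM)
      have "Q c \<in> B c" if "c \<in> I" for c
        using PiE_mem[OF Q(1) that] PiE_mem[OF Q(2) that] by (auto simp: B_def twist_def)
      then show "Q \<in> Pi\<^sub>E I B" using Q(2) by (auto simp: PiE_def)
    next
      fix Q assume Q: "Q \<in> Pi\<^sub>E I B"
      have "twist N i j e Q t c \<in> A c" if "c \<in> I" for c
        using PiE_mem[OF Q that] by (auto simp: B_def twist_def split: if_splits)
      moreover have "Q c \<in> space (haar N)" if "c \<in> I" for c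
        using PiE_mem[OF Q that] B[OF that] sets.sets_into_space by blast
      ultimately show "Q \<in> (\<lambda>Q. twist N i j e Q t) -` (Pi\<^sub>E I A) \<inter> space M"
        using Q e by (auto simp: config_measure_def space_PiM PiE_def extensional_def twist_def)
    qed
    then have "emeasure (distr M M (\<lambda>Q. twist N i j e Q t)) (Pi\<^sub>E I A) = emeasure (Pi\<^sub>M I (\<lambda>_.
        haar N)) (Pi\<^sub>E I B)"
      using A finite_I by (subst emeasure_distr[OF measurable_twist[OF assms]])
        (auto simp: config_measure_def intro!: sets_PiM_I_finite)
    also have "\<dots> = (\<Prod>c\<in>I. emeasure (haar N) (B c))"
      by (rule emeasure_PiM[OF finite_I B])
    also have "\<dots> = (\<Prod>c\<in>I. emeasure (haar N) (A c))"
      using haar_vimage_mult[OF haar R A[OF e]] by (intro prod.cong) (auto simp: B_def)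
    finally show "emeasure (distr M M (\<lambda>Q. twist N i j e Q t)) (Pi\<^sub>E I A) = (\<Prod>c\<in>I. emeasure (haar
        N) (A c))" .
  qed
  then show ?thesis by (simp add: config_measure_def)
qed

section \<open>Integration by parts for the Boltzmann weight\<close>

lemma in_box_cuts:
  assumes "(s, P, S) \<in> set (cuts reversal e w)" "in_box w"
  shows "in_box P" "in_box S"
  using cuts_concat[OF assms(1)] assms(2) by auto

text \<open>Up to the factor -2, the contraction of a walk with itself: splitting into two walks
  minus twisting, where one piece is reversed.\<close>

definition SD_split :: "edge \<Rightarrow> edge list \<Rightarrow> (edge \<Rightarrow> real mat) \<Rightarrow> real" where
  "SD_split e w Q = (\<Sum>(s, P, S)\<leftarrow>cuts reversal e w.
     s * (wilson N P Q * wilson N S Q - wilson N (P @ rv S) Q))"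

text \<open>Half the contraction of \<open>w\<close> with the plaquettes of the action: merging with
  the inverse plaquette minus merging with the plaquette, read from the cut as
  \<open>S @ P\<close>.\<close>

definition SD_deform :: "edge \<Rightarrow> edge list \<Rightarrow> (edge \<Rightarrow> real mat) \<Rightarrow> real" where
  "SD_deform e w Q = (\<Sum>p\<in>pos_plaquettes_in \<Lambda>. \<Sum>(s, P, S)\<leftarrow>cuts reversal e p.
     s * (wilson N (w @ rv (S @ P)) Q - wilson N (w @ S @ P) Q))"

lemma bdd_meas_SD_split [intro]: "in_box w \<Longrightarrow> bdd_meas M (SD_split e w)"
  unfolding SD_split_def
proof (intro bdd_meas_sum_list, clarify)
  fix s P S assume w: "in_box w" and c: "(s, P, S) \<in> set (cuts reversal e w)"
  from in_box_cuts[OF c w]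
  show "bdd_meas M (\<lambda>Q. s * (wilson N P Q * wilson N S Q - wilson N (P @ rv S) Q))"
    by (intro bdd_meas_mult bdd_meas_diff bdd_meas_wilson bdd_meas_const) auto
qed

lemma bdd_meas_SD_deform [intro]: "in_box w \<Longrightarrow> bdd_meas M (SD_deform e w)"
  unfolding SD_deform_def
proof (intro bdd_meas_sum bdd_meas_sum_list, clarify)
  fix p s P S assume w: "in_box w" and p: "p \<in> pos_plaquettes_in \<Lambda>" "(s, P, S) \<in> set (cuts
      reversal e p)"
  then have "in_box P" "in_box S" using in_box_cuts[OF p(2) in_box_plaquette[OF p(1)]] by auto
  with w show "bdd_meas M (\<lambda>Q. s * (wilson N (w @ rv (S @ P)) Q - wilson N (w @ S @ P) Q))"
    by (intro bdd_meas_mult bdd_meas_diff bdd_meas_wilson bdd_meas_const) auto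
qed

text \<open>The function integrated by parts is the trace of X times \<open>w\<close>, multiplied by
  the Boltzmann weight. \<open>K\<close> comes from differentiating the trace, \<open>L\<close> from
  the exponent.\<close>

lemma twist_ibp:
  assumes ij: "i < N" "j < N" and e: "e \<in> I" and w: "in_box w"
  defines "K \<equiv> \<lambda>Q. \<Sum>(s, P, S)\<leftarrow>cuts reversal e w. s * mat_trace (so_gen N i j *
      (walk_matrix N Q P * (so_gen N i j * walk_matrix N Q S)))"
    and "L \<equiv> \<lambda>Q. \<Sum>p\<in>pos_plaquettes_in \<Lambda>. \<Sum>(s, P, S)\<leftarrow>cuts reversal e p.
      s * (mat_trace (so_gen N i j * walk_matrix N Q w) * mat_trace (so_gen N i j * walk_matrix N
          Q (S @ P)))"
  shows "(\<integral>Q. (K Q + real N * \<beta> * L Q) * boltzmann \<Lambda> N \<beta> Q \<partial>M) = 0"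
    and "bdd_meas M (\<lambda>Q. (K Q + real N * \<beta> * L Q) * boltzmann \<Lambda> N \<beta> Q)"
proof -
  let ?X = "so_gen N i j" and ?b = "boltzmann \<Lambda> N \<beta>"
  define f where "f Q = mat_trace (?X * walk_matrix N Q w) * ?b Q" for Q
  define g where "g Q = (K Q + real N * \<beta> * L Q) * ?b Q" for Q
  have ep: "e \<in> pos_edges" using e by (simp add: pos_edges_in_def)
  have K: "bdd_meas M K"
    unfolding K_def
  proof (intro bdd_meas_sum_list, clarify)
    fix s P S assume "(s, P, S) \<in> set (cuts reversal e w)"
    from in_box_cuts[OF this w]
    show "bdd_meas M (\<lambda>Q. s * mat_trace (?X * (walk_matrix N Q P * (?X * walk_matrix N Q S))))"
      by (intro bdd_meas_mult bdd_meas_const bdd_meas_trace[of N] mat_bdd_meas_mult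
          mat_bdd_meas_const
          mat_bdd_meas_walk so_gen_carrier)
  qed
  have L: "bdd_meas M L"
    unfolding L_def
  proof (intro bdd_meas_sum bdd_meas_sum_list, clarify)
    fix p s P S assume p: "p \<in> pos_plaquettes_in \<Lambda>" "(s, P, S) \<in> set (cuts reversal e p)"
    from in_box_cuts[OF p(2) in_box_plaquette[OF p(1)]] w
    show "bdd_meas M (\<lambda>Q. s * (mat_trace (?X * walk_matrix N Q w) * mat_trace (?X * walk_matrix N
        Q (S @ P))))"
      by (intro bdd_meas_mult bdd_meas_const bdd_meas_trace[of N] mat_bdd_meas_mult
          mat_bdd_meas_const
          mat_bdd_meas_walk so_gen_carrier) auto
  qed
  have bf: "bdd_meas M f"
    unfolding f_def using w
    by (intro bdd_meas_mult bdd_meas_boltzmann bdd_meas_trace[of N] mat_bdd_meas_mult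
        mat_bdd_meas_const
        mat_bdd_meas_walk so_gen_carrier)
  show bg: "bdd_meas M (\<lambda>Q. (K Q + real N * \<beta> * L Q) * boltzmann \<Lambda> N \<beta> Q)"
    by (intro bdd_meas_mult bdd_meas_add bdd_meas_boltzmann bdd_meas_const K L)
  obtain C D where C: "\<forall>Q\<in>space M. \<bar>g Q\<bar> \<le> C" and D: "\<forall>Q\<in>space M. \<bar>f Q\<bar> \<le> D"
    using bf bg by (auto simp: bdd_meas_def g_def)
  have "(\<integral>Q. g Q \<partial>M) = 0"
  proof (rule flow_integral_eq_zero[where f = f and C = C and D = D and \<Phi> = "\<lambda>t Q. twist N i j e Q
      t"])
    fix Q t assume Q: "Q \<in> space M"
    let ?Q = "\<lambda>t. twist N i j e Q t"
    have "((\<lambda>t. \<Sum>p\<in>pos_plaquettes_in \<Lambda>. wilson N p (?Q t)) has_real_derivative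
      (\<Sum>p\<in>pos_plaquettes_in \<Lambda>. \<Sum>(s, P, S)\<leftarrow>cuts reversal e p. s * mat_trace (?X * walk_matrix N (?Q
          t) (S @ P)))) (at t)"
      by (intro DERIV_sum wilson_twist_deriv ij ep SO_on_space[OF Q] in_box_plaquette)
    from DERIV_cmult[OF this, of "real N * \<beta>"]
    have "((\<lambda>t. ?b (?Q t)) has_real_derivative ?b (?Q t) * (real N * \<beta> *
      (\<Sum>p\<in>pos_plaquettes_in \<Lambda>. \<Sum>(s, P, S)\<leftarrow>cuts reversal e p. s * mat_trace (?X * walk_matrix N (?Q
          t) (S @ P))))) (at t)"
      unfolding boltzmann_def by (rule DERIV_fun_exp)
    from DERIV_mult[OF so_gen_trace_twist_deriv[OF ij ep SO_on_space[OF Q w]] this]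
    have "((\<lambda>t. f (?Q t)) has_real_derivative K (?Q t) * ?b (?Q t) +
      ?b (?Q t) * (real N * \<beta> * (\<Sum>p\<in>pos_plaquettes_in \<Lambda>. \<Sum>(s, P, S)\<leftarrow>cuts reversal e p. s *
          mat_trace (?X * walk_matrix N (?Q t) (S @ P))))
        * mat_trace (?X * walk_matrix N (?Q t) w)) (at t)"
      by (simp add: f_def K_def)
    moreover have "mat_trace (?X * walk_matrix N (?Q t) w) * (\<Sum>p\<in>pos_plaquettes_in \<Lambda>. \<Sum>(s, P,
        S)\<leftarrow>cuts reversal e p. s * mat_trace (?X * walk_matrix N (?Q t) (S @ P)))
        = L (?Q t)"
      unfolding L_def sum_distrib_left
      by (simp add: sum_list_const_mult[symmetric] case_prod_unfold mult_ac)
    ultimately show "((\<lambda>t. f (?Q t)) has_real_derivative g (?Q t)) (at t)"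
      by (simp add: g_def algebra_simps)
  next
    fix Q assume "Q \<in> space M"
    then have "Q e \<in> carrier_mat N N"
      using e space_haar[OF haar] by (auto simp: config_measure_def space_PiM)
    then show "twist N i j e Q 0 = Q"
      by (auto simp: twist_def givens_0 left_mult_one_mat[of _ N N])
  qed (use bf bg C D prob_M measurable_twist[OF ij e] distr_twist[OF ij e] in
      \<open>auto simp: bdd_meas_def g_def[abs_def]\<close>)
  then show "(\<integral>Q. (K Q + real N * \<beta> * L Q) * boltzmann \<Lambda> N \<beta> Q \<partial>M) = 0" by (simp add: g_def)
qed

text \<open>The identities of \<open>twist_ibp\<close> are summed over all pairs (i, j). The two
  contractions give -2 times the splitting and 2 times the deformation, which explains the relative
  sign.\<close>

lemma SD_integral:
  assumes e: "e \<in> I" and w: "in_box w"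
  shows "(\<integral>Q. (SD_split e w Q - real N * \<beta> * SD_deform e w Q) * boltzmann \<Lambda> N \<beta> Q \<partial>M) = 0"
proof -
  let ?b = "boltzmann \<Lambda> N \<beta>"
  define K where "K i j Q = (\<Sum>(s, P, S)\<leftarrow>cuts reversal e w. s * mat_trace (so_gen N i j *
      (walk_matrix N Q P * (so_gen N i j * walk_matrix N Q S))))" for i j Q
  define L where "L i j Q = (\<Sum>p\<in>pos_plaquettes_in \<Lambda>. \<Sum>(s, P, S)\<leftarrow>cuts reversal e p.
      s * (mat_trace (so_gen N i j * walk_matrix N Q w) * mat_trace (so_gen N i j * walk_matrix N
          Q (S @ P))))" for i j Q
  note ibp = twist_ibp[OF _ _ e w, folded K_def L_def]
  have "(\<integral>Q. (\<Sum>i<N. \<Sum>j<N. (K i j Q + real N * \<beta> * L i j Q) * ?b Q) \<partial>M)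
      = (\<Sum>i<N. \<Sum>j<N. (\<integral>Q. (K i j Q + real N * \<beta> * L i j Q) * ?b Q \<partial>M))"
    using bdd_meas_integrable[OF prob_M ibp(2)]
    by (subst Bochner_Integration.integral_sum) (auto intro!: Bochner_Integration.integrable_sum
        sum.cong Bochner_Integration.integral_sum)
  also have "\<dots> = 0" using ibp(1) by simp
  also have "(\<integral>Q. (\<Sum>i<N. \<Sum>j<N. (K i j Q + real N * \<beta> * L i j Q) * ?b Q) \<partial>M) =
      (\<integral>Q. -2 * ((SD_split e w Q - real N * \<beta> * SD_deform e w Q) * ?b Q) \<partial>M)"
  proof (intro Bochner_Integration.integral_cong refl)
    fix Q assume Q: "Q \<in> space M"
    have "(\<Sum>i<N. \<Sum>j<N. K i j Q) = (\<Sum>(s, P, S)\<leftarrow>cuts reversal e w. \<Sum>i<N. \<Sum>j<N. s * mat_trace (so_gen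
        N i j *
      (walk_matrix N Q P * (so_gen N i j * walk_matrix N Q S))))"
      by (simp add: K_def sum_sum_list_swap case_prod_unfold)
    also have "\<dots> = (\<Sum>(s, P, S)\<leftarrow>cuts reversal e w. -2 * (s * (wilson N P Q * wilson N S Q - wilson
        N (P @ rv S) Q)))"
    proof (intro arg_cong[where f = sum_list] map_cong refl, clarify)
      fix s P S assume "(s, P, S) \<in> set (cuts reversal e w)"
      from in_box_cuts[OF this w] have PS: "SO_on N P Q" "SO_on N S Q" using SO_on_space[OF Q] by
          auto
      show "(\<Sum>i<N. \<Sum>j<N. s * mat_trace (so_gen N i j * (walk_matrix N Q P * (so_gen N i j *
          walk_matrix N Q S)))) =
          -2 * (s * (wilson N P Q * wilson N S Q - wilson N (P @ rv S) Q))"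
        unfolding sum_distrib_left[symmetric]
          casimir_same_trace[OF walk_matrix_carrier[OF PS(1)] walk_matrix_carrier[OF PS(2)]]
        using PS by (simp add: wilson_def walk_matrix_append walk_matrix_rv algebra_simps)
    qed
    also have "\<dots> = -2 * SD_split e w Q"
      by (simp only: SD_split_def case_prod_unfold sum_list_const_mult)
    finally have K: "(\<Sum>i<N. \<Sum>j<N. K i j Q) = -2 * SD_split e w Q" .
    have "(\<Sum>i<N. \<Sum>j<N. L i j Q) = (\<Sum>p\<in>pos_plaquettes_in \<Lambda>. \<Sum>(s, P, S)\<leftarrow>cuts reversal e p. \<Sum>i<N. \<Sum>j<N.
      s * (mat_trace (so_gen N i j * walk_matrix N Q w) * mat_trace (so_gen N i j * walk_matrix N
          Q (S @ P))))"
      unfolding L_def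
      by (subst sum_swap3) (simp add: sum_sum_list_swap case_prod_unfold)
    also have "\<dots> = (\<Sum>p\<in>pos_plaquettes_in \<Lambda>. \<Sum>(s, P, S)\<leftarrow>cuts reversal e p.
        2 * (s * (wilson N (w @ rv (S @ P)) Q - wilson N (w @ S @ P) Q)))"
    proof (intro sum.cong arg_cong[where f = sum_list] map_cong refl, clarify)
      fix p s P S assume p: "p \<in> pos_plaquettes_in \<Lambda>" "(s, P, S) \<in> set (cuts reversal e p)"
      from in_box_cuts[OF p(2) in_box_plaquette[OF p(1)]]
      have PS: "SO_on N (S @ P) Q" and w': "SO_on N w Q" using SO_on_space[OF Q] w by auto
      have rw: "walk_matrix N Q (w @ rv (S @ P)) = walk_matrix N Q w * transpose_mat (walk_matrix
          N Q (S @ P))"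
        "walk_matrix N Q (w @ S @ P) = walk_matrix N Q w * walk_matrix N Q (S @ P)"
        using PS w' by (simp_all only: walk_matrix_append walk_matrix_rv SO_on_rv)
      show "(\<Sum>i<N. \<Sum>j<N. s * (mat_trace (so_gen N i j * walk_matrix N Q w) * mat_trace (so_gen N i
          j * walk_matrix N Q (S @ P)))) =
          2 * (s * (wilson N (w @ rv (S @ P)) Q - wilson N (w @ S @ P) Q))"
        unfolding sum_distrib_left[symmetric] wilson_def rw
          casimir_two_traces[OF walk_matrix_carrier[OF w'] walk_matrix_carrier[OF PS]] by simp
    qed
    also have "\<dots> = 2 * SD_deform e w Q"
      by (simp add: SD_deform_def sum_list_const_mult case_prod_unfold sum_distrib_left)
    finally have L: "(\<Sum>i<N. \<Sum>j<N. L i j Q) = 2 * SD_deform e w Q" .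
    have "(\<Sum>i<N. \<Sum>j<N. (K i j Q + real N * \<beta> * L i j Q) * ?b Q) =
        ((\<Sum>i<N. \<Sum>j<N. K i j Q) + real N * \<beta> * (\<Sum>i<N. \<Sum>j<N. L i j Q)) * ?b Q"
      by (simp add: sum_distrib_left sum_distrib_right sum.distrib algebra_simps)
    then show "(\<Sum>i<N. \<Sum>j<N. (K i j Q + real N * \<beta> * L i j Q) * ?b Q) =
        -2 * ((SD_split e w Q - real N * \<beta> * SD_deform e w Q) * ?b Q)"
      unfolding K L by (simp add: algebra_simps)
  qed
  finally show ?thesis by simp
qed

section \<open>Linearity of Gibbs expectations\<close>

abbreviation "gexp \<equiv> gibbs_expectation haar \<Lambda> N \<beta>"

lemma gibbs_expectation_eq:
  assumes f: "bdd_meas M f"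
  shows "gexp f = (\<integral>Q. f Q * boltzmann \<Lambda> N \<beta> Q \<partial>M) / partition_function haar \<Lambda> N \<beta>"
proof -
  let ?Z = "partition_function haar \<Lambda> N \<beta>"
  \<comment> \<open>Nonnegativity of the density, so that \<open>ennreal\<close> does not truncate
    it.\<close>
  have "?Z \<ge> 0" by (simp add: partition_function_def boltzmann_def)
  then have "gexp f = (\<integral>Q. (boltzmann \<Lambda> N \<beta> Q / ?Z) *\<^sub>R f Q \<partial>M)"
    unfolding gibbs_expectation_def gibbs_def
    using bdd_meas_measurable[OF bdd_meas_boltzmann] bdd_meas_measurable[OF f]
    by (intro integral_density) (auto simp: boltzmann_def[of \<Lambda> N \<beta>, abs_def])
  also have "\<dots> = (\<integral>Q. f Q * boltzmann \<Lambda> N \<beta> Q / ?Z \<partial>M)"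
    by (simp add: mult.commute)
  finally show ?thesis by simp
qed

lemma gibbs_integrable: "bdd_meas M f \<Longrightarrow> integrable M (\<lambda>Q. f Q * boltzmann \<Lambda> N \<beta> Q)"
  by (intro bdd_meas_integrable prob_M) auto

lemma gibbs_diff: "bdd_meas M f \<Longrightarrow> bdd_meas M g \<Longrightarrow> gexp (\<lambda>Q. f Q - g Q) = gexp f - gexp g"
  using gibbs_integrable[of f] gibbs_integrable[of g]
  by (simp add: gibbs_expectation_eq bdd_meas_diff left_diff_distrib diff_divide_distrib)

lemma gibbs_add: "bdd_meas M f \<Longrightarrow> bdd_meas M g \<Longrightarrow> gexp (\<lambda>Q. f Q + g Q) = gexp f + gexp g"
  using gibbs_integrable[of f] gibbs_integrable[of g]
  by (simp add: gibbs_expectation_eq bdd_meas_add distrib_right add_divide_distrib)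

lemma gibbs_cmult: "bdd_meas M f \<Longrightarrow> gexp (\<lambda>Q. c * f Q) = c * gexp f"
  using gibbs_integrable[of f]
  by (simp add: gibbs_expectation_eq bdd_meas_mult bdd_meas_const mult.assoc)

lemma gibbs_sum_list:
  "(\<And>k. k \<in> set ks \<Longrightarrow> bdd_meas M (f k)) \<Longrightarrow> gexp (\<lambda>Q. \<Sum>k\<leftarrow>ks. f k Q) = (\<Sum>k\<leftarrow>ks. gexp (f k))"
proof (induction ks)
  case Nil
  have "bdd_meas M (\<lambda>_. 0)" by (rule bdd_meas_const)
  then show ?case by (simp add: gibbs_expectation_eq)
qed (simp add: gibbs_add bdd_meas_sum_list)

lemma gibbs_cong: "(\<And>Q. Q \<in> space M \<Longrightarrow> f Q = g Q) \<Longrightarrow> gexp f = gexp g"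
  unfolding gibbs_expectation_def by (rule Bochner_Integration.integral_cong) (auto simp: gibbs_def)

lemma SD_gibbs:
  assumes "e \<in> I" "in_box w"
  shows "gexp (SD_split e w) = real N * \<beta> * gexp (SD_deform e w)"
proof -
  have "gexp (\<lambda>Q. SD_split e w Q - (real N * \<beta>) * SD_deform e w Q) = 0"
    using SD_integral[OF assms] assms
    by (subst gibbs_expectation_eq) (auto intro!: bdd_meas_diff bdd_meas_mult bdd_meas_const)
  then show ?thesis using assms
    by (simp add: gibbs_diff gibbs_cmult bdd_meas_SD_split bdd_meas_SD_deform bdd_meas_mult
        bdd_meas_const)
qed

end

section \<open>Plaquettes and lassos\<close>

definition hedge :: "int \<Rightarrow> int \<Rightarrow> edge" where "hedge x y = ((x, y), (x + 1, y))"
definition vedge :: "int \<Rightarrow> int \<Rightarrow> edge" where "vedge x y = ((x, y), (x, y + 1))"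

text \<open>Going up first is the positive orientation: lexicographically, (x, y + 1) is the second
  smallest vertex.\<close>

definition plaq :: "int \<Rightarrow> int \<Rightarrow> edge list" where
  "plaq x y = [vedge x y, hedge x (y + 1), reversal (vedge (x + 1) y), reversal (hedge x y)]"

lemma edge_simps [simp]:
  "hedge x y = hedge x' y' \<longleftrightarrow> x = x' \<and> y = y'"
  "vedge x y = vedge x' y' \<longleftrightarrow> x = x' \<and> y = y'"
  "hedge x y \<noteq> vedge x' y'" "vedge x y \<noteq> hedge x' y'"
  "reversal (hedge x y) \<noteq> hedge x' y'" "reversal (hedge x y) \<noteq> vedge x' y'"
  "reversal (vedge x y) \<noteq> hedge x' y'" "reversal (vedge x y) \<noteq> vedge x' y'"
  "hedge x' y' \<noteq> reversal (hedge x y)" "vedge x' y' \<noteq> reversal (hedge x y)"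
  "hedge x' y' \<noteq> reversal (vedge x y)" "vedge x' y' \<noteq> reversal (vedge x y)"
  by (auto simp: hedge_def vedge_def reversal_def)

lemma reversal_eq_iff [simp]: "reversal c = reversal d \<longleftrightarrow> c = d"
  by (auto simp: reversal_def prod_eq_iff)

lemma edges_edge [simp]: "hedge x y \<in> edges" "vedge x y \<in> edges"
  by (auto simp: hedge_def vedge_def edges_def)

lemma hedge_pos [simp]: "hedge x y \<in> pos_edges"
  by (auto simp: hedge_def pos_edges_def edges_def lex_less_def)

lemma edges_cases:
  assumes "c \<in> edges"
  obtains x y where "c = hedge x y" | x y where "c = vedge x y"
  | x y where "c = reversal (hedge x y)" | x y where "c = reversal (vedge x y)"
proof -
  obtain u v u' v' where c: "c = ((u, v), (u', v'))" by (metis surj_pair)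
  then have "\<bar>u - u'\<bar> + \<bar>v - v'\<bar> = 1" using assms by (simp add: edges_def)
  then consider "u' = u + 1 \<and> v' = v" | "u' = u \<and> v' = v + 1" | "u = u' + 1 \<and> v = v'" | "u = u' \<and>
      v = v' + 1"
    by linarith
  then show ?thesis
    using that c by cases (auto simp: hedge_def vedge_def reversal_def)
qed

lemma is_plaquette_plaq: "is_plaquette (plaq x y)"
proof -
  have "fst ` set (plaq x y) = {x, x + 1} \<times> {y, y + 1}"
    by (auto simp: plaq_def hedge_def vedge_def reversal_def)
  moreover have "closed_walk (plaq x y)"
    unfolding closed_walk_def
  proof (intro conjI allI impI)
    fix i assume "i < length (plaq x y)"
    then have "i = 0 \<or> i = 1 \<or> i = 2 \<or> i = 3" by (simp add: plaq_def) linarith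
    then show "snd (plaq x y ! i) = fst (plaq x y ! (Suc i mod length (plaq x y)))"
      by (elim disjE) (simp_all add: plaq_def hedge_def vedge_def)
  qed (auto simp: plaq_def)
  ultimately show ?thesis by (auto simp: is_plaquette_def plaq_def)
qed

lemma pos_plaquettes_in_eq:
  "pos_plaquettes_in \<Lambda> = {plaq x y |x y. {x, x + 1} \<times> {y, y + 1} \<subseteq> \<Lambda>}"
proof (intro equalityI subsetI)
  fix p assume "p \<in> pos_plaquettes_in \<Lambda>"
  then have p: "is_plaquette p" "set p \<subseteq> \<Lambda> \<times> \<Lambda>"
    and lex: "\<And>v. v \<in> fst ` set p \<Longrightarrow> v \<noteq> fst (p ! 0) \<Longrightarrow> lex_less (fst (p ! 0)) v"
      "\<And>v. v \<in> fst ` set p \<Longrightarrow> v \<noteq> fst (p ! 0) \<Longrightarrow> v \<noteq> fst (p ! 1) \<Longrightarrow> lex_less (fst (p ! 1)) v"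
    by (auto simp: pos_plaquettes_in_def Let_def)
  then obtain c0 c1 c2 c3 x y where pc: "p = [c0, c1, c2, c3]"
    and xy: "fst ` set p = {x, x + 1} \<times> {y, y + 1}"
    unfolding is_plaquette_def
    by (auto simp: length_Suc_conv numeral_eq_Suc)
  have cl: "\<forall>i<4. snd (p ! i) = fst (p ! (Suc i mod 4))" "set p \<subseteq> edges"
    using p pc by (auto simp: is_plaquette_def closed_walk_def)
  obtain v0 v1 v2 v3 where c: "c0 = (v0, v1)" "c1 = (v1, v2)" "c2 = (v2, v3)" "c3 = (v3, v0)"
    using cl(1)[rule_format, of 0] cl(1)[rule_format, of 1] cl(1)[rule_format, of 2]
      cl(1)[rule_format, of 3] unfolding pc by (cases c0; cases c1; cases c2; cases c3) auto
  have V: "{v0, v1, v2, v3} = {x, x + 1} \<times> {y, y + 1}" using xy by (simp add: pc c)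
  have E: "(v0, v1) \<in> edges" "(v1, v2) \<in> edges" "(v3, v0) \<in> edges"
    using cl(2) by (auto simp: pc c)
  have v0: "v0 = (x, y)"
  proof (rule ccontr)
    assume "v0 \<noteq> (x, y)"
    moreover have "(x, y) \<in> fst ` set p" unfolding xy by simp
    ultimately have "lex_less v0 (x, y)" using lex(1)[of "(x, y)"] by (simp add: pc c)
    moreover have "v0 \<in> {x, x + 1} \<times> {y, y + 1}" using V by blast
    ultimately show False by (cases v0) (auto simp: lex_less_def)
  qed
  have v1: "v1 = (x, y + 1)"
  proof (rule ccontr)
    assume "v1 \<noteq> (x, y + 1)"
    moreover have "(x, y + 1) \<in> fst ` set p" unfolding xy by simp
    ultimately have "lex_less v1 (x, y + 1)" using lex(2)[of "(x, y + 1)"] v0 by (simp add: pc c)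
    moreover have "v1 \<in> {x, x + 1} \<times> {y, y + 1}" using V by blast
    ultimately have "v1 = (x, y)" by (cases v1) (auto simp: lex_less_def)
    then show False using E(1) v0 by (auto simp: edges_def)
  qed
  have "(x + 1, y + 1) \<in> {v0, v1, v2, v3}" "(x + 1, y) \<in> {v0, v1, v2, v3}" unfolding V by auto
  moreover have "v3 \<noteq> (x + 1, y + 1)" "v2 \<noteq> (x + 1, y)" using E v0 v1 by (auto simp: edges_def)
  ultimately have "v2 = (x + 1, y + 1)" "v3 = (x + 1, y)" using v0 v1 by auto
  then have "p = plaq x y"
    using v0 v1 by (simp add: pc c plaq_def hedge_def vedge_def reversal_def)
  moreover have "fst ` set p \<subseteq> \<Lambda>" using p(2) by auto
  ultimately show "p \<in> {plaq x y |x y. {x, x + 1} \<times> {y, y + 1} \<subseteq> \<Lambda>}" using xy by auto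
next
  fix p assume "p \<in> {plaq x y |x y. {x, x + 1} \<times> {y, y + 1} \<subseteq> \<Lambda>}"
  then obtain x y where p: "p = plaq x y" "{x, x + 1} \<times> {y, y + 1} \<subseteq> \<Lambda>" by blast
  then show "p \<in> pos_plaquettes_in \<Lambda>"
    using is_plaquette_plaq[of x y]
    by (auto simp: pos_plaquettes_in_def Let_def plaq_def hedge_def vedge_def reversal_def
        lex_less_def)
qed

section \<open>Equality of walks up to cancellation, and of their traces\<close>

text \<open>Only edge lists in \<open>edges\<close> are compared: on other pairs, reversal is not inversion.\<close>

definition weq :: "edge list \<Rightarrow> edge list \<Rightarrow> bool" where
  "weq u v \<longleftrightarrow> set u \<subseteq> edges \<and> set v \<subseteq> edges \<and>
    (\<forall>N Q. (\<forall>c. Q c \<in> carrier (SO N)) \<longrightarrow> walk_matrix N Q u = walk_matrix N Q v)"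

text \<open>Coarser than \<open>weq\<close>: it also identifies walks up to cyclic rotation and
  reversal.\<close>

definition teq :: "edge list \<Rightarrow> edge list \<Rightarrow> bool" where
  "teq u v \<longleftrightarrow> set u \<subseteq> edges \<and> set v \<subseteq> edges \<and>
    (\<forall>N Q. (\<forall>c. Q c \<in> carrier (SO N)) \<longrightarrow> wilson N u Q = wilson N v Q)"

lemma SO_on_total: "set w \<subseteq> edges \<Longrightarrow> (\<forall>c. Q c \<in> carrier (SO N)) \<Longrightarrow> SO_on N w Q"
  unfolding SO_on_def SO_edge_def by blast

lemma weq_refl: "set u \<subseteq> edges \<Longrightarrow> weq u u"
  by (simp add: weq_def)

lemma weq_sym: "weq u v \<Longrightarrow> weq v u"
  by (auto simp: weq_def)

lemma weq_trans [trans]: "weq u v \<Longrightarrow> weq v w \<Longrightarrow> weq u w"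
  by (auto simp: weq_def)

lemma teq_refl: "set u \<subseteq> edges \<Longrightarrow> teq u u"
  by (simp add: teq_def)

lemma teq_sym: "teq u v \<Longrightarrow> teq v u"
  by (auto simp: teq_def)

lemma teq_trans [trans]: "teq u v \<Longrightarrow> teq v w \<Longrightarrow> teq u w"
  by (auto simp: teq_def)

lemma weq_imp_teq: "weq u v \<Longrightarrow> teq u v"
  by (auto simp: weq_def teq_def wilson_def)

lemma weq_append: "weq u u' \<Longrightarrow> weq v v' \<Longrightarrow> weq (u @ v) (u' @ v')"
  by (auto simp: weq_def walk_matrix_append SO_on_total)

lemma weq_rv: "weq u v \<Longrightarrow> weq (rv u) (rv v)"
  by (auto simp: weq_def walk_matrix_rv SO_on_total)

lemma weq_cancel:
  assumes "set u \<subseteq> edges" shows "weq (u @ rv u) []"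
  unfolding weq_def
proof (intro conjI allI impI)
  fix N and Q :: "edge \<Rightarrow> real mat" assume "\<forall>c. Q c \<in> carrier (SO N)"
  then have u: "SO_on N u Q" by (rule SO_on_total[OF assms])
  then show "walk_matrix N Q (u @ rv u) = walk_matrix N Q []"
    using SO_mult_transpose[OF walk_matrix_SO[OF u]] by (simp add: walk_matrix_append
        walk_matrix_rv)
qed (use assms in auto)

lemma set_rv_edges: "set (rv u) \<subseteq> edges \<longleftrightarrow> set u \<subseteq> edges"
  by auto

lemma weq_cancel': "set u \<subseteq> edges \<Longrightarrow> weq (rv u @ u) []"
  by (metis weq_cancel winv_winv set_rv_edges)

lemma weq_cancel_mid:
  assumes "set u \<subseteq> edges" "set v \<subseteq> edges" "set w \<subseteq> edges"
  shows "weq (v @ u @ rv u @ w) (v @ w)" "weq (v @ rv u @ u @ w) (v @ w)"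
  using weq_append[OF weq_refl[OF assms(2)] weq_append[OF weq_cancel[OF assms(1)] weq_refl[OF
      assms(3)]]]
    weq_append[OF weq_refl[OF assms(2)] weq_append[OF weq_cancel'[OF assms(1)] weq_refl[OF
        assms(3)]]]
  by simp_all

lemma weq_insert:
  assumes "set h \<subseteq> edges" "set w \<subseteq> edges"
  shows "weq w (rv h @ h @ w)" "weq w (w @ rv h @ h)"
  using weq_sym[OF weq_cancel_mid(2)[OF assms(1) _ assms(2), of "[]"]]
    weq_sym[OF weq_cancel_mid(2)[OF assms(1,2), of "[]"]] by simp_all

lemma teq_rotate: "set u \<subseteq> edges \<Longrightarrow> set v \<subseteq> edges \<Longrightarrow> teq (u @ v) (v @ u)"
  by (auto simp: teq_def intro!: wilson_rotate SO_on_total)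

lemma teq_rv: "set u \<subseteq> edges \<Longrightarrow> teq (rv u) u"
  by (auto simp: teq_def intro!: wilson_rv SO_on_total)

lemma teq_conj:
  assumes "set u \<subseteq> edges" "set h \<subseteq> edges"
  shows "teq (rv h @ u @ h) u"
proof -
  have "teq (rv h @ (u @ h)) ((u @ h) @ rv h)" using assms by (intro teq_rotate) auto
  also have "teq ((u @ h) @ rv h) (u @ [])"
    using weq_cancel_mid(1)[of h u "[]"] assms by (intro weq_imp_teq) auto
  finally show ?thesis by simp
qed

lemma (in gauge_box) wilson_teq:
  assumes "teq u v" "in_box u" "in_box v" "Q \<in> space M"
  shows "wilson N u Q = wilson N v Q"
proof -
  \<comment> \<open>\<open>teq\<close> speaks of configurations that are in SO(N) at every edge,
    whereas those of the box are undefined off \<open>I\<close>; the identity matrix fills the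
    gap.\<close>
  define Q' where "Q' c = (if c \<in> I then Q c else 1\<^sub>m N)" for c
  have "Q' c \<in> carrier (SO N)" for c
    using assms(4) space_haar[OF haar] by (auto simp: Q'_def config_measure_def space_PiM)
  then have "wilson N u Q' = wilson N v Q'" using assms(1) by (auto simp: teq_def)
  moreover have "walk_matrix N Q' w = walk_matrix N Q w" if "in_box w" for w
    using that
  proof (induction w)
    case (Cons c w)
    then have "und c \<in> I" by (intro und_in_I) auto
    then have "edge_matrix N Q' c = edge_matrix N Q c"
      by (auto simp: edge_matrix_def Q'_def und_def split: if_splits)
    then show ?case using Cons by auto
  qed simp
  ultimately show ?thesis using assms by (simp add: wilson_def)
qed

section \<open>Lassos and the walks of words\<close>

text \<open>Lassos in the quadrant with corner \<open>(-m, -m)\<close>: the tail runs along the bottom row and then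
  up a column, so that the horizontal edges above the bottom row are met by the rims only.\<close>

definition tail :: "nat \<Rightarrow> nat \<Rightarrow> nat \<Rightarrow> edge list" where
  "tail m x j = map (\<lambda>k. hedge (int k - int m) (- int m)) [0..<x] @
     map (\<lambda>k. vedge (int x - int m) (int k - int m)) [0..<j]"

definition lasso :: "nat \<Rightarrow> nat \<times> nat \<Rightarrow> edge list" where
  "lasso m z = tail m (fst z) (snd z) @ plaq (int (fst z) - int m) (int (snd z) - int m) @
     rv (tail m (fst z) (snd z))"

definition letter_walk :: "nat \<Rightarrow> (nat \<times> nat) \<times> bool \<Rightarrow> edge list" where
  "letter_walk m c = (if snd c then lasso m (fst c) else rv (lasso m (fst c)))"

definition word_walk :: "nat \<Rightarrow> ((nat \<times> nat) \<times> bool) list \<Rightarrow> edge list" where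
  "word_walk m u = concat (map (letter_walk m) u)"

lemma word_walk_simps [simp]:
  "word_walk m [] = []" "word_walk m (c # u) = letter_walk m c @ word_walk m u"
  "word_walk m (u @ v) = word_walk m u @ word_walk m v"
  by (simp_all add: word_walk_def)

lemma letter_walk_flip: "letter_walk m (flip c) = rv (letter_walk m c)"
  by (simp add: letter_walk_def flip_def)

lemma word_walk_winv: "word_walk m (winv flip u) = rv (word_walk m u)"
  by (induction u) (simp_all add: letter_walk_flip)

lemma tail_edges: "set (tail m x j) \<subseteq> edges"
  by (auto simp: tail_def)

lemma lasso_edges: "set (lasso m z) \<subseteq> edges"
  using tail_edges by (fastforce simp: lasso_def plaq_def)

lemma letter_walk_edges: "set (letter_walk m c) \<subseteq> edges"
  using lasso_edges[of m "fst c"] by (auto simp: letter_walk_def)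

lemma word_walk_edges: "set (word_walk m u) \<subseteq> edges"
  using letter_walk_edges by (fastforce simp: word_walk_def)

lemma tail_Suc: "tail m x (Suc j) = tail m x j @ [vedge (int x - int m) (int j - int m)]"
  by (simp add: tail_def)

text \<open>The top edge of the plaquette, at which the Schwinger--Dyson equation will be
  applied.\<close>

definition rim :: "nat \<Rightarrow> nat \<times> nat \<Rightarrow> edge" where
  "rim m z = hedge (int (fst z) - int m) (int (snd z) + 1 - int m)"

text \<open>The path from the corner to the starting point of the rim. It is also the tail of the
  lasso directly above.\<close>

definition stem :: "nat \<Rightarrow> nat \<times> nat \<Rightarrow> edge list" where
  "stem m z = tail m (fst z) (Suc (snd z))"

definition lasso_rest :: "nat \<Rightarrow> nat \<times> nat \<Rightarrow> edge list" where
  "lasso_rest m z = [reversal (vedge (int (fst z) - int m + 1) (int (snd z) - int m)),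
     reversal (hedge (int (fst z) - int m) (int (snd z) - int m))] @ rv (tail m (fst z) (snd z))"

lemma lasso_eq: "lasso m z = stem m z @ rim m z # lasso_rest m z"
  by (simp add: lasso_def stem_def rim_def lasso_rest_def tail_Suc plaq_def algebra_simps)

lemma rim_notin_tail: "rim m z \<notin> set (tail m x j)" "reversal (rim m z) \<notin> set (tail m x j)"
  by (auto simp: rim_def tail_def)

lemma rim_notin_stem: "rim m z \<notin> set (stem m z')" "reversal (rim m z) \<notin> set (stem m z')"
  by (auto simp: stem_def rim_notin_tail)

lemma reversal_in_iff: "c \<in> reversal ` A \<longleftrightarrow> reversal c \<in> A"
  by (metis image_iff reversal_reversal)

text \<open>The bottom edge of a plaquette is the rim of the plaquette below it. The hypothesis
  keeps the lasso directly above \<open>z\<close> away.\<close>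

lemma rim_notin_rest:
  assumes "fst z' \<noteq> fst z \<or> snd z' \<le> snd z"
  shows "rim m z \<notin> set (lasso_rest m z')" "reversal (rim m z) \<notin> set (lasso_rest m z')"
  using assms rim_notin_tail[of m z "fst z'" "snd z'"]
  by (auto simp: lasso_rest_def reversal_in_iff) (auto simp: rim_def)

lemma rim_eq: "rim m z = rim m z' \<longleftrightarrow> z = z'" and rim_neq_reversal: "rim m z \<noteq> reversal (rim m z')"
  by (cases z; cases z'; auto simp: rim_def)+

lemma rim_notin_word:
  assumes "\<And>z'. z' \<in> fst ` set u \<Longrightarrow> fst z' \<noteq> fst z \<or> snd z' < snd z"
  shows "rim m z \<notin> set (word_walk m u)" "reversal (rim m z) \<notin> set (word_walk m u)"
proof -
  have "rim m z \<notin> set (lasso m z') \<and> reversal (rim m z) \<notin> set (lasso m z')" if "z' \<in> fst ` set u"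
      for z'
    using assms[OF that] rim_notin_rest[of z' z m] rim_notin_stem[of m z z'] rim_neq_reversal[of m
        z z']
      rim_neq_reversal[of m z' z] rim_eq[of m z z']
    by (auto simp: lasso_eq)
  then have "rim m z \<notin> set (letter_walk m c) \<and> reversal (rim m z) \<notin> set (letter_walk m c)" if "c \<in>
      set u" for c
    using that by (auto simp: letter_walk_def reversal_in_iff)
  then show "rim m z \<notin> set (word_walk m u)" "reversal (rim m z) \<notin> set (word_walk m u)"
    by (auto simp: word_walk_def)
qed

lemma cuts_lasso:
  assumes "fst z' \<noteq> fst z \<or> snd z' \<le> snd z"
  shows "cuts reversal (rim m z) (lasso m z') =
      (if z' = z then [(1, stem m z, rim m z # lasso_rest m z)] else [])"
    and "cuts reversal (rim m z) (rv (lasso m z')) =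
      (if z' = z then [(-1, rv (rim m z # lasso_rest m z), rv (stem m z))] else [])"
proof -
  have 1: "cuts reversal (rim m z) (stem m z') = []" "cuts reversal (rim m z) (lasso_rest m z') =
      []"
    "cuts reversal (rim m z) (rv (stem m z')) = []" "cuts reversal (rim m z) (rv (lasso_rest m
        z')) = []"
    using rim_notin_stem[of m z z'] rim_notin_rest[OF assms, of m]
    by (auto intro!: cuts_eq_Nil simp: reversal_in_iff)
  show "cuts reversal (rim m z) (lasso m z') = (if z' = z then [(1, stem m z, rim m z # lasso_rest
      m z)] else [])"
    using rim_neq_reversal[of m z' z] by (auto simp: lasso_eq cuts_append 1 rim_eq)
  show "cuts reversal (rim m z) (rv (lasso m z')) =
      (if z' = z then [(-1, rv (rim m z # lasso_rest m z), rv (stem m z))] else [])"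
    using rim_neq_reversal[of m z z'] by (auto simp: lasso_eq cuts_append 1 rim_eq)
qed

lemma set_edges_simps:
  "set (stem m z) \<subseteq> edges" "set (rim m z # lasso_rest m z) \<subseteq> edges" "set (lasso_rest m z) \<subseteq> edges"
  using lasso_edges[of m z] by (auto simp: lasso_eq)

text \<open>A cut at the rim falls inside a lasso, next to its stem. Inserting the stem and its
  inverse moves it to the boundary of the letter, before \<open>(z, True)\<close> and after its
  inverse, just as \<open>cuts\<close> does for words.\<close>

lemma cuts_word_walk:
  assumes "\<And>z'. z' \<in> fst ` set u \<Longrightarrow> fst z' \<noteq> fst z \<or> snd z' \<le> snd z"
  shows "list_all2 (\<lambda>(s, P, S) (s', P', S'). s = s' \<and> weq P (word_walk m P' @ stem m z) \<and>
      weq S (rv (stem m z) @ word_walk m S'))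
    (cuts reversal (rim m z) (word_walk m u)) (cuts flip (z, True) u)"
  using assms
proof (induction u)
  case (Cons c u)
  let ?R = "\<lambda>(s, P, S) (s', P', S'). s = s' \<and> weq P (word_walk m P' @ stem m z) \<and>
      weq S (rv (stem m z) @ word_walk m S')"
  obtain z' b where c: "c = (z', b)" by (cases c)
  have z': "fst z' \<noteq> fst z \<or> snd z' \<le> snd z" using Cons.prems[of z'] c by simp
  have IH: "list_all2 ?R (cuts reversal (rim m z) (word_walk m u)) (cuts flip (z, True) u)"
    using Cons by auto
  note ed = set_edges_simps[of m z] word_walk_edges[of m u]
  have A: "list_all2 ?R (map (\<lambda>(s, P, S). (s, P, S @ word_walk m u)) (cuts reversal (rim m z)
      (letter_walk m c)))
    ((if c = (z, True) then [(1, [], c # u)] else []) @ (if c = flip (z, True) then [(-1, [c], u)]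
        else []))"
  proof (cases "z' = z")
    case False
    then have "cuts reversal (rim m z) (letter_walk m c) = []" "c \<noteq> (z, True)" "c \<noteq> flip (z, True)"
      using cuts_lasso[OF z', of m] unfolding c letter_walk_def flip_def by simp_all
    then show ?thesis by simp
  next
    case True
    show ?thesis
    proof (cases b)
      case b: True
      have cut: "cuts reversal (rim m z) (letter_walk m c) = [(1, stem m z, rim m z # lasso_rest m
          z)]"
        using cuts_lasso(1)[OF z', of m] True b unfolding c letter_walk_def by simp
      have cc: "c = (z, True)" "c \<noteq> flip (z, True)" using True b unfolding c flip_def by simp_all
      have "letter_walk m c = stem m z @ rim m z # lasso_rest m z"
        using cc(1) by (simp add: letter_walk_def lasso_eq)
      then have "weq ((rim m z # lasso_rest m z) @ word_walk m u) (rv (stem m z) @ word_walk m (c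
          # u))"
        using weq_insert(1)[OF ed(1), of "(rim m z # lasso_rest m z) @ word_walk m u"] ed by simp
      moreover have "weq (stem m z) (word_walk m [] @ stem m z)" using weq_refl[OF ed(1)] by simp
      ultimately show ?thesis unfolding cut using cc by simp
    next
      case b: False
      have cut: "cuts reversal (rim m z) (letter_walk m c) = [(-1, rv (rim m z # lasso_rest m z),
          rv (stem m z))]"
        using cuts_lasso(2)[OF z', of m] True b unfolding c letter_walk_def by simp
      have cc: "c \<noteq> (z, True)" "c = flip (z, True)" using True b unfolding c flip_def by simp_all
      have "letter_walk m c = rv (rim m z # lasso_rest m z) @ rv (stem m z)"
        using cc(2) by (simp add: letter_walk_def lasso_eq flip_def)
      then have "weq (rv (rim m z # lasso_rest m z)) (word_walk m [c] @ stem m z)"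
        using weq_insert(2)[OF ed(1), of "rv (rim m z # lasso_rest m z)"] ed(2)
        unfolding set_rv_edges by simp
      moreover have "weq (rv (stem m z) @ word_walk m u) (rv (stem m z) @ word_walk m u)"
        using ed(1,4) set_rv_edges by (intro weq_refl) simp
      ultimately show ?thesis unfolding cut using cc by simp
    qed
  qed
  have B: "list_all2 ?R (map (\<lambda>(s, P, S). (s, letter_walk m c @ P, S)) (cuts reversal (rim m z)
      (word_walk m u)))
      (map (\<lambda>(s, P, S). (s, c # P, S)) (cuts flip (z, True) u))"
    unfolding list_all2_map1 list_all2_map2
    using IH by (rule list_all2_mono)
      (auto dest: weq_append[OF weq_refl[OF letter_walk_edges[of m c]]])
  from list_all2_appendI[OF A B] show ?case
    by (simp only: word_walk_simps cuts_append cuts.simps append_assoc)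
qed simp

text \<open>Attaching \<open>v\<close> at the far end of \<open>h\<close> is, for traces, the same
  as attaching the lasso \<open>h v h^-1\<close> at the start of \<open>h\<close>.\<close>

lemma teq_conj_append:
  assumes "set w \<subseteq> edges" "set h \<subseteq> edges" "weq (h @ v @ rv h) l"
  shows "teq ((rv h @ w @ h) @ v) (w @ l)" "teq ((rv h @ w @ h) @ rv v) (w @ rv l)"
proof -
  have *: "teq ((rv h @ w @ h) @ v) (w @ l)" if "weq (h @ v @ rv h) l" for v l
  proof -
    have v: "set v \<subseteq> edges" using that by (simp add: weq_def)
    have "teq (rv h @ (w @ h @ v)) ((w @ h @ v) @ rv h)" using assms v by (intro teq_rotate) auto
    also have "(w @ h @ v) @ rv h = w @ (h @ v @ rv h)" by simp
    also have "teq \<dots> (w @ l)"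
      using weq_append[OF weq_refl[OF assms(1)] that] by (rule weq_imp_teq)
    finally show ?thesis by simp
  qed
  show "teq ((rv h @ w @ h) @ v) (w @ l)" by (rule *[OF assms(3)])
  show "teq ((rv h @ w @ h) @ rv v) (w @ rv l)" using weq_rv[OF assms(3)] by (intro *) simp
qed

lemma cuts_letters:
  assumes "(s, P, S) \<in> set (cuts r e w)"
  shows "f ` set P \<subseteq> f ` set w" "f ` set S \<subseteq> f ` set w"
  using cuts_concat[OF assms] by auto

section \<open>The Schwinger--Dyson equation for words in a square box\<close>

definition sq_box :: "nat \<Rightarrow> vertex set" where
  "sq_box n = {- int n..int n} \<times> {- int n..int n}"

text \<open>The lasso stays in the box. The inequalities are strict because the plaquette extends
  one unit beyond its lower left vertex.\<close>

definition fits :: "nat \<Rightarrow> nat \<Rightarrow> nat \<times> nat \<Rightarrow> bool" where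
  "fits n m z \<longleftrightarrow> m \<le> n \<and> fst z < m + n \<and> snd z < m + n"

lemma sum_list_list_all2:
  assumes "list_all2 R xs ys" "\<And>x y. x \<in> set xs \<Longrightarrow> R x y \<Longrightarrow> f x = g y"
  shows "(\<Sum>x\<leftarrow>xs. f x) = (\<Sum>y\<leftarrow>ys. g y :: real)"
  using assms by (induction rule: list_all2_induct) auto

text \<open>The rim is the top edge of the plaquette of \<open>z\<close> and, traversed backwards,
  the bottom edge of the one above. These opposite signs make the column telescope.\<close>

lemma cuts_plaq:
  "cuts reversal (rim m z) (plaq X Y) =
    (if X = int (fst z) - int m \<and> Y = int (snd z) - int m
     then [(1, [vedge X Y], [hedge X (Y + 1), reversal (vedge (X + 1) Y), reversal (hedge X Y)])]
     else if X = int (fst z) - int m \<and> Y = int (snd z) + 1 - int m then [(-1, plaq X Y, [])] else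
         [])"
  by (auto simp: plaq_def rim_def)

lemma plaq_inject: "plaq X Y = plaq X' Y' \<longleftrightarrow> X = X' \<and> Y = Y'"
  by (auto simp: plaq_def)

text \<open>The box grows with the matrix size. Any exhaustion has the same limits, so squares are
  chosen: each column of plaquettes then ends at the top row.\<close>

locale lasso_box =
  fixes N :: nat and haar :: "nat \<Rightarrow> real mat measure" and \<beta> :: real
  assumes is_haar: "is_haar_prob N (haar N)" and N: "N \<ge> 1"

sublocale lasso_box \<subseteq> gauge_box N haar "sq_box N" \<beta>
  by standard (auto simp: is_haar sq_box_def)

context lasso_box begin

lemma in_box_tail:
  assumes "m \<le> N" "x \<le> m + N" "j \<le> m + N"
  shows "in_box (tail m x j)"
  unfolding in_box_def tail_def using assms by (auto simp: hedge_def vedge_def edges_def sq_box_def)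

lemma in_box_plaq: "in_box (plaq X Y) \<longleftrightarrow> {X, X + 1} \<times> {Y, Y + 1} \<subseteq> sq_box N"
  by (auto simp: plaq_def) (auto simp: hedge_def vedge_def reversal_def)

lemma fits_plaq:
  "m \<le> N \<Longrightarrow> {int (fst z) - int m, int (fst z) - int m + 1} \<times> {int (snd z) - int m, int (snd z) -
      int m + 1} \<subseteq> sq_box N
    \<longleftrightarrow> fits N m z"
  by (auto simp: sq_box_def fits_def)

lemma in_box_lasso: "fits N m z \<Longrightarrow> in_box (lasso m z)"
  using fits_plaq[of m z] in_box_tail[of m "fst z" "snd z"]
  by (auto simp: lasso_def in_box_plaq fits_def)

lemma in_box_letter_walk: "fits N m (fst c) \<Longrightarrow> in_box (letter_walk m c)"
  by (simp add: letter_walk_def in_box_lasso)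

lemma in_box_word_walk: "(\<And>z. z \<in> fst ` set u \<Longrightarrow> fits N m z) \<Longrightarrow> in_box (word_walk m u)"
  by (induction u) (auto simp: in_box_letter_walk)

lemma in_box_stem: "fits N m z \<Longrightarrow> in_box (stem m z)"
  by (auto simp: stem_def fits_def intro: in_box_tail)

lemma rim_in_I: "fits N m z \<Longrightarrow> rim m z \<in> I"
  by (auto simp: pos_edges_in_def rim_def fits_def sq_box_def) (auto simp: hedge_def)

definition kick :: "nat \<Rightarrow> nat \<times> nat \<Rightarrow> edge list \<Rightarrow> (edge \<Rightarrow> real mat) \<Rightarrow> real" where
  "kick m z w Q = wilson N (w @ rv (lasso m z)) Q - wilson N (w @ lasso m z) Q"

lemma bdd_meas_kick: "fits N m z \<Longrightarrow> in_box w \<Longrightarrow> bdd_meas M (kick m z w)"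
  unfolding kick_def by (intro bdd_meas_diff bdd_meas_wilson) (auto simp: in_box_lasso)

lemma in_box_edges: "in_box w \<Longrightarrow> set w \<subseteq> edges"
  by (auto simp: in_box_def)

text \<open>Plaquettes are attached at the starting point of the rim, but words are based at the
  corner; conjugation by the stem reconciles the two. It turns the plaquette below the rim into the
  lasso of \<open>z\<close>, and the one above, if it is in the box, into the next lasso.\<close>

lemma SD_deform_rim:
  assumes z: "fits N m z" and w: "in_box w" and Q: "Q \<in> space M"
  shows "SD_deform (rim m z) (rv (stem m z) @ w @ stem m z) Q =
    kick m z w Q - (if fits N m (fst z, Suc (snd z)) then kick m (fst z, Suc (snd z)) w Q else 0)"
proof -
  define X Y where "X = int (fst z) - int m" and "Y = int (snd z) - int m"
  let ?H = "stem m z" and ?z = "(fst z, Suc (snd z))"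
  let ?w = "rv ?H @ w @ ?H"
  define h where "h p = (\<Sum>(s, P, S)\<leftarrow>cuts reversal (rim m z) p.
     s * (wilson N (?w @ rv (S @ P)) Q - wilson N (?w @ S @ P) Q))" for p
  define T where "T = insert (plaq X Y) (if fits N m ?z then {plaq X (Y + 1)} else {})"
  have mN: "m \<le> N" using z by (simp add: fits_def)
  have mem: "plaq X' Y' \<in> pos_plaquettes_in (sq_box N) \<longleftrightarrow> {X', X' + 1} \<times> {Y', Y' + 1} \<subseteq> sq_box N"
      for X' Y'
    unfolding pos_plaquettes_in_eq by (auto simp: plaq_inject)
  have m0: "plaq X Y \<in> pos_plaquettes_in (sq_box N)"
    unfolding mem using fits_plaq[OF mN, of z] z by (simp add: X_def Y_def)
  have m1: "plaq X (Y + 1) \<in> pos_plaquettes_in (sq_box N) \<longleftrightarrow> fits N m ?z"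
    unfolding mem using fits_plaq[OF mN, of ?z] by (simp add: X_def Y_def algebra_simps)
  have fin: "finite (pos_plaquettes_in (sq_box N))"
    by (rule finite_subset[of _ "(\<lambda>(x, y). plaq x y) ` sq_box N"])
      (auto simp: pos_plaquettes_in_eq sq_box_def)
  have h0: "h p = 0" if p: "p \<in> pos_plaquettes_in (sq_box N) - T" for p
  proof -
    obtain X' Y' where p': "p = plaq X' Y'" using p unfolding pos_plaquettes_in_eq by blast
    have "X' \<noteq> X \<or> Y' \<noteq> Y" "X' \<noteq> X \<or> Y' \<noteq> Y + 1"
      using p m1 unfolding p' T_def by auto
    then have "cuts reversal (rim m z) p = []"
      unfolding p' cuts_plaq by (auto simp: X_def Y_def)
    then show ?thesis by (simp add: h_def)
  qed
  have "SD_deform (rim m z) ?w Q = (\<Sum>p\<in>pos_plaquettes_in (sq_box N). h p)"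
    by (simp add: SD_deform_def h_def)
  also have "\<dots> = (\<Sum>p\<in>T. h p)"
    using fin m0 m1 h0 by (intro sum.mono_neutral_right) (auto simp: T_def)
  also have "\<dots> = h (plaq X Y) + (if fits N m ?z then h (plaq X (Y + 1)) else 0)"
    by (simp add: T_def plaq_inject)
  also have "h (plaq X Y) = kick m z w Q"
  proof -
    let ?v = "[hedge X (Y + 1), reversal (vedge (X + 1) Y), reversal (hedge X Y)]"
    \<comment> \<open>The plaquette read from the starting point of the rim, its upper left vertex.
      After conjugation by the stem, its left edge cancels against the end of the stem.\<close>
    let ?U = "?v @ [vedge X Y]"
    have H: "?H = tail m (fst z) (snd z) @ [vedge X Y]" by (simp add: stem_def tail_Suc X_def Y_def)
    have L: "lasso m z = ?H @ ?v @ rv (tail m (fst z) (snd z))"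
      by (simp add: H lasso_def plaq_def X_def Y_def)
    have "weq ((?H @ ?v) @ [vedge X Y] @ rv [vedge X Y] @ rv (tail m (fst z) (snd z)))
        ((?H @ ?v) @ rv (tail m (fst z) (snd z)))"
      by (rule weq_cancel_mid(1)) (use set_edges_simps(1) tail_edges set_rv_edges in auto)
    then have "weq (?H @ ?U @ rv ?H) (lasso m z)" by (simp add: L H)
    note t = teq_conj_append[OF in_box_edges[OF w] set_edges_simps(1) this]
    have b: "in_box ?w" "in_box ?U"
      using in_box_stem[OF z] w m0 in_box_plaquette[OF m0] by (auto simp: plaq_def)
    have "wilson N (?w @ ?U) Q = wilson N (w @ lasso m z) Q"
      using b w in_box_lasso[OF z] by (intro wilson_teq[OF t(1)] Q) auto
    moreover have "wilson N (?w @ rv ?U) Q = wilson N (w @ rv (lasso m z)) Q"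
      using b w in_box_lasso[OF z] in_box_rv[of ?U] by (intro wilson_teq[OF t(2)] Q) auto
    moreover have "cuts reversal (rim m z) (plaq X Y) = [(1, [vedge X Y], ?v)]"
      unfolding cuts_plaq by (simp add: X_def Y_def)
    ultimately show ?thesis unfolding h_def kick_def by simp
  qed
  finally have "SD_deform (rim m z) ?w Q = kick m z w Q + (if fits N m ?z then h (plaq X (Y + 1))
      else 0)" .
  moreover have "h (plaq X (Y + 1)) = - kick m ?z w Q" if z': "fits N m ?z"
  proof -
    let ?U = "plaq X (Y + 1)"
    have L: "lasso m ?z = ?H @ ?U @ rv ?H"
      by (simp add: lasso_def stem_def X_def Y_def algebra_simps)
    then have "weq (?H @ ?U @ rv ?H) (lasso m ?z)" using lasso_edges[of m ?z] by (simp add: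
        weq_refl)
    note t = teq_conj_append[OF in_box_edges[OF w] set_edges_simps(1) this]
    have b: "in_box ?w" "in_box ?U"
      using in_box_stem[OF z] w in_box_plaquette[of ?U] m1 z' by auto
    have "wilson N (?w @ ?U) Q = wilson N (w @ lasso m ?z) Q"
      using b w in_box_lasso[OF z'] by (intro wilson_teq[OF t(1)] Q) auto
    moreover have "wilson N (?w @ rv ?U) Q = wilson N (w @ rv (lasso m ?z)) Q"
      using b w in_box_lasso[OF z'] in_box_rv[of ?U] by (intro wilson_teq[OF t(2)] Q) auto
    moreover have "cuts reversal (rim m z) ?U = [(-1, ?U, [])]"
      unfolding cuts_plaq by (simp add: X_def Y_def)
    ultimately show ?thesis unfolding h_def kick_def by simp
  qed
  ultimately show ?thesis by simp
qed

text \<open>Climbing the column: the Schwinger--Dyson equation at a rim not used by \<open>w\<close> says that the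
  kicks below and above it agree, and at the boundary of the box there is nothing above.\<close>

lemma gexp_kick_eq_zero:
  assumes "\<beta> \<noteq> 0" and w: "in_box w" and z: "fits N m z"
    and "\<And>i. i \<ge> snd z \<Longrightarrow> rim m (fst z, i) \<notin> set w \<and> reversal (rim m (fst z, i)) \<notin> set w"
  shows "gexp (kick m z w) = 0"
  using assms(3,4)
proof (induction "m + N - snd z" arbitrary: z rule: less_induct)
  case less
  let ?z = "(fst z, Suc (snd z))"
  let ?w = "rv (stem m z) @ w @ stem m z"
  have up: "gexp (kick m ?z w) = 0" if "fits N m ?z"
    by (rule less.hyps) (use that less.prems in \<open>auto simp: fits_def\<close>)
  have "cuts reversal (rim m z) ?w = []"
    using less.prems(2)[of "snd z"] rim_notin_stem[of m z z]
    by (intro cuts_eq_Nil) (auto simp: reversal_in_iff)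
  then have "SD_split (rim m z) ?w = (\<lambda>_. 0)" by (simp add: SD_split_def fun_eq_iff)
  moreover have "in_box ?w" using in_box_stem[OF less.prems(1)] w by simp
  ultimately have "gexp (\<lambda>_. 0) = real N * \<beta> * gexp (SD_deform (rim m z) ?w)"
    using SD_gibbs[OF rim_in_I[OF less.prems(1)], of ?w] by simp
  moreover have "gexp (\<lambda>_. 0) = 0"
    by (simp add: gibbs_expectation_eq[OF bdd_meas_const])
  ultimately have "gexp (SD_deform (rim m z) ?w) = 0" using \<open>\<beta> \<noteq> 0\<close> N by auto
  moreover have "gexp (SD_deform (rim m z) ?w) =
      gexp (\<lambda>Q. kick m z w Q - (if fits N m ?z then kick m ?z w Q else 0))"
    by (intro gibbs_cong SD_deform_rim less.prems w)
  moreover have "\<dots> = gexp (kick m z w)"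
    using up bdd_meas_kick[OF less.prems(1) w] bdd_meas_kick[OF _ w, of m ?z]
    by (cases "fits N m ?z") (simp_all add: gibbs_diff)
  ultimately show ?case by simp
qed

abbreviation "wil m u \<equiv> wilson N (word_walk m u)"

text \<open>The stem does not meet the rim, so all cuts lie in the walk of \<open>u\<close>. By
  \<open>cuts_word_walk\<close> every resulting piece is conjugate, through the stem, to the walk of
  a word.\<close>

lemma SD_split_word:
  assumes z: "fits N m z" and u: "\<And>z'. z' \<in> fst ` set u \<Longrightarrow> fits N m z' \<and> snd z' \<le> snd z"
    and Q: "Q \<in> space M"
  shows "SD_split (rim m z) (rv (stem m z) @ word_walk m u @ stem m z) Q =
    (\<Sum>(s, P, S)\<leftarrow>cuts flip (z, True) u. s * (wil m P Q * wil m S Q - wil m (P @ winv flip S) Q))"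
proof -
  let ?H = "stem m z"
  have boxu: "in_box (word_walk m u)" using u by (intro in_box_word_walk) auto
  have boxH: "in_box ?H" by (rule in_box_stem[OF z])
  have nil: "cuts reversal (rim m z) ?H = []" "cuts reversal (rim m z) (rv ?H) = []"
    using rim_notin_stem[of m z z] by (auto intro!: cuts_eq_Nil simp: reversal_in_iff)
  have "SD_split (rim m z) (rv ?H @ word_walk m u @ ?H) Q =
    (\<Sum>(s, P, S)\<leftarrow>cuts reversal (rim m z) (word_walk m u). s * (wilson N (rv ?H @ P) Q * wilson N (S
        @ ?H) Q
      - wilson N ((rv ?H @ P) @ rv (S @ ?H)) Q))"
    by (simp add: SD_split_def cuts_append nil case_prod_unfold o_def)
  also have "\<dots> = (\<Sum>(s, P, S)\<leftarrow>cuts flip (z, True) u. s * (wil m P Q * wil m S Q - wil m (P @ winv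
      flip S) Q))"
  proof (rule sum_list_list_all2)
    show "list_all2 (\<lambda>(s, P, S) (s', P', S'). (s', P', S') \<in> set (cuts flip (z, True) u) \<and> s = s' \<and>
        weq P (word_walk m P' @ stem m z) \<and> weq S (rv (stem m z) @ word_walk m S'))
      (cuts reversal (rim m z) (word_walk m u)) (cuts flip (z, True) u)"
      using cuts_word_walk[of u z m] u
      by (auto simp: list_all2_conv_all_nth case_prod_unfold)
  next
    fix x y
    assume x: "x \<in> set (cuts reversal (rim m z) (word_walk m u))"
      and xy: "(\<lambda>(s, P, S) (s', P', S'). (s', P', S') \<in> set (cuts flip (z, True) u) \<and> s = s' \<and>
        weq P (word_walk m P' @ stem m z) \<and> weq S (rv (stem m z) @ word_walk m S')) x y"
    obtain s P S s' P' S' where [simp]: "x = (s, P, S)" "y = (s', P', S')" by (metis surj_pair)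
    have *: "s = s'" "weq P (word_walk m P' @ ?H)" "weq S (rv ?H @ word_walk m S')"
      "(s', P', S') \<in> set (cuts flip (z, True) u)"
      using xy by auto
    have b: "in_box P" "in_box S" using in_box_cuts[of s P S "rim m z"] x boxu by auto
    have b': "in_box (word_walk m P')" "in_box (word_walk m S')"
      using cuts_letters[OF *(4), of fst] u by (intro in_box_word_walk; blast)+
    have H: "set ?H \<subseteq> edges" "set (rv ?H) \<subseteq> edges" using set_edges_simps(1) set_rv_edges by auto
    have P: "weq (rv ?H @ P) (rv ?H @ word_walk m P' @ ?H)"
      by (rule weq_append[OF weq_refl[OF H(2)] *(2)])
    have S: "weq (S @ ?H) (rv ?H @ word_walk m S' @ ?H)"
      using weq_append[OF *(3) weq_refl[OF H(1)]] by simp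
    have "wilson N (rv ?H @ P) Q = wil m P' Q"
      using teq_trans[OF weq_imp_teq[OF P] teq_conj[OF word_walk_edges H(1)]] boxH b b' Q
      by (intro wilson_teq) auto
    moreover have "wilson N (S @ ?H) Q = wil m S' Q"
      using teq_trans[OF weq_imp_teq[OF S] teq_conj[OF word_walk_edges H(1)]] boxH b b' Q
      by (intro wilson_teq) auto
    moreover have "wilson N ((rv ?H @ P) @ rv (S @ ?H)) Q = wil m (P' @ winv flip S') Q"
    proof -
      have "weq ((rv ?H @ P) @ rv (S @ ?H)) ((rv ?H @ word_walk m P' @ ?H) @ rv (rv ?H @ word_walk
          m S' @ ?H))"
        by (rule weq_append[OF P weq_rv[OF S]])
      also have "(rv ?H @ word_walk m P' @ ?H) @ rv (rv ?H @ word_walk m S' @ ?H) =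
          (rv ?H @ word_walk m P') @ ?H @ rv ?H @ (rv (word_walk m S') @ ?H)" by simp
      also have "weq \<dots> ((rv ?H @ word_walk m P') @ (rv (word_walk m S') @ ?H))"
        using H word_walk_edges[of m P'] word_walk_edges[of m S'] set_rv_edges[of "word_walk m S'"]
        by (intro weq_cancel_mid(1)) auto
      also have "(rv ?H @ word_walk m P') @ (rv (word_walk m S') @ ?H) =
          rv ?H @ word_walk m (P' @ winv flip S') @ ?H" by (simp add: word_walk_winv)
      finally have "teq ((rv ?H @ P) @ rv (S @ ?H)) (word_walk m (P' @ winv flip S'))"
        using teq_trans[OF weq_imp_teq teq_conj[OF word_walk_edges H(1)]] by blast
      then show ?thesis
        using boxH b b' Q by (intro wilson_teq) (simp_all add: word_walk_winv)
    qed
    ultimately show "(case x of (s, P, S) \<Rightarrow> s * (wilson N (rv ?H @ P) Q * wilson N (S @ ?H) Q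
      - wilson N ((rv ?H @ P) @ rv (S @ ?H)) Q)) =
      (case y of (s, P, S) \<Rightarrow> s * (wil m P Q * wil m S Q - wil m (P @ winv flip S) Q))"
      using *(1) by simp
  qed
  finally show ?thesis .
qed

text \<open>As \<open>u\<close> has no letter above the row of \<open>z\<close>, the kick by the
  next lasso in the column has mean zero and only that by \<open>z\<close> remains.\<close>

lemma word_SD:
  assumes z: "fits N m z" and u: "\<And>z'. z' \<in> fst ` set u \<Longrightarrow> fits N m z' \<and> snd z' \<le> snd z"
  shows "(\<Sum>(s, P, S)\<leftarrow>cuts flip (z, True) u. s * (gexp (\<lambda>Q. wil m P Q * wil m S Q) - gexp (wil m (P
      @ winv flip S))))
    = real N * \<beta> * (gexp (wil m (u @ [(z, False)])) - gexp (wil m (u @ [(z, True)])))"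
proof -
  let ?w = "word_walk m u" and ?e = "rim m z" and ?z = "(fst z, Suc (snd z))"
  let ?c = "rv (stem m z) @ ?w @ stem m z"
  have boxu: "in_box ?w" using u by (intro in_box_word_walk) auto
  have bx: "in_box ?c" using in_box_stem[OF z] boxu by simp
  have cb: "in_box (word_walk m P)" "in_box (word_walk m S)" if "(s, P, S) \<in> set (cuts flip (z,
      True) u)" for s P S
    using cuts_letters[OF that, of fst] u by (intro in_box_word_walk; blast)+
  have "gexp (SD_split ?e ?c) =
      gexp (\<lambda>Q. \<Sum>(s, P, S)\<leftarrow>cuts flip (z, True) u. s * (wil m P Q * wil m S Q - wil m (P @ winv
          flip S) Q))"
    by (intro gibbs_cong SD_split_word z u)
  also have "\<dots> = (\<Sum>k\<leftarrow>cuts flip (z, True) u. gexp (\<lambda>Q. case k of (s, P, S) \<Rightarrow> s * (wil m P Q * wil m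
      S Q - wil m (P @ winv flip S) Q)))"
  proof (rule gibbs_sum_list)
    fix k assume k: "k \<in> set (cuts flip (z, True) u)"
    obtain s P S where [simp]: "k = (s, P, S)" by (cases k)
    show "bdd_meas M (\<lambda>Q. case k of (s, P, S) \<Rightarrow> s * (wil m P Q * wil m S Q - wil m (P @ winv flip
        S) Q))"
      using cb[of s P S] k
      by (auto intro!: bdd_meas_mult bdd_meas_diff bdd_meas_wilson bdd_meas_const simp:
          word_walk_winv)
  qed
  also have "\<dots> = (\<Sum>(s, P, S)\<leftarrow>cuts flip (z, True) u. s * (gexp (\<lambda>Q. wil m P Q * wil m S Q) - gexp
      (wil m (P @ winv flip S))))"
  proof (intro arg_cong[where f = sum_list] map_cong refl, clarify)
    fix s P S assume "(s, P, S) \<in> set (cuts flip (z, True) u)"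
    from cb[OF this] show "gexp (\<lambda>Q. s * (wil m P Q * wil m S Q - wil m (P @ winv flip S) Q)) =
        s * (gexp (\<lambda>Q. wil m P Q * wil m S Q) - gexp (wil m (P @ winv flip S)))"
      by (simp add: gibbs_cmult gibbs_diff bdd_meas_mult bdd_meas_wilson bdd_meas_diff
          word_walk_winv)
  qed
  finally have split: "gexp (SD_split ?e ?c) = \<dots>" .
  have "gexp (SD_deform ?e ?c) =
      gexp (\<lambda>Q. kick m z ?w Q - (if fits N m ?z then kick m ?z ?w Q else 0))"
    by (intro gibbs_cong SD_deform_rim z boxu)
  also have "\<dots> = gexp (kick m z ?w) - (if fits N m ?z then gexp (kick m ?z ?w) else 0)"
    using bdd_meas_kick[OF z boxu] bdd_meas_kick[OF _ boxu, of m ?z]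
    by (cases "fits N m ?z") (simp_all add: gibbs_diff)
  \<comment> \<open>At \<beta> = 0 the equations say nothing about the kicks; keeping the factor
    \<beta> covers this case.\<close>
  also have "\<beta> * \<dots> = \<beta> * gexp (kick m z ?w)"
  proof -
    have "gexp (kick m ?z ?w) = 0" if "\<beta> \<noteq> 0" "fits N m ?z"
    proof (rule gexp_kick_eq_zero[OF that(1) boxu that(2)])
      fix i assume i: "snd ?z \<le> i"
      have "fst z' \<noteq> fst (fst ?z, i) \<or> snd z' < snd (fst ?z, i)" if "z' \<in> fst ` set u" for z'
        using u[OF that] i by auto
      from rim_notin_word[OF this] show "rim m (fst ?z, i) \<notin> set ?w \<and> reversal (rim m (fst ?z, i))
          \<notin> set ?w"
        by blast
    qed
    then show ?thesis by auto
  qed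
  also have "gexp (kick m z ?w) = gexp (wil m (u @ [(z, False)])) - gexp (wil m (u @ [(z, True)]))"
    using boxu in_box_lasso[OF z]
    by (simp add: kick_def[abs_def] gibbs_diff bdd_meas_wilson letter_walk_def)
  finally have "\<beta> * gexp (SD_deform ?e ?c) = \<beta> * (gexp (wil m (u @ [(z, False)])) - gexp (wil m (u
      @ [(z, True)])))" .
  then show ?thesis
    using SD_gibbs[OF rim_in_I[OF z] bx] split by (simp add: mult.assoc)
qed

end

section \<open>Functions represented by power series\<close>

text \<open>Once the earlier coefficients vanish, division by x^n leaves a series that is 0 near 0
  and tends to \<open>c n\<close>.\<close>

lemma real_powser_zero:
  fixes c :: "nat \<Rightarrow> real"
  assumes "r > 0" "\<And>x. x \<noteq> 0 \<Longrightarrow> \<bar>x\<bar> < r \<Longrightarrow> (\<lambda>k. c k * x ^ k) sums 0"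
  shows "c n = 0"
proof (induction n rule: less_induct)
  case (less n)
  have "((\<lambda>_. 0) \<longlongrightarrow> c (0 + n)) (at (0 :: real))"
  proof (rule powser_limit_0_strong[OF assms(1)])
    fix x :: real assume x: "x \<noteq> 0" "norm x < r"
    have "(\<lambda>k. c (k + n) * x ^ (k + n)) sums (0 - (\<Sum>k<n. c k * x ^ k))"
      using assms(2)[of x] x by (intro sums_split_initial_segment) auto
    moreover have "(\<Sum>k<n. c k * x ^ k) = 0" using less by simp
    ultimately have "(\<lambda>k. c (k + n) * x ^ (k + n) / x ^ n) sums (0 / x ^ n)"
      by (intro sums_divide) simp
    then show "(\<lambda>k. c (k + n) * x ^ k) sums 0" using x by (simp add: power_add)
  qed
  then show ?case using tendsto_unique[OF _ _ tendsto_const[of "0 :: real" "at (0 :: real)"]] by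
      simp
qed

text \<open>The bridge by which identities between functions on an interval become identities of
  formal power series.\<close>

definition represents :: "real \<Rightarrow> real fps \<Rightarrow> (real \<Rightarrow> real) \<Rightarrow> bool" where
  "represents r f \<phi> \<longleftrightarrow> (\<forall>x. \<bar>x\<bar> < r \<longrightarrow> (\<lambda>k. fps_nth f k * x ^ k) sums \<phi> x)"

lemma represents_unique:
  assumes "r > 0" "represents r f \<phi>" "represents r g \<phi>"
  shows "f = g"
proof (rule fps_ext)
  fix n
  have "fps_nth f n - fps_nth g n = 0"
  proof (rule real_powser_zero[OF assms(1)])
    fix x :: real assume "\<bar>x\<bar> < r"
    then have "(\<lambda>k. fps_nth f k * x ^ k - fps_nth g k * x ^ k) sums (\<phi> x - \<phi> x)"
      using assms by (intro sums_diff) (auto simp: represents_def)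
    then show "(\<lambda>k. (fps_nth f k - fps_nth g k) * x ^ k) sums 0" by (simp add: algebra_simps)
  qed
  then show "fps_nth f n = fps_nth g n" by simp
qed

lemma represents_cong:
  "(\<And>x. \<bar>x\<bar> < r \<Longrightarrow> \<phi> x = \<psi> x) \<Longrightarrow> represents r f \<phi> \<Longrightarrow> represents r f \<psi>"
  by (simp add: represents_def)

lemma represents_diff:
  "represents r f \<phi> \<Longrightarrow> represents r g \<psi> \<Longrightarrow> represents r (f - g) (\<lambda>x. \<phi> x - \<psi> x)"
  unfolding represents_def by (auto simp: left_diff_distrib intro!: sums_diff)

lemma represents_add:
  "represents r f \<phi> \<Longrightarrow> represents r g \<psi> \<Longrightarrow> represents r (f + g) (\<lambda>x. \<phi> x + \<psi> x)"
  unfolding represents_def by (auto simp: distrib_right intro!: sums_add)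

lemma represents_const_mult:
  "represents r f \<phi> \<Longrightarrow> represents r (fps_const c * f) (\<lambda>x. c * \<phi> x)"
  unfolding represents_def by (auto simp: mult.assoc intro!: sums_mult)

lemma represents_const: "represents r (fps_const c) (\<lambda>_. c)"
proof -
  have "(\<lambda>k. fps_nth (fps_const c) k * x ^ k) sums c" for x :: real
    using sums_single[of 0 "\<lambda>_. c"] by (rule back_subst[where P = "\<lambda>f. f sums c"]) auto
  then show ?thesis by (simp add: represents_def)
qed

lemma represents_X_mult:
  assumes "represents r f \<phi>"
  shows "represents r (fps_X * f) (\<lambda>x. x * \<phi> x)"
  unfolding represents_def
proof (intro allI impI)
  fix x :: real assume "\<bar>x\<bar> < r"
  then have "(\<lambda>k. x * (fps_nth f k * x ^ k)) sums (x * \<phi> x)"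
    using assms by (intro sums_mult) (auto simp: represents_def)
  then have "(\<lambda>k. fps_nth (fps_X * f) (Suc k) * x ^ Suc k) sums (x * \<phi> x)"
    by (simp add: mult_ac)
  then show "(\<lambda>k. fps_nth (fps_X * f) k * x ^ k) sums (x * \<phi> x)"
    by (subst (asm) sums_Suc_iff) simp
qed

lemma represents_sum_list:
  "(\<And>c. c \<in> set cs \<Longrightarrow> represents r (f c) (\<phi> c)) \<Longrightarrow>
    represents r (\<Sum>c\<leftarrow>cs. f c) (\<lambda>x. \<Sum>c\<leftarrow>cs. \<phi> c x)"
  by (induction cs) (auto intro: represents_add represents_const[of r 0, simplified])

lemma represents_mult:
  assumes "represents r f \<phi>" "represents r g \<psi>"
    and "\<And>x. \<bar>x\<bar> < r \<Longrightarrow> summable (\<lambda>k. \<bar>fps_nth f k * x ^ k\<bar>)"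
    and "\<And>x. \<bar>x\<bar> < r \<Longrightarrow> summable (\<lambda>k. \<bar>fps_nth g k * x ^ k\<bar>)"
  shows "represents r (f * g) (\<lambda>x. \<phi> x * \<psi> x)"
  unfolding represents_def
proof (intro allI impI)
  fix x :: real assume x: "\<bar>x\<bar> < r"
  have "(\<lambda>k. \<Sum>i\<le>k. (fps_nth f i * x ^ i) * (fps_nth g (k - i) * x ^ (k - i))) sums
      ((\<Sum>k. fps_nth f k * x ^ k) * (\<Sum>k. fps_nth g k * x ^ k))"
    using assms(3,4)[OF x] by (intro Cauchy_product_sums) auto
  moreover have "(\<Sum>i\<le>k. (fps_nth f i * x ^ i) * (fps_nth g (k - i) * x ^ (k - i))) = fps_nth (f *
      g) k * x ^ k" for k
  proof -
    have "(fps_nth f i * x ^ i) * (fps_nth g (k - i) * x ^ (k - i)) = fps_nth f i * fps_nth g (k -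
        i) * x ^ k"
      if "i \<le> k" for i
    proof -
      have "x ^ k = x ^ i * x ^ (k - i)" using that by (simp flip: power_add)
      then show ?thesis by simp
    qed
    then show ?thesis
      unfolding fps_mult_nth sum_distrib_right atLeast0AtMost by (intro sum.cong) auto
  qed
  moreover have "(\<Sum>k. fps_nth f k * x ^ k) = \<phi> x" "(\<Sum>k. fps_nth g k * x ^ k) = \<psi> x"
    using assms(1,2) x by (auto simp: represents_def sums_iff)
  ultimately show "(\<lambda>k. fps_nth (f * g) k * x ^ k) sums (\<phi> x * \<psi> x)" by simp
qed

section \<open>Loops as words in lassos\<close>

text \<open>\<open>closed_walk\<close> indexes cyclically and has no base point; explicit end points
  allow recursion and concatenation.\<close>

fun is_path :: "vertex \<Rightarrow> edge list \<Rightarrow> vertex \<Rightarrow> bool" where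
  "is_path u [] v \<longleftrightarrow> u = v"
| "is_path u (c # p) v \<longleftrightarrow> c \<in> edges \<and> fst c = u \<and> is_path (snd c) p v"

lemma is_path_append: "is_path u (p @ q) v \<longleftrightarrow> (\<exists>x. is_path u p x \<and> is_path x q v)"
  by (induction p arbitrary: u) auto

lemma is_path_appendI: "is_path u p x \<Longrightarrow> is_path x q v \<Longrightarrow> is_path u (p @ q) v"
  unfolding is_path_append by blast

lemma is_path_edges: "is_path u p v \<Longrightarrow> set p \<subseteq> edges"
proof (induction p arbitrary: u)
  case (Cons c p)
  then have "c \<in> edges" "is_path (snd c) p v" by auto
  with Cons.IH[of "snd c"] show ?case by simp
qed simp

lemma is_path_rv: "is_path u p v \<Longrightarrow> is_path v (rv p) u"
  by (induction p arbitrary: u) (auto simp: is_path_append)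

lemma is_path_nth: "is_path u p v \<Longrightarrow> Suc i < length p \<Longrightarrow> snd (p ! i) = fst (p ! Suc i)"
proof (induction p arbitrary: u i)
  case (Cons c p)
  then show ?case by (cases i; cases p) auto
qed simp

lemma is_path_ends: "is_path u p v \<Longrightarrow> p \<noteq> [] \<Longrightarrow> fst (p ! 0) = u \<and> snd (last p) = v"
  by (induction p arbitrary: u) auto

lemma closed_walk_of_path:
  assumes p: "is_path u p u"
  shows "closed_walk p"
  unfolding closed_walk_def
proof (intro conjI allI impI)
  fix i assume i: "i < length p"
  show "snd (p ! i) = fst (p ! (Suc i mod length p))"
  proof (cases "Suc i = length p")
    case True
    then have "p ! i = last p" using i by (cases p rule: rev_cases) auto
    moreover have "p \<noteq> []" using i by auto
    ultimately show ?thesis using True is_path_ends[OF p] by simp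
  next
    case False then show ?thesis using i is_path_nth[OF p, of i] by simp
  qed
qed (rule is_path_edges[OF p])

lemma is_path_of_steps:
  "p \<noteq> [] \<Longrightarrow> set p \<subseteq> edges \<Longrightarrow> (\<And>i. Suc i < length p \<Longrightarrow> snd (p ! i) = fst (p ! Suc i)) \<Longrightarrow>
    is_path (fst (hd p)) p (snd (last p))"
proof (induction p)
  case (Cons c p)
  show ?case
  proof (cases "p = []")
    case False
    have "snd (p ! i) = fst (p ! Suc i)" if "Suc i < length p" for i
      using Cons.prems(3)[of "Suc i"] that by simp
    then have "is_path (fst (hd p)) p (snd (last p))" using Cons.IH False Cons.prems by simp
    moreover have "snd c = fst (hd p)" using Cons.prems(3)[of 0] False by (simp add: hd_conv_nth)
    ultimately show ?thesis using False Cons.prems by simp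
  qed (use Cons.prems in simp)
qed simp

lemma path_of_closed_walk:
  assumes p: "closed_walk p"
  obtains u where "is_path u p u"
proof (cases "p = []")
  case True then show ?thesis using that[of "(0, 0)"] by simp
next
  case False
  have step: "snd (p ! i) = fst (p ! (Suc i mod length p))" if "i < length p" for i
    using p that by (simp add: closed_walk_def)
  have "is_path (fst (hd p)) p (snd (last p))"
  proof (rule is_path_of_steps[OF False])
    show "snd (p ! i) = fst (p ! Suc i)" if "Suc i < length p" for i
      using step[of i] that by simp
  qed (use p in \<open>simp add: closed_walk_def\<close>)
  moreover have "snd (last p) = fst (hd p)"
    using step[of "length p - 1"] False by (simp add: last_conv_nth hd_conv_nth)
  ultimately show ?thesis using that by metis
qed

text \<open>A backtrack is rotated to the front, since it may straddle the end of the walk, and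
  deleted. Rotation moves the base point, so \<open>u\<close> varies in the induction.\<close>

lemma reduce_to_loop:
  assumes "is_path u p u"
  shows "\<exists>l. is_loop l \<and> set l \<subseteq> set p \<and> teq p l"
  using assms
proof (induction "length p" arbitrary: u p rule: less_induct)
  case less
  show ?case
  proof (cases "is_loop p")
    case True then show ?thesis using teq_refl[OF is_path_edges[OF less.prems]] by blast
  next
    case False
    then obtain i where i: "i < length p" "p ! (Suc i mod length p) = reversal (p ! i)"
      using closed_walk_of_path[OF less.prems] by (auto simp: is_loop_def)
    have ed: "set p \<subseteq> edges" by (rule is_path_edges[OF less.prems])
    have "p ! i \<in> edges" using i ed by auto
    then have nr: "reversal (p ! i) \<noteq> p ! i"
      by (cases "p ! i") (auto simp: reversal_def edges_def)
    \<comment> \<open>In a walk of length 1 the edge would follow itself and equal its own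
      reversal.\<close>
    have "length p \<noteq> 1" using i nr by auto
    then have n: "length p \<ge> 2" using i by linarith
    define q where "q = rotate i p"
    have q: "q = drop i p @ take i p" using i by (simp add: q_def rotate_drop_take)
    have q01: "q ! 0 = p ! i" "q ! 1 = reversal (p ! i)"
      using i n nth_rotate[of 0 p i] nth_rotate[of 1 p i] by (cases "p = []"; simp add: q_def)+
    obtain c d r where qr: "q = c # d # r"
      using n by (metis Suc_le_length_iff length_rotate numeral_2_eq_2 q_def)
    then have d: "d = reversal c" using q01 by simp
    obtain x where "is_path u (take i p) x" "is_path x (drop i p) u"
      using less.prems is_path_append[of u "take i p" "drop i p" u] by auto
    then have "is_path x q x" unfolding q by (rule is_path_appendI[rotated])
    then have r: "is_path x r x" and c: "c \<in> edges" by (auto simp: qr d)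
    have len: "length r < length p" using arg_cong[OF qr, of length] by (simp add: q_def)
    obtain l where l: "is_loop l" "set l \<subseteq> set r" "teq r l"
      using less.hyps[OF len r] by blast
    have "teq (take i p @ drop i p) (drop i p @ take i p)"
      using ed by (intro teq_rotate) (auto dest: in_set_takeD in_set_dropD)
    then have "teq p q" by (simp add: q)
    also have "teq q r"
      using weq_cancel_mid(1)[of "[c]" "[]" r] c is_path_edges[OF r]
      by (intro weq_imp_teq) (simp add: qr d)
    also note l(3)
    finally have "teq p l" .
    moreover have "set r \<subseteq> set p" using arg_cong[OF qr, of set] by (auto simp: q_def)
    ultimately show ?thesis using l by blast
  qed
qed

text \<open>No new edges are allowed, so the chosen loop lies in every box that contains the
  walk.\<close>

definition reduced :: "edge list \<Rightarrow> edge list" where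
  "reduced p = (SOME l. is_loop l \<and> set l \<subseteq> set p \<and> teq p l)"

lemma reduced:
  assumes "is_path u p u"
  shows "is_loop (reduced p)" "set (reduced p) \<subseteq> set p" "teq p (reduced p)"
  using someI_ex[OF reduce_to_loop[OF assms]] by (auto simp: reduced_def)

section \<open>Closed paths as words in lassos\<close>

definition corner :: "nat \<Rightarrow> vertex" where "corner m = (- int m, - int m)"

lemma is_path_tail: "is_path (corner m) (tail m x j) (int x - int m, int j - int m)"
proof (induction j)
  case 0
  show ?case
  proof (induction x)
    case (Suc x)
    then show ?case by (simp add: tail_def is_path_append) (auto simp: hedge_def algebra_simps)
  qed (simp add: tail_def corner_def)
next
  case (Suc j)
  moreover have "is_path (int x - int m, int j - int m) [vedge (int x - int m) (int j - int m)]
      (int x - int m, int (Suc j) - int m)"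
    by simp (simp add: vedge_def)
  ultimately show ?case unfolding tail_Suc by (rule is_path_appendI)
qed

lemma is_path_lasso: "is_path (corner m) (lasso m z) (corner m)"
proof -
  have "is_path (X, Y) (plaq X Y) (X, Y)" for X Y
    using edges_edge[of X] edges_edge[of "X + 1"] unfolding plaq_def
    by (simp del: edges_edge) (simp add: hedge_def vedge_def)
  then show ?thesis
    using is_path_tail[of m "fst z" "snd z"] is_path_rv[OF is_path_tail[of m "fst z" "snd z"]]
    unfolding lasso_def is_path_append by blast
qed

lemma is_path_word: "is_path (corner m) (word_walk m u) (corner m)"
proof (induction u)
  case (Cons c u)
  have "is_path (corner m) (letter_walk m c) (corner m)"
    using is_path_lasso is_path_rv[OF is_path_lasso] by (simp add: letter_walk_def)
  then show ?case unfolding word_walk_simps using Cons.IH by (rule is_path_appendI)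
qed simp

text \<open>The conversion by \<open>nat\<close> is faithful in the quadrant described by
  \<open>above\<close>.\<close>

definition tail_to :: "nat \<Rightarrow> vertex \<Rightarrow> edge list" where
  "tail_to m v = tail m (nat (fst v + int m)) (nat (snd v + int m))"

definition above :: "nat \<Rightarrow> vertex \<Rightarrow> bool" where
  "above m v \<longleftrightarrow> - int m \<le> fst v \<and> - int m \<le> snd v"

lemma weq_triangle:
  assumes "set h \<subseteq> edges" "c \<in> edges"
  shows "weq (h @ [c] @ rv (h @ [c])) []"
  using weq_cancel[of "h @ [c]"] assms by simp

text \<open>Induction up the column: multiplying the closed-up edge by the lasso of the plaquette
  above it gives the closed-up edge one row higher. In the bottom row the two tails differ by the
  edge itself, and the word is empty.\<close>

lemma hedge_word:
  "\<exists>u. weq (tail m x j @ [hedge (int x - int m) (int j - int m)] @ rv (tail m (Suc x) j))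
      (word_walk m u)"
proof (induction j)
  case 0
  have "tail m (Suc x) 0 = tail m x 0 @ [hedge (int x - int m) (int 0 - int m)]"
    by (simp add: tail_def)
  then show ?case
    using weq_triangle[OF tail_edges, of "hedge (int x - int m) (int 0 - int m)" m x 0]
    by (intro exI[of _ "[]"]) simp
next
  case (Suc j)
  then obtain u where u: "weq (tail m x j @ [hedge (int x - int m) (int j - int m)] @ rv (tail m
      (Suc x) j)) (word_walk m u)"
    by blast
  let ?T = "tail m x j" and ?T' = "tail m (Suc x) j"
  let ?h = "hedge (int x - int m) (int j - int m)" and ?h' = "hedge (int x - int m) (int (Suc j) -
      int m)"
  let ?v = "vedge (int x - int m) (int j - int m)" and ?v' = "vedge (int (Suc x) - int m) (int j -
      int m)"
  have L: "lasso m (x, j) = (?T @ [?v, ?h', reversal ?v']) @ [reversal ?h] @ rv ?T"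
    by (simp add: lasso_def plaq_def algebra_simps)
  have T: "set ?T \<subseteq> edges" "set ?T' \<subseteq> edges" by (rule tail_edges)+
  have "weq (word_walk m (((x, j), True) # u)) (lasso m (x, j) @ (?T @ [?h] @ rv ?T'))"
    using weq_append[OF weq_refl[OF lasso_edges] weq_sym[OF u], of m "(x, j)"]
    by (simp add: letter_walk_def)
  also have "lasso m (x, j) @ (?T @ [?h] @ rv ?T') =
      ((?T @ [?v, ?h', reversal ?v']) @ rv [?h]) @ rv ?T @ ?T @ ([?h] @ rv ?T')"
    by (simp add: L)
  also have "weq \<dots> (((?T @ [?v, ?h', reversal ?v']) @ rv [?h]) @ ([?h] @ rv ?T'))"
    by (rule weq_cancel_mid(2)) (use T set_rv_edges in auto)
  also have "((?T @ [?v, ?h', reversal ?v']) @ rv [?h]) @ ([?h] @ rv ?T') =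
      (?T @ [?v, ?h', reversal ?v']) @ rv [?h] @ [?h] @ rv ?T'" by simp
  also have "weq \<dots> ((?T @ [?v, ?h', reversal ?v']) @ rv ?T')"
    by (rule weq_cancel_mid(2)) (use T set_rv_edges in auto)
  also have "(?T @ [?v, ?h', reversal ?v']) @ rv ?T' =
      tail m x (Suc j) @ [?h'] @ rv (tail m (Suc x) (Suc j))"
    by (simp add: tail_Suc)
  finally show ?case using weq_sym by blast
qed

text \<open>The tails form a comb-shaped spanning tree of the quadrant. Vertical edges lie in the
  tree and give the empty word; horizontal ones climb their column.\<close>

lemma edge_word:
  assumes "c \<in> edges" "above m (fst c)" "above m (snd c)"
  shows "\<exists>u. weq (tail_to m (fst c) @ [c] @ rv (tail_to m (snd c))) (word_walk m u)"
proof -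
  have pos: "\<exists>u. weq (tail_to m (fst c) @ [c] @ rv (tail_to m (snd c))) (word_walk m u)"
    if "above m (fst c)" "above m (snd c)" "c = hedge X Y \<or> c = vedge X Y" for c X Y
  proof -
    define x j where "x = nat (X + int m)" and "j = nat (Y + int m)"
    have XY: "X = int x - int m" "Y = int j - int m"
      using that by (auto simp: above_def hedge_def vedge_def x_def j_def)
    from that(3) show ?thesis
    proof
      assume c: "c = hedge X Y"
      have "tail_to m (fst c) = tail m x j" "tail_to m (snd c) = tail m (Suc x) j"
        by (simp_all add: c tail_to_def hedge_def XY nat_add_distrib)
      then show ?thesis using hedge_word[of m x j] by (simp add: c XY)
    next
      assume c: "c = vedge X Y"
      have "tail_to m (fst c) = tail m x j" "tail_to m (snd c) = tail m x j @ [c]"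
        by (simp_all add: c tail_to_def vedge_def XY nat_add_distrib tail_Suc)
      then show ?thesis
        using weq_triangle[OF tail_edges assms(1), of m x j] weq_triangle[OF tail_edges
            edges_edge(2)[of X Y], of m x j]
        by (intro exI[of _ "[]"]) (simp add: c)
    qed
  qed
  have neg: "\<exists>u. weq (tail_to m (fst c) @ [c] @ rv (tail_to m (snd c))) (word_walk m u)"
    if d: "\<exists>u. weq (tail_to m (fst d) @ [d] @ rv (tail_to m (snd d))) (word_walk m u)" "c =
        reversal d" for d
  proof -
    obtain u where "weq (tail_to m (fst d) @ [d] @ rv (tail_to m (snd d))) (word_walk m u)"
      using d(1) by blast
    from weq_rv[OF this] show ?thesis
      using d(2) by (intro exI[of _ "winv flip u"]) (simp add: word_walk_winv)
  qed
  show ?thesis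
    using assms(1)
  proof (cases rule: edges_cases)
    case (1 x y) then show ?thesis using pos assms by blast
  next
    case (2 x y) then show ?thesis using pos assms by blast
  next
    case (3 x y)
    then show ?thesis using pos[of "hedge x y" x y] assms by (intro neg[of "hedge x y"]) auto
  next
    case (4 x y)
    then show ?thesis using pos[of "vedge x y" x y] assms by (intro neg[of "vedge x y"]) auto
  qed
qed

text \<open>At each inner vertex the tail and its inverse are inserted, which closes up every edge
  separately.\<close>

lemma path_word:
  assumes "is_path v p v'" "above m v" "\<And>c. c \<in> set p \<Longrightarrow> above m (snd c)"
  shows "\<exists>u. weq (tail_to m v @ p @ rv (tail_to m v')) (word_walk m u)"
  using assms
proof (induction p arbitrary: v)
  case Nil
  then show ?case
    using weq_cancel[OF tail_edges] by (intro exI[of _ "[]"]) (simp add: tail_to_def)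
next
  case (Cons c p)
  obtain u1 where u1: "weq (tail_to m (fst c) @ [c] @ rv (tail_to m (snd c))) (word_walk m u1)"
    using edge_word[of c m] Cons.prems by auto
  obtain u2 where u2: "weq (tail_to m (snd c) @ p @ rv (tail_to m v')) (word_walk m u2)"
    using Cons.IH[of "snd c"] Cons.prems by auto
  have T: "set (tail_to m w) \<subseteq> edges" for w by (simp add: tail_to_def tail_edges)
  have "weq (word_walk m (u1 @ u2)) ((tail_to m (fst c) @ [c] @ rv (tail_to m (snd c))) @ (tail_to
      m (snd c) @ p @ rv (tail_to m v')))"
    unfolding word_walk_simps by (rule weq_sym[OF weq_append[OF u1 u2]])
  also have "\<dots> = (tail_to m (fst c) @ [c]) @ rv (tail_to m (snd c)) @ tail_to m (snd c) @ (p @ rv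
      (tail_to m v'))" by simp
  also have "weq \<dots> ((tail_to m (fst c) @ [c]) @ (p @ rv (tail_to m v')))"
    using T is_path_edges[OF Cons.prems(1)] set_rv_edges[of "tail_to m v'"]
    by (intro weq_cancel_mid(2)) auto
  finally have "weq (word_walk m (u1 @ u2)) (tail_to m v @ (c # p) @ rv (tail_to m v'))"
    using Cons.prems by simp
  then show ?case using weq_sym by blast
qed

lemma loop_word:
  assumes p: "is_path v p v"
  obtains m u where "teq p (word_walk m u)"
proof -
  \<comment> \<open>A crude bound for all coordinates along the path, placing it in the
    quadrant.\<close>
  define m where "m = nat (\<bar>fst v\<bar> + \<bar>snd v\<bar> + (\<Sum>c\<leftarrow>p. \<bar>fst (snd c)\<bar> + \<bar>snd (snd c)\<bar>))"
  have le: "\<bar>fst (snd c)\<bar> + \<bar>snd (snd c)\<bar> \<le> (\<Sum>c\<leftarrow>p. \<bar>fst (snd c)\<bar> + \<bar>snd (snd c)\<bar>)" if "c \<in> set p"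
      for c
    using that by (intro member_le_sum_list) auto
  have nn: "(\<Sum>c\<leftarrow>p. \<bar>fst (snd c)\<bar> + \<bar>snd (snd c)\<bar>) \<ge> 0" by (intro sum_list_nonneg) auto
  have "above m v" using nn by (auto simp: above_def m_def)
  moreover have "above m (snd c)" if "c \<in> set p" for c
    using le[OF that] by (auto simp: above_def m_def)
  ultimately obtain u where u: "weq (tail_to m v @ p @ rv (tail_to m v)) (word_walk m u)"
    using path_word[OF p] by blast
  have "teq (rv (rv (tail_to m v)) @ p @ rv (tail_to m v)) p"
    using is_path_edges[OF p] tail_edges set_rv_edges by (intro teq_conj) (auto simp: tail_to_def)
  then have "teq p (tail_to m v @ p @ rv (tail_to m v))" using teq_sym by simp
  then have "teq p (word_walk m u)" using weq_imp_teq[OF u] teq_trans by blast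
  then show ?thesis by (rule that)
qed

section \<open>The limit\<close>

lemma exhaustion_box: "exhaustion sq_box"
proof -
  have "(x, y) \<in> (\<Union>N. sq_box N)" for x y
    by (rule UN_I[of "nat (\<bar>x\<bar> + \<bar>y\<bar>)"]) (auto simp: sq_box_def)
  then have "(\<Union>N. sq_box N) = UNIV" by auto
  moreover have "incseq sq_box" by (rule incseq_SucI) (auto simp: sq_box_def)
  ultimately show ?thesis by (auto simp: exhaustion_def sq_box_def)
qed

lemma eventually_in_box:
  assumes "finite A"
  shows "\<forall>\<^sub>F N in sequentially. A \<subseteq> sq_box N \<times> sq_box N"
proof -
  have "\<forall>\<^sub>F N in sequentially. c \<in> sq_box N \<times> sq_box N" for c :: edge
  proof -
    obtain x y x' y' where c: "c = ((x, y), (x', y'))" by (metis surj_pair)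
    show ?thesis unfolding c
      by (rule eventually_sequentiallyI[of "nat (\<bar>x\<bar> + \<bar>y\<bar> + \<bar>x'\<bar> + \<bar>y'\<bar>)"]) (auto simp: sq_box_def)
  qed
  then have "\<forall>\<^sub>F N in sequentially. \<forall>c\<in>A. c \<in> sq_box N \<times> sq_box N"
    using assms by (simp add: eventually_ball_finite)
  then show ?thesis by (rule eventually_mono) blast
qed

lemma eventually_fits: "\<forall>\<^sub>F N in sequentially. fits N m z"
  by (rule eventually_sequentiallyI[of "m + fst z + snd z + 1"]) (auto simp: fits_def)

lemma tendsto_sum_list:
  fixes f :: "'a \<Rightarrow> nat \<Rightarrow> real"
  shows "(\<And>x. x \<in> set xs \<Longrightarrow> (f x \<longlongrightarrow> g x) F) \<Longrightarrow> ((\<lambda>n. \<Sum>x\<leftarrow>xs. f x n) \<longlongrightarrow> (\<Sum>x\<leftarrow>xs. g x)) F"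
  by (induction xs) (auto intro!: tendsto_add)

lemma LIMSEQ_eventually_unique:
  fixes A B :: real
  assumes "f \<longlonglongrightarrow> A" "g \<longlonglongrightarrow> B" "\<forall>\<^sub>F n in sequentially. f n = g n"
  shows "A = B"
  using LIMSEQ_unique[OF assms(1) iffD2[OF tendsto_cong[OF assms(3)] assms(2)]] .

locale strong_coupling_limit =
  fixes haar :: "nat \<Rightarrow> real mat measure" and \<beta>\<^sub>0 :: real
    and w :: "edge list \<Rightarrow> real \<Rightarrow> real" and a :: "edge list \<Rightarrow> nat \<Rightarrow> real"
  assumes haar: "\<And>N. N \<ge> 1 \<Longrightarrow> is_haar_prob N (haar N)"
    and sc: "strong_coupling haar \<beta>\<^sub>0 w a"
begin

lemma \<beta>\<^sub>0: "\<beta>\<^sub>0 > 0"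
  using sc by (simp add: strong_coupling_def)

abbreviation "ge \<beta> N \<equiv> gibbs_expectation haar (sq_box N) N \<beta>"

lemma lasso_box: "N \<ge> 1 \<Longrightarrow> lasso_box N haar"
  by (simp add: lasso_box_def haar)

text \<open>Lasso words backtrack, and \<open>w\<close> and \<open>a\<close> are only constrained on loops.\<close>

definition w' :: "edge list \<Rightarrow> real \<Rightarrow> real" where
  "w' p = w (reduced p)"

text \<open>Once the box contains the paths it contains their reductions, and the two products agree
  on all configurations.\<close>

lemma lim_prod:
  assumes "\<bar>\<beta>\<bar> < \<beta>\<^sub>0" and ps: "\<And>p. p \<in> set ps \<Longrightarrow> \<exists>u. is_path u p u"
  shows "(\<lambda>N. ge \<beta> N (\<lambda>Q. \<Prod>p\<leftarrow>ps. wilson N p Q) / real N ^ length ps) \<longlonglongrightarrow> (\<Prod>p\<leftarrow>ps. w' p \<beta>)"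
proof -
  let ?ls = "map reduced ps"
  have "\<forall>l\<in>set ?ls. is_loop l" using ps reduced(1) by auto
  then have lim: "(\<lambda>N. ge \<beta> N (\<lambda>Q. \<Prod>l\<leftarrow>?ls. wilson N l Q) / real N ^ length ?ls) \<longlonglongrightarrow> (\<Prod>l\<leftarrow>?ls. w l \<beta>)"
    using sc assms(1) exhaustion_box unfolding strong_coupling_def by blast
  have fin: "finite (\<Union>p\<in>set ps. set p)" by simp
  have "\<forall>\<^sub>F N in sequentially. ge \<beta> N (\<lambda>Q. \<Prod>p\<leftarrow>ps. wilson N p Q) / real N ^ length ps
      = ge \<beta> N (\<lambda>Q. \<Prod>l\<leftarrow>?ls. wilson N l Q) / real N ^ length ?ls"
    using eventually_ge_at_top[of 1] eventually_in_box[OF fin]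
  proof (eventually_elim)
    case (elim N)
    interpret lasso_box N haar \<beta> by (rule lasso_box[OF elim(1)])
    have eq: "wilson N p Q = wilson N (reduced p) Q" if mem: "p \<in> set ps" "Q \<in> space
        (config_measure haar (sq_box N) N)" for p Q
    proof -
      obtain u where u: "is_path u p u" using ps mem(1) by blast
      have "set p \<subseteq> edges \<inter> sq_box N \<times> sq_box N" using elim(2) mem(1) is_path_edges[OF u] by auto
      moreover from this have "set (reduced p) \<subseteq> edges \<inter> sq_box N \<times> sq_box N" using reduced(2)[OF
          u] by blast
      ultimately show ?thesis using reduced(3)[OF u] mem(2) by (intro wilson_teq) (auto simp:
          in_box_def)
    qed
    have "ge \<beta> N (\<lambda>Q. \<Prod>p\<leftarrow>ps. wilson N p Q) = ge \<beta> N (\<lambda>Q. \<Prod>l\<leftarrow>?ls. wilson N l Q)"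
    proof (rule gibbs_cong)
      fix Q assume "Q \<in> space (config_measure haar (sq_box N) N)"
      then show "(\<Prod>p\<leftarrow>ps. wilson N p Q) = (\<Prod>l\<leftarrow>?ls. wilson N l Q)"
        using eq by (auto intro!: arg_cong[where f = prod_list] map_cong)
    qed
    then show ?case by simp
  qed
  from tendsto_cong[OF this] lim
  have "(\<lambda>N. ge \<beta> N (\<lambda>Q. \<Prod>p\<leftarrow>ps. wilson N p Q) / real N ^ length ps) \<longlonglongrightarrow> (\<Prod>l\<leftarrow>?ls. w l \<beta>)"
    by blast
  then show ?thesis by (simp add: w'_def o_def)
qed

lemma lim_one:
  assumes "\<bar>\<beta>\<bar> < \<beta>\<^sub>0" "is_path u p u"
  shows "(\<lambda>N. ge \<beta> N (wilson N p) / real N) \<longlonglongrightarrow> w' p \<beta>"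
proof -
  have "\<exists>u. is_path u q u" if "q \<in> set [p]" for q using assms(2) that by (metis empty_iff list.set
      set_ConsD)
  from lim_prod[of \<beta> "[p]", OF assms(1) this] show ?thesis by simp
qed

lemma lim_two:
  assumes "\<bar>\<beta>\<bar> < \<beta>\<^sub>0" "is_path u p u" "is_path v q v"
  shows "(\<lambda>N. ge \<beta> N (\<lambda>Q. wilson N p Q * wilson N q Q) / (real N)\<^sup>2) \<longlonglongrightarrow> w' p \<beta> * w' q \<beta>"
proof -
  have "\<exists>u. is_path u r u" if "r \<in> set [p, q]" for r
    using assms(2,3) that by (metis empty_iff list.set set_ConsD)
  from lim_prod[of \<beta> "[p, q]", OF assms(1) this] show ?thesis by (simp add: power2_eq_square)
qed

definition W :: "edge list \<Rightarrow> real fps" where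
  "W p = Abs_fps (a (reduced p))"

lemma W_represents:
  assumes "is_path u p u"
  shows "represents \<beta>\<^sub>0 (W p) (w' p)"
    and "\<And>x. \<bar>x\<bar> < \<beta>\<^sub>0 \<Longrightarrow> summable (\<lambda>k. \<bar>fps_nth (W p) k * x ^ k\<bar>)"
proof -
  have *: "summable (\<lambda>k. \<bar>a (reduced p) k * x ^ k\<bar>)" "w (reduced p) x = (\<Sum>k. a (reduced p) k * x ^
      k)"
    if "\<bar>x\<bar> < \<beta>\<^sub>0" for x
    using sc reduced(1)[OF assms] that unfolding strong_coupling_def by blast+
  show "represents \<beta>\<^sub>0 (W p) (w' p)"
    unfolding represents_def
    using * summable_rabs_cancel by (auto simp: W_def w'_def intro!: summable_sums)
  show "summable (\<lambda>k. \<bar>fps_nth (W p) k * x ^ k\<bar>)" if "\<bar>x\<bar> < \<beta>\<^sub>0" for x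
    using *(1)[OF that] by (simp add: W_def)
qed

lemma lim_teq:
  assumes "teq p q"
  shows "\<forall>\<^sub>F N in sequentially. ge \<beta> N (wilson N p) / real N = ge \<beta> N (wilson N q) / real N"
  using eventually_ge_at_top[of 1] eventually_in_box[of "set p \<union> set q", OF finite_UnI[OF
      finite_set finite_set]]
proof eventually_elim
  case (elim N)
  interpret lasso_box N haar \<beta> by (rule lasso_box[OF elim(1)])
  have "set p \<subseteq> edges \<inter> sq_box N \<times> sq_box N" "set q \<subseteq> edges \<inter> sq_box N \<times> sq_box N"
    using elim(2) assms by (auto simp: teq_def)
  then have "ge \<beta> N (wilson N p) = ge \<beta> N (wilson N q)"
    using assms by (intro gibbs_cong wilson_teq) (auto simp: in_box_def)
  then show ?case by simp
qed

lemma w'_teq: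
  assumes "teq p q" "is_path u p u" "is_path v q v" "\<bar>\<beta>\<bar> < \<beta>\<^sub>0"
  shows "w' p \<beta> = w' q \<beta>"
  by (rule LIMSEQ_eventually_unique[OF lim_one[OF assms(4,2)] lim_one[OF assms(4,3)] lim_teq[OF
      assms(1)]])

lemma W_teq:
  assumes "teq p q" "is_path u p u" "is_path v q v"
  shows "W p = W q"
  using W_represents(1)[OF assms(3)] represents_cong[OF w'_teq[OF assms] W_represents(1)[OF
      assms(2)]]
  by (intro represents_unique[OF \<beta>\<^sub>0])

text \<open>The empty product in the factorization property says that the expectation of 1 tends to
  1, and the Wilson variable of the empty walk is N.\<close>

lemma w'_Nil:
  assumes "\<bar>\<beta>\<bar> < \<beta>\<^sub>0"
  shows "w' [] \<beta> = 1"
proof -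
  have "(\<lambda>N. ge \<beta> N (wilson N []) / real N) \<longlonglongrightarrow> w' [] \<beta>"
    by (rule lim_one[OF assms]) simp
  moreover have "(\<lambda>N. ge \<beta> N (\<lambda>_. 1)) \<longlonglongrightarrow> 1"
    using lim_prod[OF assms, of "[]"] by simp
  moreover have "\<forall>\<^sub>F N in sequentially. ge \<beta> N (wilson N []) / real N = ge \<beta> N (\<lambda>_. 1)"
    using eventually_ge_at_top[of 1]
  proof eventually_elim
    case (elim N)
    interpret lasso_box N haar \<beta> by (rule lasso_box[OF elim])
    have "wilson N [] = (\<lambda>_. real N * 1)" by (auto simp: wilson_def mat_trace_def)
    then show ?case using gibbs_cmult[OF bdd_meas_const, of "real N" 1] elim by simp
  qed
  ultimately show ?thesis by (rule LIMSEQ_eventually_unique)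
qed

abbreviation "Ww m u \<equiv> W (word_walk m u)"

text \<open>The equation \<open>word_SD\<close> is divided by N^2. Products of two traces factorize
  in the limit, while the single trace is divided by one N too many and vanishes.\<close>

lemma master_value:
  assumes \<beta>: "\<bar>\<beta>\<bar> < \<beta>\<^sub>0" and u: "\<And>z'. z' \<in> fst ` set u \<Longrightarrow> snd z' \<le> snd z"
  shows "(\<Sum>(s, P, S)\<leftarrow>cuts flip (z, True) u. s * (w' (word_walk m P) \<beta> * w' (word_walk m S) \<beta>)) =
    \<beta> * (w' (word_walk m (u @ [(z, False)])) \<beta> - w' (word_walk m (u @ [(z, True)])) \<beta>)"
proof -
  let ?L = "\<lambda>N. \<Sum>(s, P, S)\<leftarrow>cuts flip (z, True) u. s * (ge \<beta> N (\<lambda>Q. wilson N (word_walk m P) Q *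
      wilson N (word_walk m S) Q) / (real N)\<^sup>2
      - ge \<beta> N (wilson N (word_walk m (P @ winv flip S))) / real N / real N)"
  let ?R = "\<lambda>N. \<beta> * (ge \<beta> N (wilson N (word_walk m (u @ [(z, False)]))) / real N
      - ge \<beta> N (wilson N (word_walk m (u @ [(z, True)]))) / real N)"
  have "\<forall>\<^sub>F N in sequentially. \<forall>z'\<in>fst ` set u. fits N m z'"
    by (intro eventually_ball_finite ballI eventually_fits) auto
  then have "\<forall>\<^sub>F N in sequentially. ?L N = ?R N"
    using eventually_ge_at_top[of 1] eventually_fits[of m z]
  proof eventually_elim
    case (elim N)
    interpret lasso_box N haar \<beta> by (rule lasso_box[OF elim(2)])
    have "?L N = (\<Sum>(s, P, S)\<leftarrow>cuts flip (z, True) u. s * (gexp (\<lambda>Q. wil m P Q * wil m S Q) - gexp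
        (wil m (P @ winv flip S)))) / (real N)\<^sup>2"
      unfolding divide_inverse sum_list_mult_const[symmetric]
      by (simp add: case_prod_unfold algebra_simps power2_eq_square)
    also have "\<dots> = real N * \<beta> * (gexp (wil m (u @ [(z, False)])) - gexp (wil m (u @ [(z, True)])))
        / (real N)\<^sup>2"
      by (subst word_SD) (use elim u in auto)
    also have "\<dots> = ?R N"
      using elim(2) by (simp add: power2_eq_square field_simps)
    finally show ?case .
  qed
  moreover have "?L \<longlonglongrightarrow> (\<Sum>(s, P, S)\<leftarrow>cuts flip (z, True) u. s * (w' (word_walk m P) \<beta> * w' (word_walk
      m S) \<beta>))"
  proof (rule tendsto_sum_list)
    fix c assume "c \<in> set (cuts flip (z, True) u)"
    obtain s P S where [simp]: "c = (s, P, S)" by (cases c)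
    have "(\<lambda>N. s * (ge \<beta> N (\<lambda>Q. wilson N (word_walk m P) Q * wilson N (word_walk m S) Q) / (real
        N)\<^sup>2
        - ge \<beta> N (wilson N (word_walk m (P @ winv flip S))) / real N / real N))
        \<longlonglongrightarrow> s * (w' (word_walk m P) \<beta> * w' (word_walk m S) \<beta> - 0)"
      by (intro tendsto_mult tendsto_diff tendsto_const lim_two[OF \<beta> is_path_word is_path_word]
          tendsto_divide_0[OF lim_one[OF \<beta> is_path_word]]
          filterlim_at_top_imp_at_infinity[OF filterlim_real_sequentially])
    then show "(\<lambda>N. case c of (s, P, S) \<Rightarrow> s * (ge \<beta> N (\<lambda>Q. wilson N (word_walk m P) Q * wilson N
        (word_walk m S) Q) / (real N)\<^sup>2
        - ge \<beta> N (wilson N (word_walk m (P @ winv flip S))) / real N / real N))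
        \<longlonglongrightarrow> (case c of (s, P, S) \<Rightarrow> s * (w' (word_walk m P) \<beta> * w' (word_walk m S) \<beta>))"
      by simp
  qed
  moreover have "?R \<longlonglongrightarrow> \<beta> * (w' (word_walk m (u @ [(z, False)])) \<beta> - w' (word_walk m (u @ [(z,
      True)])) \<beta>)"
    by (intro tendsto_mult tendsto_diff tendsto_const lim_one[OF \<beta> is_path_word])
  ultimately show ?thesis using LIMSEQ_eventually_unique by blast
qed

lemma W_word_rotate: "Ww m (u @ v) = Ww m (v @ u)"
  using teq_rotate[OF word_walk_edges word_walk_edges, of m u m v]
  by (intro W_teq[OF _ is_path_word is_path_word]) simp

lemma W_master:
  assumes "\<And>z'. z' \<in> fst ` set u \<Longrightarrow> snd z' \<le> snd z"
  shows "(\<Sum>(s, P, S)\<leftarrow>cuts flip (z, True) u. fps_const s * (Ww m P * Ww m S)) =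
    fps_X * (Ww m ((z, False) # u) - Ww m ((z, True) # u))"
proof (rule represents_unique[OF \<beta>\<^sub>0])
  let ?\<phi> = "\<lambda>x. \<Sum>c\<leftarrow>cuts flip (z, True) u. (case c of (s, P, S) \<Rightarrow> \<lambda>x. s * (w' (word_walk m P) x *
      w' (word_walk m S) x)) x"
  show "represents \<beta>\<^sub>0 (\<Sum>(s, P, S)\<leftarrow>cuts flip (z, True) u. fps_const s * (Ww m P * Ww m S)) ?\<phi>"
  proof (rule represents_sum_list)
    fix c assume "c \<in> set (cuts flip (z, True) u)"
    obtain s P S where [simp]: "c = (s, P, S)" by (cases c)
    have "represents \<beta>\<^sub>0 (fps_const s * (Ww m P * Ww m S)) (\<lambda>x. s * (w' (word_walk m P) x * w'
        (word_walk m S) x))"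
      by (intro represents_const_mult represents_mult W_represents[OF is_path_word])
    then show "represents \<beta>\<^sub>0 (case c of (s, P, S) \<Rightarrow> fps_const s * (Ww m P * Ww m S))
        (case c of (s, P, S) \<Rightarrow> \<lambda>x. s * (w' (word_walk m P) x * w' (word_walk m S) x))"
      by simp
  qed
  have "represents \<beta>\<^sub>0 (fps_X * (Ww m (u @ [(z, False)]) - Ww m (u @ [(z, True)])))
      (\<lambda>x. x * (w' (word_walk m (u @ [(z, False)])) x - w' (word_walk m (u @ [(z, True)])) x))"
    by (intro represents_X_mult represents_diff W_represents(1)[OF is_path_word])
  then show "represents \<beta>\<^sub>0 (fps_X * (Ww m ((z, False) # u) - Ww m ((z, True) # u))) ?\<phi>"
    unfolding W_word_rotate[of m u "[(z, False)]"] W_word_rotate[of m u "[(z, True)]"] append.simps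
    by (rule represents_cong[rotated])
      (subst master_value[OF _ assms, symmetric], auto simp: case_prod_unfold)
qed

text \<open>The rank of a lasso is its row, as the master equation for \<open>z\<close> concerns
  words that do not rise above the row of \<open>z\<close>.\<close>

lemma fps_poly_W_word: "fps_poly (Ww m u)"
proof (rule fps_poly_words[where rank = snd and F = "fst ` set u"])
  have "represents \<beta>\<^sub>0 (Ww m []) (\<lambda>_. 1)"
    using represents_cong[OF w'_Nil W_represents(1)[OF is_path_word[of m "[]", unfolded
        word_walk_simps]]]
    by simp
  moreover have "represents \<beta>\<^sub>0 1 (\<lambda>_. 1)" using represents_const[of \<beta>\<^sub>0 1] by simp
  ultimately show "Ww m [] = 1" by (rule represents_unique[OF \<beta>\<^sub>0])
  show "Ww m (u @ v) = Ww m (v @ u)" for u v by (rule W_word_rotate)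
  show "Ww m (winv flip u) = Ww m u" for u
    using teq_rv[OF word_walk_edges, of m u]
    by (intro W_teq[OF _ is_path_word is_path_word]) (simp add: word_walk_winv)
  show "Ww m (flip c # c # u) = Ww m u" for c u
    using weq_cancel_mid(2)[OF letter_walk_edges[of m c] _ word_walk_edges[of m u], of "[]"]
    by (intro W_teq[OF weq_imp_teq is_path_word is_path_word]) (simp add: letter_walk_flip)
  show "(\<Sum>(s, P, S)\<leftarrow>cuts flip (y, True) u. fps_const s * (Ww m P * Ww m S)) =
      fps_X * (Ww m ((y, False) # u) - Ww m ((y, True) # u))"
    if "\<And>z. z \<in> fst ` set u \<Longrightarrow> snd z \<le> snd y" for y u
    by (rule W_master[OF that])
qed auto

text \<open>\<open>l\<close> is itself a loop, so its own limit is compared with that of its word;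
  uniqueness of power series then identifies the coefficients.\<close>

lemma loop_fps_poly:
  assumes "is_loop l"
  shows "fps_poly (Abs_fps (a l))" "\<bar>x\<bar> < \<beta>\<^sub>0 \<Longrightarrow> (\<lambda>k. a l k * x ^ k) sums w l x"
proof -
  obtain v where v: "is_path v l v" using path_of_closed_walk assms by (auto simp: is_loop_def)
  obtain m u where u: "teq l (word_walk m u)" using loop_word[OF v] .
  have sums: "(\<lambda>k. a l k * x ^ k) sums w l x" if "\<bar>x\<bar> < \<beta>\<^sub>0" for x
  proof -
    have "summable (\<lambda>k. \<bar>a l k * x ^ k\<bar>)" "w l x = (\<Sum>k. a l k * x ^ k)"
      using sc assms that unfolding strong_coupling_def by blast+
    then show ?thesis using summable_rabs_cancel by (simp add: summable_sums)
  qed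
  then show "\<bar>x\<bar> < \<beta>\<^sub>0 \<Longrightarrow> (\<lambda>k. a l k * x ^ k) sums w l x" .
  have "w' (word_walk m u) x = w l x" if x: "\<bar>x\<bar> < \<beta>\<^sub>0" for x
  proof -
    have "(\<lambda>N. ge x N (wilson N l) / real N) \<longlonglongrightarrow> w l x"
      using sc assms x exhaustion_box unfolding strong_coupling_def by blast
    from LIMSEQ_eventually_unique[OF this lim_one[OF x is_path_word] lim_teq[OF u]]
    show ?thesis by simp
  qed
  then have "represents \<beta>\<^sub>0 (Ww m u) (w l)"
    using represents_cong W_represents(1)[OF is_path_word] by blast
  moreover have "represents \<beta>\<^sub>0 (Abs_fps (a l)) (w l)" using sums by (simp add: represents_def)
  ultimately have "Abs_fps (a l) = Ww m u" using represents_unique[OF \<beta>\<^sub>0] by blast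
  then show "fps_poly (Abs_fps (a l))" using fps_poly_W_word by simp
qed

end

theorem theorem2p11:
  fixes haar :: "nat \<Rightarrow> real mat measure"
    and \<beta>\<^sub>0 :: real
    and w :: "edge list \<Rightarrow> real \<Rightarrow> real"
    and a :: "edge list \<Rightarrow> nat \<Rightarrow> real"
    and l :: "edge list"
  assumes "\<And>N. N \<ge> 1 \<Longrightarrow> is_haar_prob N (haar N)"
    and "strong_coupling haar \<beta>\<^sub>0 w a"
    and "is_loop l"
  shows "\<exists>k\<^sub>0. (\<forall>k > k\<^sub>0. a l k = 0) \<and>
           (\<forall>\<beta>. \<bar>\<beta>\<bar> < \<beta>\<^sub>0 \<longrightarrow> w l \<beta> = (\<Sum>k\<le>k\<^sub>0. a l k * \<beta> ^ k))"
proof -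
  interpret strong_coupling_limit haar \<beta>\<^sub>0 w a
    by standard (use assms in auto)
  obtain k\<^sub>0 where k: "\<And>k. k > k\<^sub>0 \<Longrightarrow> a l k = 0"
    using fps_poly_bound[OF loop_fps_poly(1)[OF assms(3)]] by auto
  have "w l \<beta> = (\<Sum>k\<le>k\<^sub>0. a l k * \<beta> ^ k)" if "\<bar>\<beta>\<bar> < \<beta>\<^sub>0" for \<beta>
  proof -
    have "(\<lambda>k. a l k * \<beta> ^ k) sums (\<Sum>k\<le>k\<^sub>0. a l k * \<beta> ^ k)"
      by (rule sums_finite) (use k in \<open>auto simp: not_le\<close>)
    then show ?thesis using loop_fps_poly(2)[OF assms(3) that] sums_unique2 by blast
  qed
  then show ?thesis using k by blast
qed

end
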